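(* There exists an absolute constant $M_1>0$ such that the following holds. Let $0<\mu,\nu,\lambda<\infty$ satisfy $\mu\nu^{-1}\lambda^{1/2}\le M_1$, and let $\omega_L$ be the Lamb dipole with parameters $\lambda$ and $W=\mu\lambda/(c_0^2\pi)$. Then the set of minimizers is exactly the set of translates of the Lamb dipole: $$S_{\mu,\nu,\lambda}=\left\{\omega_L(\cdot+y) : y\in\partial\mathbb{R}^2_+\right\}.$$
   Context: $\mathbb{R}^2_+=\{x=(x_1,x_2)\in\mathbb{R}^2 : x_2>0\}$, $\partial\mathbb{R}^2_+=\{(y_1,0): y_1\in\mathbb{R}\}$. Let $$G(x,y)=\frac{1}{4\pi}\log\left(1+\frac{4x_2y_2}{|x-y|^2}\right),\quad x,y\in\mathbb{R}^2_+,$$ $$E[\omega]=\frac12\int_{\mathbb{R}^2_+}\int_{\mathbb{R}^2_+}G(x,y)\omega(x)\omega(y)\,dx\,dy,\qquad E_{2,\lambda}[\omega]=E[\omega]-\frac{1}{2\lambda}\int_{\mathbb{R}^2_+}\omega^2\,dx,$$ $$K_{\mu,\nu}=\left\{\omega\in L^2(\mathbb{R}^2_+) : \omega\ge0,\ \int_{\mathbb{R}^2_+}x_2\omega\,dx=\mu,\ \int_{\mathbb{R}^2_+}\omega\,dx\le\nu\right\},\qquad I_{\mu,\nu,\lambda}=\inf_{\omega\in K_{\mu,\nu}}\{-E_{2,\lambda}[\omega]\}.$$ $S_{\mu,\nu,\lambda}=\{\omega\in K_{\mu,\nu}: -E_{2,\lambda}[\omega]=I_{\mu,\nu,\lambda}\}$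 is the set of minimizers (functions identified a.e.). Lamb dipole with parameters $\lambda,W>0$: let $J_m$ be the $m$-th order Bessel function of the first kind, $c_0=3.8317\ldots$ the first positive zero of $J_1$ (so $J_0(c_0)<0$), $a=c_0\lambda^{-1/2}$, $C_L=-\dfrac{2W}{\lambda^{1/2}J_0(c_0)}$. In polar coordinates $x_1=r\cos\theta$, $x_2=r\sin\theta$ set $\Psi_L(x)=C_LJ_1(\lambda^{1/2}r)\sin\theta$ for $r\le a$ and $\Psi_L(x)=-W\left(r-\frac{a^2}{r}\right)\sin\theta$ for $r>a$. The Lamb dipole is $\omega_L=\lambda\max\{\Psi_L,0\}$ on $\mathbb{R}^2_+$. *)

theory Defs
  imports "HOL-Analysis.Analysis"
begin

definition half_plane :: "(real \<times> real) set" where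
  "half_plane = {x. snd x > 0}"

definition half_plane_boundary :: "(real \<times> real) set" where
  "half_plane_boundary = {(y1, 0) | y1. True}"

text \<open>Functions on the half-plane are represented by total functions on the plane; the measure
  \<open>half_leb\<close> only sees their values on the half-plane.\<close>

abbreviation half_leb :: "(real \<times> real) measure" where
  "half_leb \<equiv> lebesgue_on half_plane"

definition L2_half :: "(real \<times> real \<Rightarrow> real) set" where
  "L2_half = {\<omega> \<in> borel_measurable half_leb. integrable half_leb (\<lambda>x. (\<omega> x)\<^sup>2)}"

definition ae_eq :: "((real \<times> real \<Rightarrow> real) \<times> (real \<times> real \<Rightarrow> real)) set" where
  "ae_eq = {(f, g). f \<in> borel_measurable half_leb \<and> g \<in> borel_measurable half_leb \<and>
              (AE x in half_leb. f x = g x)}"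

text \<open>On the null set \<open>x = y\<close>, where the kernel is infinite, the convention \<open>t / 0 = 0\<close> gives it
  the value \<open>0\<close>.\<close>

definition G :: "real \<times> real \<Rightarrow> real \<times> real \<Rightarrow> real" where
  "G x y = 1 / (4 * pi) * ln (1 + 4 * snd x * snd y / (norm (x - y))\<^sup>2)"

text \<open>On the admissible class below the kernel integral converges absolutely: since
  \<open>G x y \<le> C * sqrt (snd x * snd y) / norm (x - y)\<close>, the Hardy--Littlewood--Sobolev and Hoelder
  inequalities bound it by the first moment times the \<open>L\<^sup>2\<close> norm. So the Bochner integrals
  (which are \<open>0\<close> for non-integrable functions) are the intended ones, and the infimum is that of
  a nonempty set of reals that is bounded below.\<close>

definition energy :: "(real \<times> real \<Rightarrow> real) \<Rightarrow> real" where
  "energy \<omega> = 1 / 2 * (\<integral>x. (\<integral>y. G x y * \<omega> x * \<omega> y \<partial>half_leb) \<partial>half_leb)"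

definition penalized_energy :: "real \<Rightarrow> (real \<times> real \<Rightarrow> real) \<Rightarrow> real" where
  "penalized_energy lam \<omega> = energy \<omega> - 1 / (2 * lam) * (\<integral>x. (\<omega> x)\<^sup>2 \<partial>half_leb)"

definition admissible :: "real \<Rightarrow> real \<Rightarrow> (real \<times> real \<Rightarrow> real) set" where
  "admissible \<mu> \<nu> = {\<omega> \<in> L2_half.
      (AE x in half_leb. \<omega> x \<ge> 0) \<and>
      integrable half_leb (\<lambda>x. snd x * \<omega> x) \<and> (\<integral>x. snd x * \<omega> x \<partial>half_leb) = \<mu> \<and>
      integrable half_leb \<omega> \<and> (\<integral>x. \<omega> x \<partial>half_leb) \<le> \<nu>}"

definition min_value :: "real \<Rightarrow> real \<Rightarrow> real \<Rightarrow> real" where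
  "min_value \<mu> \<nu> lam = (INF \<omega>\<in>admissible \<mu> \<nu>. - penalized_energy lam \<omega>)"

text \<open>Elements are almost-everywhere classes of functions.\<close>

definition minimizers :: "real \<Rightarrow> real \<Rightarrow> real \<Rightarrow> (real \<times> real \<Rightarrow> real) set set" where
  "minimizers \<mu> \<nu> lam =
     {\<omega> \<in> admissible \<mu> \<nu>. - penalized_energy lam \<omega> = min_value \<mu> \<nu> lam} // ae_eq"

definition bessel_J :: "nat \<Rightarrow> real \<Rightarrow> real" where
  "bessel_J m x = (\<Sum>k. (-1) ^ k / (fact k * fact (k + m)) * (x / 2) ^ (2 * k + m))"

definition bessel_c0 :: real where
  "bessel_c0 = (LEAST c. c > 0 \<and> bessel_J 1 c = 0)"

definition lamb_radius :: "real \<Rightarrow> real" where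
  "lamb_radius lam = bessel_c0 * lam powr (- (1 / 2))"

definition lamb_coeff :: "real \<Rightarrow> real \<Rightarrow> real" where
  "lamb_coeff lam W = - (2 * W / (lam powr (1 / 2) * bessel_J 0 bessel_c0))"

text \<open>In polar coordinates \<open>r = norm x\<close> and \<open>s = sin \<theta>\<close>.\<close>

definition lamb_stream :: "real \<Rightarrow> real \<Rightarrow> real \<times> real \<Rightarrow> real" where
  "lamb_stream lam W x =
     (let r = norm x; s = snd x / r; a = lamb_radius lam in
      if r \<le> a then lamb_coeff lam W * bessel_J 1 (lam powr (1 / 2) * r) * s
      else - W * (r - a\<^sup>2 / r) * s)"

definition lamb_dipole :: "real \<Rightarrow> real \<Rightarrow> real \<times> real \<Rightarrow> real" where
  "lamb_dipole lam W x = lam * max (lamb_stream lam W x) 0"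

end

theory Submission
  imports Defs "HOL-Complex_Analysis.Great_Picard"
begin

text \<open>
  Write a function on the half-plane as \<open>\<omega> (x\<^sub>1, x\<^sub>2) = x\<^sub>2 * \<zeta>\<close> and regard \<open>\<zeta>\<close> as a function on four-dimensional
  space that is axisymmetric about the \<open>x\<^sub>1\<close>-axis. Averaging \<open>1 / \<bar>X - Y\<bar>\<^sup>2\<close> over rotations about the
  axis gives the kernel \<open>G\<close>, so impulse, \<open>L\<^sup>2\<close> norm and energy of \<open>\<omega>\<close> become the \<open>L\<^sup>1\<close> norm, the \<open>L\<^sup>2\<close> norm and the
  Coulomb energy of \<open>\<zeta>\<close>, which are invariant under all isometries of the four-dimensional space. The theorem thus
  becomes a sharp inequality \<open>(Coulomb energy) \<le> (4 \<pi>\<^sup>2 / \<lambda>) \<parallel>\<zeta>\<parallel>\<^sub>2\<^sup>2 + \<parallel>\<zeta>\<parallel>\<^sub>1\<^sup>2 / a\<^sup>2\<close> together with its equality cases; the mass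
  constraint is inactive when \<open>\<mu> / \<nu>\<close> is small.

  Polarization with respect to a hyperplane keeps both norms and does not decrease the energy. Minimizing the second
  moment over the polarizations of a function therefore yields a radial competitor. For a radial \<open>\<zeta>\<close> let \<open>N u\<close> be its mass in
  \<open>\<bar>X\<bar>\<^sup>2 < u\<close>. By Newton's theorem the energy is the integral of \<open>N u\<^sup>2 / u\<^sup>2\<close>. The part over \<open>u > a\<^sup>2\<close> is at most \<open>N \<infinity>\<^sup>2 / a\<^sup>2\<close>, and
  the part over \<open>u < a\<^sup>2\<close> is bounded by the Cauchy--Schwarz inequality with weight \<open>N\<^sub>0'\<close>, where \<open>N\<^sub>0\<close> is the mass
  function of the Lamb dipole.

  In the equality case every polarization is trivial: on each half-space, \<open>\<zeta>\<close> minus its reflection has a constant sign.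
  If the hyperplane halves the mass, \<open>\<zeta>\<close> is symmetric about it. A halving hyperplane orthogonal to the axis and the axial
  symmetry make \<open>\<zeta>\<close> even about a point of the axis, so every hyperplane through that point halves the mass and \<open>\<zeta>\<close> is
  radial about it; equality in the Cauchy--Schwarz inequality then identifies the Lamb dipole.
\<close>

section \<open>Reflections and Lebesgue measure\<close>

text \<open>The two constants are found together. In the variable u = |X|^2 the Cauchy-Schwarz step
  loses nothing if the integral of N0(u) / u^2 over v < u < A equals c N0'(v) / v. Differentiation
  leads to Bessel's equation, whose scale fixes c = 4 / \<lambda>, and the absence of a boundary
  term puts A at the first zero of N0', which is a^2. The compactness argument behind the radial
  competitor wants a bounded kernel and a continuous, compactly supported function. The inequality
  is therefore proved for 1 / (s + 1 / n), with s the squared distance, and extended by Fatou's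
  lemma. Equality cases do not survive such limits; they come from applying the finished inequality
  to the polarizations of an extremal function, where the bounded, strictly decreasing part 1 / (s +
  1) of the kernel detects any change. Invariance under a reflection holds only off a null set that
  depends on the reflection, so radiality cannot be read off pointwise. Instead the function is
  compared with its radial average, which has the same mass and energy and at most the same L^2
  norm.\<close>

lemma nn_integral_lborel_translate:
  fixes f :: "'a::euclidean_space \<Rightarrow> ennreal"
  assumes [measurable]: "f \<in> borel_measurable borel"
  shows "(\<integral>\<^sup>+x. f (x + c) \<partial>lborel) = (\<integral>\<^sup>+x. f x \<partial>lborel)"
proof -
  have "(\<integral>\<^sup>+x. f x \<partial>lborel) = (\<integral>\<^sup>+x. f x \<partial>distr lborel borel ((+) c))"
    by (simp add: lborel_distr_plus)
  also have "\<dots> = (\<integral>\<^sup>+x. f (c + x) \<partial>lborel)"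
    by (subst nn_integral_distr) auto
  finally show ?thesis by (simp add: add.commute)
qed

text \<open>Volume preservation from Fubini alone: the product of the measures of \<open>A\<close>
  and of the unit ball is a double integral in which translation invariance moves \<open>f\<close>
  from \<open>A\<close> to the ball, and the preimage of a ball under the isometry is a ball of the
  same radius.\<close>

lemma distr_lborel_orthogonal_transformation:
  fixes f :: "'a::euclidean_space \<Rightarrow> 'a"
  assumes f: "orthogonal_transformation f"
  shows "distr lborel borel f = lborel"
proof (rule measure_eqI)
  show "sets (distr lborel borel f) = sets lborel" by simp
  fix A assume "A \<in> sets (distr lborel borel f)"
  then have A[measurable]: "A \<in> sets borel" by simp
  obtain g where fg: "\<And>x. f (g x) = x"
    using orthogonal_transformation_surj[OF f] by (metis surj_def)
  have lin: "linear f" using f by (simp add: orthogonal_transformation_def)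
  have fm[measurable]: "f \<in> borel_measurable borel"
    using lin linear_continuous_on linear_conv_bounded_linear borel_measurable_continuous_onI by blast
  define B where "B = ball (0::'a) 1"
  have B[measurable]: "B \<in> sets borel" by (simp add: B_def)
  have "emeasure lborel B * emeasure (distr lborel borel f) A
      = (\<integral>\<^sup>+x. (\<integral>\<^sup>+z. indicator B x * indicator A (f z) \<partial>lborel) \<partial>lborel)"
  proof -
    have "emeasure (distr lborel borel f) A = (\<integral>\<^sup>+z. indicator A (f z) \<partial>lborel)"
      by (subst nn_integral_distr[of f lborel borel "indicator A", symmetric]) auto
    then show ?thesis by (simp add: nn_integral_cmult nn_integral_multc)
  qed
  also have "\<dots> = (\<integral>\<^sup>+x. (\<integral>\<^sup>+z. indicator B x * indicator A (f z + x) \<partial>lborel) \<partial>lborel)"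
  proof (rule nn_integral_cong)
    fix x :: 'a
    have "(\<integral>\<^sup>+z. indicator B x * indicator A (f z) \<partial>lborel)
        = (\<integral>\<^sup>+z. indicator B x * indicator A (f (z + g x)) \<partial>lborel)"
      by (rule nn_integral_lborel_translate[symmetric, of "\<lambda>z. indicator B x * indicator A (f z)"]) measurable
    also have "\<dots> = (\<integral>\<^sup>+z. indicator B x * indicator A (f z + x) \<partial>lborel)"
      by (simp add: linear_add[OF lin] fg)
    finally show "(\<integral>\<^sup>+z. indicator B x * indicator A (f z) \<partial>lborel) = (\<integral>\<^sup>+z. indicator B x * indicator A (f z + x) \<partial>lborel)" .
  qed
  also have "\<dots> = (\<integral>\<^sup>+z. (\<integral>\<^sup>+x. indicator B x * indicator A (f z + x) \<partial>lborel) \<partial>lborel)"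
    by (rule lborel_pair.Fubini') measurable
  also have "\<dots> = (\<integral>\<^sup>+z. (\<integral>\<^sup>+x. indicator B (x - f z) * indicator A x \<partial>lborel) \<partial>lborel)"
  proof (rule nn_integral_cong)
    fix z :: 'a
    show "(\<integral>\<^sup>+x. indicator B x * indicator A (f z + x) \<partial>lborel)
        = (\<integral>\<^sup>+x. indicator B (x - f z) * indicator A x \<partial>lborel)"
      using nn_integral_lborel_translate[of "\<lambda>x. indicator B (x - f z) * indicator A x" "f z"]
      by (simp add: add.commute)
  qed
  also have "\<dots> = (\<integral>\<^sup>+x. (\<integral>\<^sup>+z. indicator B (x - f z) * indicator A x \<partial>lborel) \<partial>lborel)"
    by (rule lborel_pair.Fubini') measurable
  also have "\<dots> = (\<integral>\<^sup>+x. emeasure lborel B * indicator A x \<partial>lborel)"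
  proof (rule nn_integral_cong)
    fix x :: 'a
    have "norm (x - f z) = norm (g x - z)" for z
      using orthogonal_transformation_norm[OF f, of "g x - z"] by (simp add: linear_diff[OF lin] fg)
    then have "indicator B (x - f z) = (indicator (ball (g x) 1) z :: ennreal)" for z
      by (simp add: B_def indicator_def dist_norm norm_minus_commute)
    then have "(\<integral>\<^sup>+z. indicator B (x - f z) * indicator A x \<partial>lborel)
       = emeasure lborel (ball (g x) 1) * indicator A x"
      by (subst nn_integral_multc) (auto intro!: borel_measurable_indicator)
    also have "emeasure lborel (ball (g x) 1) = emeasure lborel B"
      unfolding B_def by (simp add: emeasure_ball)
    finally show "(\<integral>\<^sup>+z. indicator B (x - f z) * indicator A x \<partial>lborel) = emeasure lborel B * indicator A x" .
  qed
  also have "\<dots> = emeasure lborel B * emeasure lborel A"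
    by (simp add: nn_integral_cmult)
  finally have "emeasure lborel B * emeasure (distr lborel borel f) A = emeasure lborel B * emeasure lborel A" .
  moreover have "emeasure lborel B \<noteq> 0" "emeasure lborel B \<noteq> \<infinity>"
    unfolding B_def by (auto simp: emeasure_ball less_top order_less_imp_not_eq2 unit_ball_vol_pos)
  ultimately show "emeasure (distr lborel borel f) A = emeasure lborel A"
    by (metis ennreal_mult_cancel_left infinity_ennreal_def)
qed

text \<open>Reflection in the hyperplane \<open>v \<bullet> x = c\<close>. The normal is not
  normalized, so that the mirror exchanging two given points can be written down directly, as in
  \<open>exists_hrefl\<close>.\<close>

definition hrefl :: "'a::euclidean_space \<Rightarrow> real \<Rightarrow> 'a \<Rightarrow> 'a" where
  "hrefl v c x = x - (2 * (v \<bullet> x - c) / (v \<bullet> v)) *\<^sub>R v"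

lemma hrefl_inner: "v \<noteq> 0 \<Longrightarrow> v \<bullet> hrefl v c x - c = - (v \<bullet> x - c)"
  by (simp add: hrefl_def inner_diff_right field_simps)

lemma hrefl_hrefl [simp]:
  assumes "v \<noteq> 0"
  shows "hrefl v c (hrefl v c x) = x"
proof -
  have "hrefl v c (hrefl v c x) = hrefl v c x - (2 * (v \<bullet> hrefl v c x - c) / (v \<bullet> v)) *\<^sub>R v"
    by (simp only: hrefl_def[of v c "hrefl v c x"])
  also have "\<dots> = hrefl v c x + (2 * (v \<bullet> x - c) / (v \<bullet> v)) *\<^sub>R v"
    by (simp only: hrefl_inner[OF assms] mult_minus_right minus_divide_left[symmetric] scaleR_minus_left diff_minus_eq_add)
  also have "\<dots> = x" by (simp add: hrefl_def)
  finally show ?thesis .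
qed

lemma hrefl_on_hyperplane: "v \<bullet> x = c \<Longrightarrow> hrefl v c x = x"
  by (simp add: hrefl_def)

text \<open>The sign of the product of the two offsets decides whether reflecting one of two points
  brings them closer. This identity drives the energy comparison, the preserved modulus of
  continuity and, with one point at the origin, the second moment.\<close>

lemma dist_hrefl:
  assumes "v \<noteq> 0"
  shows "(dist x (hrefl v c y))\<^sup>2 = (dist x y)\<^sup>2 + 4 * (v \<bullet> x - c) * (v \<bullet> y - c) / (v \<bullet> v)"
proof -
  define s where "s = 2 * (v \<bullet> y - c) / (v \<bullet> v)"
  have sv: "s * (v \<bullet> v) = 2 * (v \<bullet> y - c)" using assms by (simp add: s_def)
  have xs: "x - hrefl v c y = (x - y) + s *\<^sub>R v" by (simp add: hrefl_def s_def)
  have "(dist x (hrefl v c y))\<^sup>2 = (dist x y)\<^sup>2 + 2 * s * ((x - y) \<bullet> v) + s * (s * (v \<bullet> v))"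
    unfolding dist_norm xs
    by (simp add: power2_norm_eq_inner inner_add_left inner_add_right inner_commute algebra_simps)
  also have "\<dots> = (dist x y)\<^sup>2 + 2 * s * (v \<bullet> x - c)"
    unfolding sv by (simp add: inner_diff_left inner_commute algebra_simps)
  finally show ?thesis by (simp add: s_def algebra_simps)
qed

lemma dist_hrefl_hrefl: "v \<noteq> 0 \<Longrightarrow> dist (hrefl v c x) (hrefl v c y) = dist x y"
proof -
  assume v: "v \<noteq> 0"
  have "(dist (hrefl v c x) (hrefl v c y))\<^sup>2 = (dist (hrefl v c x) y)\<^sup>2 + 4 * (v \<bullet> hrefl v c x - c) * (v \<bullet> y - c) / (v \<bullet> v)"
    by (rule dist_hrefl[OF v])
  also have "\<dots> = (dist y (hrefl v c x))\<^sup>2 - 4 * (v \<bullet> x - c) * (v \<bullet> y - c) / (v \<bullet> v)"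
    by (simp only: hrefl_inner[OF v] dist_commute[of y] mult_minus_right mult_minus_left minus_divide_left[symmetric])
  also have "\<dots> = (dist x y)\<^sup>2"
    by (simp add: dist_hrefl[OF v] dist_commute algebra_simps)
  finally show ?thesis by simp
qed

lemma dist_hrefl_commute: "v \<noteq> 0 \<Longrightarrow> dist (hrefl v c x) y = dist x (hrefl v c y)"
  using dist_hrefl_hrefl[of v c x "hrefl v c y"] by simp

lemma continuous_on_hrefl [continuous_intros]: "continuous_on A (hrefl v c)"
  unfolding hrefl_def divide_inverse by (intro continuous_intros)

lemma hrefl_measurable [measurable]: "hrefl v c \<in> borel_measurable borel"
  by (intro borel_measurable_continuous_onI continuous_intros)

lemma distr_lborel_hrefl:
  fixes v :: "'a::euclidean_space"
  assumes v: "v \<noteq> 0"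
  shows "distr lborel borel (hrefl v c) = lborel"
proof -
  have "orthogonal_transformation (hrefl v 0)"
    unfolding orthogonal_transformation
  proof
    show "linear (hrefl v 0)"
      by (rule linearI) (simp_all add: hrefl_def algebra_simps inner_add_right add_divide_distrib)
    show "\<forall>w. norm (hrefl v 0 w) = norm w"
      using dist_hrefl_hrefl[OF v, of 0 _ 0] by (simp add: dist_norm hrefl_def)
  qed
  then have *: "distr lborel borel (hrefl v 0) = lborel" by (rule distr_lborel_orthogonal_transformation)
  have "hrefl v c = (\<lambda>x. (2 * c / (v \<bullet> v)) *\<^sub>R v + x) \<circ> hrefl v 0"
    by (auto simp: hrefl_def fun_eq_iff diff_divide_distrib algebra_simps)
  then have "distr lborel borel (hrefl v c) = distr (distr lborel borel (hrefl v 0)) borel ((+) ((2 * c / (v \<bullet> v)) *\<^sub>R v))"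
    by (subst distr_distr) (auto simp: o_def)
  then show ?thesis by (simp add: * lborel_distr_plus)
qed

lemma nn_integral_hrefl:
  fixes v :: "'a::euclidean_space" and f :: "'a \<Rightarrow> ennreal"
  assumes v: "v \<noteq> 0" and [measurable]: "f \<in> borel_measurable borel"
  shows "(\<integral>\<^sup>+x. f (hrefl v c x) \<partial>lborel) = (\<integral>\<^sup>+x. f x \<partial>lborel)"
proof -
  have "(\<integral>\<^sup>+x. f x \<partial>lborel) = (\<integral>\<^sup>+x. f x \<partial>distr lborel borel (hrefl v c))"
    by (simp add: distr_lborel_hrefl[OF v])
  also have "\<dots> = (\<integral>\<^sup>+x. f (hrefl v c x) \<partial>lborel)"
    by (subst nn_integral_distr) auto
  finally show ?thesis by simp
qed

text \<open>The mirror is the perpendicular bisector. Its offset vanishes when the norms agree and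
  is positive when \<open>y\<close> is farther from the origin than \<open>x\<close>; radiality uses
  the first case, monotonicity in the norm the second.\<close>

lemma exists_hrefl:
  assumes "x \<noteq> y"
  shows "hrefl (y - x) ((y \<bullet> y - x \<bullet> x) / 2) x = y"
proof -
  have "2 * ((y - x) \<bullet> x - (y \<bullet> y - x \<bullet> x) / 2) = - ((y - x) \<bullet> (y - x))"
    by (simp add: inner_diff_left inner_diff_right inner_commute field_simps)
  moreover have "(y - x) \<bullet> (y - x) \<noteq> 0" using assms by simp
  ultimately show ?thesis by (simp add: hrefl_def)
qed

section \<open>Polarization\<close>

text \<open>Equality case of monotonicity of the integral: the difference has integral zero.
  Finiteness permits the subtraction in \<open>ennreal\<close>.\<close>

lemma AE_eq_of_nn_integral_eq:
  assumes [measurable]: "f \<in> borel_measurable M" "g \<in> borel_measurable M"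
    and le: "\<And>x. f x \<le> g x" and eq: "integral\<^sup>N M g \<le> integral\<^sup>N M f" and fin: "integral\<^sup>N M f < \<infinity>"
  shows "AE x in M. f x = g x"
proof -
  have "(\<integral>\<^sup>+x. g x - f x \<partial>M) = integral\<^sup>N M g - integral\<^sup>N M f"
    by (intro nn_integral_diff) (use fin le in auto)
  also have "\<dots> = 0" using le_less_trans[OF eq fin] eq by (simp add: diff_eq_0_iff_ennreal)
  finally have "AE x in M. g x - f x = 0" by (subst (asm) nn_integral_0_iff_AE) auto
  moreover have "AE x in M. f x \<noteq> \<infinity>"
    by (rule nn_integral_noteq_infinite) (use fin in auto)
  ultimately show ?thesis
    by eventually_elim (metis diff_eq_0_iff_ennreal le antisym infinity_ennreal_def not_less top.not_eq_extremum)
qed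

text \<open>The half-space \<open>v \<bullet> x \<le> c\<close> receives the larger of the two
  values on each mirror pair. For \<open>0 \<le> c\<close> it contains the origin, so mass moves
  inward.\<close>

definition polarize :: "'a::euclidean_space \<Rightarrow> real \<Rightarrow> ('a \<Rightarrow> real) \<Rightarrow> 'a \<Rightarrow> real" where
  "polarize v c f x =
     (if v \<bullet> x \<le> c then max (f x) (f (hrefl v c x)) else min (f x) (f (hrefl v c x)))"

text \<open>The kernel takes the squared distance, the quantity that \<open>dist_hrefl\<close>
  controls, and is \<open>ennreal\<close>-valued so that the Coulomb kernel may be infinite on the
  diagonal.\<close>

definition riesz :: "(real \<Rightarrow> ennreal) \<Rightarrow> ('a::euclidean_space \<Rightarrow> real) \<Rightarrow> ennreal" where
  "riesz k f = (\<integral>\<^sup>+x. \<integral>\<^sup>+y. k ((dist x y)\<^sup>2) * ennreal (f x * f y) \<partial>lborel \<partial>lborel)"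

lemma polarize_measurable [measurable]:
  assumes [measurable]: "f \<in> borel_measurable borel"
  shows "polarize v c f \<in> borel_measurable borel"
  unfolding polarize_def[abs_def] by measurable

lemma polarize_nonneg: "(\<And>x. 0 \<le> f x) \<Longrightarrow> 0 \<le> polarize v c f x"
  by (simp add: polarize_def le_max_iff_disj)

lemma hrefl_side: "v \<noteq> 0 \<Longrightarrow> v \<bullet> hrefl v c x < c \<longleftrightarrow> c < v \<bullet> x"
  "v \<noteq> 0 \<Longrightarrow> v \<bullet> hrefl v c x \<le> c \<longleftrightarrow> c \<le> v \<bullet> x"
  using hrefl_inner[of v c x] by auto

lemma polarize_hrefl:
  assumes "v \<noteq> 0"
  shows "polarize v c f (hrefl v c x) =
     (if c \<le> v \<bullet> x then max (f x) (f (hrefl v c x)) else min (f x) (f (hrefl v c x)))"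
  by (auto simp: polarize_def hrefl_side assms max.commute min.commute)

lemma polarize_sum:
  assumes "v \<noteq> 0"
  shows "polarize v c f x + polarize v c f (hrefl v c x) = f x + f (hrefl v c x)"
    "(polarize v c f x)\<^sup>2 + (polarize v c f (hrefl v c x))\<^sup>2 = (f x)\<^sup>2 + (f (hrefl v c x))\<^sup>2"
  unfolding polarize_hrefl[OF assms]
  by (cases "v \<bullet> x" c rule: linorder_cases;
      simp add: polarize_def hrefl_on_hyperplane max_def min_def)+

text \<open>On every mirror pair the two values are at most exchanged, so the sum over the pair of
  the values, or of their squares, is unchanged; each integral is half the integral of that
  sum.\<close>

lemma nn_integral_polarize:
  fixes f :: "'a::euclidean_space \<Rightarrow> real"
  assumes v: "v \<noteq> 0" and [measurable]: "f \<in> borel_measurable borel" and nonneg: "\<And>x. 0 \<le> f x"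
  shows "(\<integral>\<^sup>+x. ennreal (polarize v c f x) \<partial>lborel) = (\<integral>\<^sup>+x. ennreal (f x) \<partial>lborel)"
    "(\<integral>\<^sup>+x. ennreal ((polarize v c f x)\<^sup>2) \<partial>lborel) = (\<integral>\<^sup>+x. ennreal ((f x)\<^sup>2) \<partial>lborel)"
proof -
  have half: "(\<integral>\<^sup>+x. ennreal (h x) \<partial>lborel) = (\<integral>\<^sup>+x. ennreal (g x) \<partial>lborel)"
    if [measurable]: "h \<in> borel_measurable borel" "g \<in> borel_measurable borel"
      and nn: "\<And>x. 0 \<le> h x" "\<And>x. 0 \<le> g x"
      and eq: "\<And>x. h x + h (hrefl v c x) = g x + g (hrefl v c x)" for h g :: "'a \<Rightarrow> real"
  proof -
    have two: "(\<integral>\<^sup>+x. ennreal (u x + u (hrefl v c x)) \<partial>lborel) = 2 * (\<integral>\<^sup>+x. ennreal (u x) \<partial>lborel)"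
      if [measurable]: "u \<in> borel_measurable borel" and "\<And>x. 0 \<le> u x" for u :: "'a \<Rightarrow> real"
    proof -
      have "(\<integral>\<^sup>+x. ennreal (u x + u (hrefl v c x)) \<partial>lborel)
        = (\<integral>\<^sup>+x. ennreal (u x) \<partial>lborel) + (\<integral>\<^sup>+x. ennreal (u (hrefl v c x)) \<partial>lborel)"
        using that(2) by (subst nn_integral_add[symmetric]) auto
      also have "(\<integral>\<^sup>+x. ennreal (u (hrefl v c x)) \<partial>lborel) = (\<integral>\<^sup>+x. ennreal (u x) \<partial>lborel)"
        by (rule nn_integral_hrefl[OF v, of "\<lambda>x. ennreal (u x)"]) measurable
      finally show ?thesis by (simp add: mult_2)
    qed
    have "2 * (\<integral>\<^sup>+x. ennreal (h x) \<partial>lborel) = 2 * (\<integral>\<^sup>+x. ennreal (g x) \<partial>lborel)"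
      using two[of h] two[of g] nn eq by simp
    then show ?thesis by (simp add: ennreal_mult_cancel_left)
  qed
  show "(\<integral>\<^sup>+x. ennreal (polarize v c f x) \<partial>lborel) = (\<integral>\<^sup>+x. ennreal (f x) \<partial>lborel)"
    by (rule half) (auto simp: polarize_nonneg nonneg polarize_sum v)
  show "(\<integral>\<^sup>+x. ennreal ((polarize v c f x)\<^sup>2) \<partial>lborel) = (\<integral>\<^sup>+x. ennreal ((f x)\<^sup>2) \<partial>lborel)"
    by (rule half) (auto simp: polarize_sum v)
qed

text \<open>The energy integrand summed over the four pairs obtained by reflecting \<open>x\<close>
  and \<open>y\<close>; only two kernel values occur. Polarization may lower the energy integrand at
  a single pair, but never this sum.\<close>

definition riesz_fold where
  "riesz_fold v c k f x y =
     k ((dist x y)\<^sup>2) * ennreal (f x * f y + f (hrefl v c x) * f (hrefl v c y)) +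
     k ((dist x (hrefl v c y))\<^sup>2) * ennreal (f x * f (hrefl v c y) + f (hrefl v c x) * f y)"

lemma nn_integral_riesz_fold:
  fixes f :: "'a::euclidean_space \<Rightarrow> real"
  assumes v: "v \<noteq> 0" and [measurable]: "f \<in> borel_measurable borel" "k \<in> borel_measurable borel"
    and nonneg: "\<And>x. 0 \<le> f x"
  shows "(\<integral>\<^sup>+x. \<integral>\<^sup>+y. riesz_fold v c k f x y \<partial>lborel \<partial>lborel) = 4 * riesz k f"
proof -
  define F where "F x y = k ((dist x y)\<^sup>2) * ennreal (f x * f y)" for x y
  have [measurable]: "case_prod F \<in> borel_measurable (borel \<Otimes>\<^sub>M borel)"
    unfolding F_def by measurable
  let ?s = "hrefl v c"
  have expand: "riesz_fold v c k f x y = (F x y + F x (?s y)) + (F (?s x) y + F (?s x) (?s y))" for x y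
    unfolding riesz_fold_def F_def
    by (simp add: dist_hrefl_hrefl[OF v] dist_hrefl_commute[OF v] v ennreal_plus nonneg distrib_left add_ac)
  have inner: "(\<integral>\<^sup>+y. F x (?s y) \<partial>lborel) = (\<integral>\<^sup>+y. F x y \<partial>lborel)" for x
    by (rule nn_integral_hrefl[OF v, of "F x"]) measurable
  have outer: "(\<integral>\<^sup>+x. \<integral>\<^sup>+y. F (?s x) y \<partial>lborel \<partial>lborel) = (\<integral>\<^sup>+x. \<integral>\<^sup>+y. F x y \<partial>lborel \<partial>lborel)"
    by (rule nn_integral_hrefl[OF v, of "\<lambda>x. \<integral>\<^sup>+y. F x y \<partial>lborel"]) measurable
  have "(\<integral>\<^sup>+x. \<integral>\<^sup>+y. riesz_fold v c k f x y \<partial>lborel \<partial>lborel)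
      = (\<integral>\<^sup>+x. (2 * (\<integral>\<^sup>+y. F x y \<partial>lborel) + 2 * (\<integral>\<^sup>+y. F (?s x) y \<partial>lborel)) \<partial>lborel)"
    unfolding expand by (simp add: nn_integral_add inner mult_2)
  also have "\<dots> = 2 * (\<integral>\<^sup>+x. \<integral>\<^sup>+y. F x y \<partial>lborel \<partial>lborel) + 2 * (\<integral>\<^sup>+x. \<integral>\<^sup>+y. F x y \<partial>lborel \<partial>lborel)"
    by (simp add: nn_integral_add nn_integral_cmult outer)
  also have "\<dots> = 4 * riesz k f"
    unfolding riesz_def F_def by (simp only: distrib_right[symmetric] numeral_plus_numeral add_num_simps)
  finally show ?thesis .
qed

lemma rearrangement_le:
  fixes a b c d :: real
  shows "a * c + b * d \<le> max a b * max c d + min a b * min c d"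
    "a * d + b * c \<le> max a b * max c d + min a b * min c d"
  using mult_nonneg_nonneg[of "a - b" "c - d"] mult_nonneg_nonneg[of "b - a" "c - d"]
    mult_nonneg_nonneg[of "a - b" "d - c"] mult_nonneg_nonneg[of "b - a" "d - c"]
  by (auto simp: max_def min_def algebra_simps)

text \<open>With a fixed total, moving weight from the smaller factor \<open>q\<close> to the larger
  factor \<open>p\<close> cannot decrease the sum. Writing \<open>p = q + d\<close> avoids
  subtracting infinite values.\<close>

lemma ennreal_mix_le:
  fixes p q :: ennreal and X Y X' Y' :: real
  assumes "q \<le> p" "X \<le> X'" "X + Y = X' + Y'" "0 \<le> X" "0 \<le> Y" "0 \<le> Y'"
  shows "p * ennreal X + q * ennreal Y \<le> p * ennreal X' + q * ennreal Y'"
proof -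
  obtain d where p: "p = q + d" using assms(1) by (auto simp: le_iff_add)
  have X': "0 \<le> X'" using assms by simp
  have "p * ennreal X + q * ennreal Y = d * ennreal X + q * ennreal (X + Y)"
    using assms(4,5) by (simp add: p ennreal_plus algebra_simps)
  also have "\<dots> \<le> d * ennreal X' + q * ennreal (X' + Y')"
    using assms(2) unfolding assms(3) by (intro add_mono mult_left_mono ennreal_leI) auto
  also have "\<dots> = p * ennreal X' + q * ennreal Y'"
    using assms(6) X' by (simp add: p ennreal_plus algebra_simps)
  finally show ?thesis .
qed

text \<open>Two points on the same side are closer to each other than to each other's mirror images,
  so the larger kernel value multiplies the pairing of like-ordered values; on opposite sides the
  roles are exchanged. Either way polarization realizes the largest pairing allowed by the
  rearrangement inequality.\<close>

lemma riesz_fold_polarize_le: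
  fixes f :: "'a::euclidean_space \<Rightarrow> real"
  assumes v: "v \<noteq> 0" and nonneg: "\<And>x. 0 \<le> f x"
    and k: "\<And>s t. 0 \<le> s \<Longrightarrow> s \<le> t \<Longrightarrow> k t \<le> k s"
  shows "riesz_fold v c k f x y \<le> riesz_fold v c k (polarize v c f) x y"
proof -
  define A A' B B' where "A = f x" and "A' = f (hrefl v c x)" and "B = f y" and "B' = f (hrefl v c y)"
  define P P' Q Q' where "P = polarize v c f x" and "P' = polarize v c f (hrefl v c x)"
    and "Q = polarize v c f y" and "Q' = polarize v c f (hrefl v c y)"
  have nn: "0 \<le> A" "0 \<le> A'" "0 \<le> B" "0 \<le> B'" by (auto simp: A_def A'_def B_def B'_def nonneg)
  have nn': "0 \<le> P" "0 \<le> P'" "0 \<le> Q" "0 \<le> Q'"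
    by (auto simp: P_def P'_def Q_def Q'_def nonneg polarize_nonneg)
  have "P + P' = A + A'" "Q + Q' = B + B'"
    by (simp_all add: A_def A'_def B_def B'_def P_def P'_def Q_def Q'_def polarize_sum[OF v])
  then have "(P + P') * (Q + Q') = (A + A') * (B + B')" by simp
  then have sum: "(A * B + A' * B') + (A * B' + A' * B) = (P * Q + P' * Q') + (P * Q' + P' * Q)"
    by (simp add: algebra_simps)
  have d: "(dist x (hrefl v c y))\<^sup>2 = (dist x y)\<^sup>2 + 4 * ((v \<bullet> x - c) * (v \<bullet> y - c)) / (v \<bullet> v)"
    using dist_hrefl[OF v, of x c y] by (simp add: mult.assoc)
  have vv: "v \<bullet> v > 0" using v by simp
  have pol: "P = (if v \<bullet> x \<le> c then max A A' else min A A')"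
    "P' = (if v \<bullet> x \<ge> c then max A A' else min A A')"
    "Q = (if v \<bullet> y \<le> c then max B B' else min B B')"
    "Q' = (if v \<bullet> y \<ge> c then max B B' else min B B')"
    by (simp_all add: A_def A'_def B_def B'_def P_def P'_def Q_def Q'_def polarize_hrefl[OF v])
      (simp_all add: polarize_def)
  \<comment> \<open>On the mirror the two values coincide, which settles the points where both
    branches of \<open>polarize\<close> take the maximum.\<close>
  have bd: "v \<bullet> x = c \<Longrightarrow> A = A'" "v \<bullet> y = c \<Longrightarrow> B = B'"
    by (auto simp: A_def A'_def B_def B'_def hrefl_on_hyperplane)
  show ?thesis
  proof (cases "0 \<le> (v \<bullet> x - c) * (v \<bullet> y - c)")
    case True
    then have "(dist x y)\<^sup>2 \<le> (dist x (hrefl v c y))\<^sup>2" unfolding d using vv by simp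
    then have kk: "k ((dist x (hrefl v c y))\<^sup>2) \<le> k ((dist x y)\<^sup>2)" by (intro k) auto
    have "A * B + A' * B' \<le> P * Q + P' * Q'"
      using True rearrangement_le(1)[of A B A' B'] bd unfolding pol zero_le_mult_iff
      by (auto simp: algebra_simps split: if_splits)
    then show ?thesis
      unfolding riesz_fold_def A_def[symmetric] A'_def[symmetric] B_def[symmetric] B'_def[symmetric]
        P_def[symmetric] P'_def[symmetric] Q_def[symmetric] Q'_def[symmetric]
      by (intro ennreal_mix_le[OF kk]) (use sum nn nn' in auto)
  next
    case False
    then have "(dist x (hrefl v c y))\<^sup>2 \<le> (dist x y)\<^sup>2" unfolding d using vv by (simp add: divide_nonpos_pos)
    then have kk: "k ((dist x y)\<^sup>2) \<le> k ((dist x (hrefl v c y))\<^sup>2)" by (intro k) auto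
    have "A * B' + A' * B \<le> P * Q' + P' * Q"
      using False rearrangement_le(2)[of A B' A' B] unfolding pol zero_le_mult_iff
      by (auto simp: algebra_simps split: if_splits)
    then have "k ((dist x (hrefl v c y))\<^sup>2) * ennreal (A * B' + A' * B) + k ((dist x y)\<^sup>2) * ennreal (A * B + A' * B')
      \<le> k ((dist x (hrefl v c y))\<^sup>2) * ennreal (P * Q' + P' * Q) + k ((dist x y)\<^sup>2) * ennreal (P * Q + P' * Q')"
      by (intro ennreal_mix_le[OF kk]) (use sum nn nn' in auto)
    then show ?thesis
      unfolding riesz_fold_def A_def[symmetric] A'_def[symmetric] B_def[symmetric] B'_def[symmetric]
        P_def[symmetric] P'_def[symmetric] Q_def[symmetric] Q'_def[symmetric]
      by (simp add: add.commute)
  qed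
qed

lemma riesz_fold_measurable [measurable]:
  fixes f :: "'a::euclidean_space \<Rightarrow> real"
  assumes [measurable]: "f \<in> borel_measurable borel" "k \<in> borel_measurable borel"
  shows "case_prod (riesz_fold v c k f) \<in> borel_measurable (borel \<Otimes>\<^sub>M borel)"
  unfolding riesz_fold_def by measurable

lemma riesz_polarize_le:
  fixes f :: "'a::euclidean_space \<Rightarrow> real"
  assumes v: "v \<noteq> 0" and [measurable]: "f \<in> borel_measurable borel" "k \<in> borel_measurable borel"
    and nonneg: "\<And>x. 0 \<le> f x"
    and k: "\<And>s t. 0 \<le> s \<Longrightarrow> s \<le> t \<Longrightarrow> k t \<le> k s"
  shows "riesz k f \<le> riesz k (polarize v c f)"
proof -
  have "4 * riesz k f \<le> 4 * riesz k (polarize v c f)"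
    unfolding nn_integral_riesz_fold[where c=c, OF assms(1-4), symmetric]
      nn_integral_riesz_fold[where c=c, OF v polarize_measurable[OF assms(2)] assms(3) polarize_nonneg[OF nonneg], symmetric]
    by (intro nn_integral_mono riesz_fold_polarize_le[OF v nonneg k])
  then show ?thesis by (subst (asm) ennreal_mult_le_mult_iff) auto
qed

text \<open>Equality of the finite energies forces equality of the folded integrands almost
  everywhere. For two points of the open half-space the kernel is strictly larger at their distance
  than at the reflected one, so differences of opposite sign would make the folded comparison
  strict. The kernel is real-valued because its values are cancelled.\<close>

lemma polarize_equality:
  fixes f :: "'a::euclidean_space \<Rightarrow> real" and \<kappa> :: "real \<Rightarrow> real"
  assumes v: "v \<noteq> 0" and [measurable]: "f \<in> borel_measurable borel" "\<kappa> \<in> borel_measurable borel"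
    and nonneg: "\<And>x. 0 \<le> f x" and \<kappa>0: "\<And>s. 0 \<le> s \<Longrightarrow> 0 \<le> \<kappa> s"
    and \<kappa>: "\<And>s t. 0 \<le> s \<Longrightarrow> s < t \<Longrightarrow> \<kappa> t < \<kappa> s"
    and fin: "riesz (\<lambda>s. ennreal (\<kappa> s)) f < \<infinity>"
    and eq: "riesz (\<lambda>s. ennreal (\<kappa> s)) (polarize v c f) \<le> riesz (\<lambda>s. ennreal (\<kappa> s)) f"
  shows "AE x in lborel. AE y in lborel. v \<bullet> x < c \<longrightarrow> v \<bullet> y < c \<longrightarrow>
    0 \<le> (f x - f (hrefl v c x)) * (f y - f (hrefl v c y))"
proof -
  let ?k = "\<lambda>s. ennreal (\<kappa> s)"
  let ?F = "riesz_fold v c ?k f" and ?P = "riesz_fold v c ?k (polarize v c f)"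
  have anti: "?k t \<le> ?k s" if "0 \<le> s" "s \<le> t" for s t
    using \<kappa>[of s t] that by (cases "s = t") (auto intro!: ennreal_leI)
  have le: "?F x y \<le> ?P x y" for x y
    by (rule riesz_fold_polarize_le[OF v nonneg anti])
  have intF: "(\<integral>\<^sup>+x. \<integral>\<^sup>+y. ?F x y \<partial>lborel \<partial>lborel) = 4 * riesz ?k f"
    by (rule nn_integral_riesz_fold[OF v]) (auto simp: nonneg)
  have intP: "(\<integral>\<^sup>+x. \<integral>\<^sup>+y. ?P x y \<partial>lborel \<partial>lborel) = 4 * riesz ?k (polarize v c f)"
    by (rule nn_integral_riesz_fold[OF v]) (auto simp: nonneg polarize_nonneg)
  have finF: "(\<integral>\<^sup>+x. \<integral>\<^sup>+y. ?F x y \<partial>lborel \<partial>lborel) < \<infinity>"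
    unfolding intF using fin by (simp add: ennreal_mult_less_top)
  have "AE x in lborel. (\<integral>\<^sup>+y. ?F x y \<partial>lborel) = (\<integral>\<^sup>+y. ?P x y \<partial>lborel)"
    by (rule AE_eq_of_nn_integral_eq[OF _ _ _ _ finF])
      (auto intro!: nn_integral_mono le mult_left_mono simp: intF intP eq)
  moreover have "AE x in lborel. (\<integral>\<^sup>+y. ?F x y \<partial>lborel) \<noteq> \<infinity>"
    by (rule nn_integral_noteq_infinite) (use finF in auto)
  ultimately show ?thesis
  proof eventually_elim
    case (elim x)
    have "AE y in lborel. ?F x y = ?P x y"
      by (rule AE_eq_of_nn_integral_eq) (use elim le in \<open>auto simp: less_top\<close>)
    then show ?case
    proof eventually_elim
      case (elim y)
      show ?case
      proof (intro impI)
        assume x: "v \<bullet> x < c" and y: "v \<bullet> y < c"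
        define A A' B B' where "A = f x" and "A' = f (hrefl v c x)" and "B = f y" and "B' = f (hrefl v c y)"
        define p q where "p = \<kappa> ((dist x y)\<^sup>2)" and "q = \<kappa> ((dist x (hrefl v c y))\<^sup>2)"
        have nn: "0 \<le> A" "0 \<le> A'" "0 \<le> B" "0 \<le> B'" by (auto simp: A_def A'_def B_def B'_def nonneg)
        have "0 < 4 * (v \<bullet> x - c) * (v \<bullet> y - c) / (v \<bullet> v)"
          using x y v by (auto intro!: divide_pos_pos mult_neg_neg)
        then have qp: "q < p" unfolding p_def q_def by (intro \<kappa>) (auto simp: dist_hrefl[OF v])
        have q0: "0 \<le> q" unfolding q_def by (intro \<kappa>0) auto
        let ?X = "A * B + A' * B'" and ?Y = "A * B' + A' * B"
        let ?X' = "max A A' * max B B' + min A A' * min B B'"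
        let ?Y' = "max A A' * min B B' + min A A' * max B B'"
        have "ennreal p * ennreal ?X + ennreal q * ennreal ?Y
          = ennreal p * ennreal ?X' + ennreal q * ennreal ?Y'"
          using elim x y unfolding riesz_fold_def polarize_hrefl[OF v] unfolding polarize_def
          by (simp add: A_def A'_def B_def B'_def p_def q_def)
        then have "ennreal (p * ?X + q * ?Y) = ennreal (p * ?X' + q * ?Y')"
          using nn q0 qp by (simp add: ennreal_mult' ennreal_plus le_max_iff_disj)
        then have e: "p * ?X + q * ?Y = p * ?X' + q * ?Y'"
          using nn q0 qp by (subst (asm) ennreal_inj) (auto intro!: add_nonneg_nonneg mult_nonneg_nonneg simp: le_max_iff_disj)
        have s: "?X + ?Y = ?X' + ?Y'" by (auto simp: max_def min_def algebra_simps)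
        \<comment> \<open>The two pairings have the same total before and after, so the increase is
          the difference of the kernel values times the gain of the better pairing; hence that gain
          is zero.\<close>
        have "(p - q) * (?X' - ?X) = (p * ?X' + q * ?Y') - (p * ?X + q * ?Y) - q * ((?X' + ?Y') - (?X + ?Y))"
          by (simp add: algebra_simps)
        then have "?X' = ?X" using e s qp by simp
        moreover have "?X' - ?X = - ((A - A') * (B - B'))" if "(A - A') * (B - B') < 0"
          using that unfolding mult_less_0_iff by (auto simp: max_def min_def algebra_simps)
        ultimately show "0 \<le> (f x - f (hrefl v c x)) * (f y - f (hrefl v c y))"
          unfolding A_def[symmetric] A'_def[symmetric] B_def[symmetric] B'_def[symmetric]
          by (smt (verit))
      qed
    qed
  qed
qed

text \<open>One point with a nonzero difference fixes the sign of the difference on almost all of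
  the half-space. Then one of the functions \<open>f\<close> and its reflection dominates the other
  there, and since both halves carry the same finite mass, they agree almost everywhere.\<close>

lemma reflection_symmetric:
  fixes f :: "'a::euclidean_space \<Rightarrow> real" and \<kappa> :: "real \<Rightarrow> real"
  assumes v: "v \<noteq> 0" and [measurable]: "f \<in> borel_measurable borel" and nonneg: "\<And>x. 0 \<le> f x"
    and sign: "AE x in lborel. AE y in lborel. v \<bullet> x < c \<longrightarrow> v \<bullet> y < c \<longrightarrow>
      0 \<le> (f x - f (hrefl v c x)) * (f y - f (hrefl v c y))"
    and fin: "(\<integral>\<^sup>+x. ennreal (f x) \<partial>lborel) < \<infinity>"
    and half: "(\<integral>\<^sup>+x. ennreal (f x) * indicator {x. v \<bullet> x < c} x \<partial>lborel)
      = (\<integral>\<^sup>+x. ennreal (f x) * indicator {x. c < v \<bullet> x} x \<partial>lborel)"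
  shows "AE x in lborel. f (hrefl v c x) = f x"
proof -
  let ?s = "hrefl v c"
  define F where "F x = ennreal (f x) * indicator {x. v \<bullet> x < c} x" for x
  define F' where "F' x = ennreal (f (?s x)) * indicator {x. v \<bullet> x < c} x" for x
  have [measurable]: "F \<in> borel_measurable borel" "F' \<in> borel_measurable borel"
    unfolding F_def[abs_def] F'_def[abs_def] by measurable
  have side: "c < v \<bullet> ?s x \<longleftrightarrow> v \<bullet> x < c" for x using hrefl_side(1)[OF v, of c "?s x"] v by simp
  have "integral\<^sup>N lborel F' = (\<integral>\<^sup>+x. ennreal (f x) * indicator {x. c < v \<bullet> x} x \<partial>lborel)"
    using nn_integral_hrefl[OF v, of "\<lambda>x. ennreal (f x) * indicator {x. c < v \<bullet> x} x" c]
    by (simp add: F'_def[abs_def] indicator_def side)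
  then have eq: "integral\<^sup>N lborel F = integral\<^sup>N lborel F'" using half by (simp add: F_def[abs_def])
  have Ffin: "integral\<^sup>N lborel F < \<infinity>"
    by (rule le_less_trans[OF nn_integral_mono fin]) (auto simp: F_def indicator_def)
  have AE1: "AE y in lborel. v \<bullet> y < c \<longrightarrow> f (?s y) = f y"
  proof (cases "\<exists>x. f x \<noteq> f (?s x) \<and> v \<bullet> x < c \<and> (AE y in lborel. v \<bullet> y < c \<longrightarrow>
      0 \<le> (f x - f (?s x)) * (f y - f (?s y)))")
    case False
    then show ?thesis using sign by (auto elim!: eventually_mono)
  next
    case True
    then obtain x where x: "f x \<noteq> f (?s x)" and
      AEy: "AE y in lborel. v \<bullet> y < c \<longrightarrow> 0 \<le> (f x - f (?s x)) * (f y - f (?s y))" by blast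
    have "AE y in lborel. F y = F' y"
    proof (cases "f x < f (?s x)")
      case True
      have le: "AE y in lborel. F y \<le> F' y"
        using AEy by eventually_elim (use True in \<open>auto simp: F_def F'_def indicator_def zero_le_mult_iff intro!: ennreal_leI\<close>)
      have "AE y in lborel. F' y \<le> F y"
      proof -
        have "(\<integral>\<^sup>+x. F' x - F x \<partial>lborel) = integral\<^sup>N lborel F' - integral\<^sup>N lborel F"
          by (intro nn_integral_diff) (use Ffin le in auto)
        then have "(\<integral>\<^sup>+x. F' x - F x \<partial>lborel) = 0" using eq Ffin by simp
        then have "AE x in lborel. F' x - F x = 0" by (subst (asm) nn_integral_0_iff_AE) auto
        then show ?thesis
          by eventually_elim (auto simp: diff_eq_0_iff_ennreal F_def F'_def indicator_def)
      qed
      with le show ?thesis by eventually_elim simp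
    next
      case False
      have le: "AE y in lborel. F' y \<le> F y"
        using AEy by eventually_elim (use False x in \<open>auto simp: F_def F'_def indicator_def zero_le_mult_iff intro!: ennreal_leI\<close>)
      have "AE y in lborel. F y \<le> F' y"
      proof -
        have "(\<integral>\<^sup>+x. F x - F' x \<partial>lborel) = integral\<^sup>N lborel F - integral\<^sup>N lborel F'"
          by (intro nn_integral_diff) (use Ffin le eq in auto)
        then have "(\<integral>\<^sup>+x. F x - F' x \<partial>lborel) = 0" using eq Ffin by simp
        then have "AE x in lborel. F x - F' x = 0" by (subst (asm) nn_integral_0_iff_AE) auto
        then show ?thesis
          by eventually_elim (auto simp: diff_eq_0_iff_ennreal F_def F'_def indicator_def)
      qed
      with le show ?thesis by eventually_elim simp
    qed
    then show ?thesis
      by eventually_elim (use nonneg in \<open>auto simp: F_def F'_def indicator_def\<close>)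
  qed
  have "AE x in distr lborel borel ?s. v \<bullet> x < c \<longrightarrow> f (?s x) = f x"
    unfolding distr_lborel_hrefl[OF v] by (rule AE1)
  then have "AE x in lborel. v \<bullet> ?s x < c \<longrightarrow> f (?s (?s x)) = f (?s x)"
    by (subst (asm) AE_distr_iff) auto
  with AE1 show ?thesis
  proof eventually_elim
    case (elim x)
    then show ?case using v hrefl_side(1)[OF v, of c x] hrefl_on_hyperplane[of v x c]
      by (cases "v \<bullet> x" c rule: linorder_cases) auto
  qed
qed

text \<open>All mirrors have the origin on the side that receives the larger values. This keeps the
  support in a fixed ball about the origin and never increases the second moment.\<close>

inductive iterated_polarization :: "('a::euclidean_space \<Rightarrow> real) \<Rightarrow> ('a \<Rightarrow> real) \<Rightarrow> bool" for f where
  base: "iterated_polarization f f"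
| step: "iterated_polarization f g \<Longrightarrow> v \<noteq> 0 \<Longrightarrow> 0 \<le> c \<Longrightarrow> iterated_polarization f (polarize v c g)"

lemma norm_hrefl:
  assumes "v \<noteq> 0"
  shows "(norm (hrefl v c x))\<^sup>2 = (norm x)\<^sup>2 - 4 * c * (v \<bullet> x - c) / (v \<bullet> v)"
  using dist_hrefl[OF assms, of 0 c x] by simp

lemma norm_hrefl_mono:
  assumes v: "v \<noteq> 0" and c: "0 \<le> c" and x: "v \<bullet> x \<le> c"
  shows "norm x \<le> norm (hrefl v c x)"
proof -
  have "4 * c * (v \<bullet> x - c) / (v \<bullet> v) \<le> 0"
    using assms by (auto intro!: divide_nonpos_nonneg mult_nonneg_nonpos)
  then have "(norm x)\<^sup>2 \<le> (norm (hrefl v c x))\<^sup>2" by (simp add: norm_hrefl[OF v])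
  then show ?thesis by (simp add: power2_le_iff_abs_le)
qed

text \<open>When \<open>x\<close> and \<open>y\<close> lie on opposite sides, reflecting one of them
  does not increase their distance, so every pair of values that \<open>polarize\<close> can select
  is still controlled. A common modulus for all iterates is what the Arzela-Ascoli theorem
  requires.\<close>

lemma polarize_modulus:
  assumes v: "v \<noteq> 0"
    and f: "\<And>x y. dist x y < \<delta> \<Longrightarrow> \<bar>f x - f y\<bar> \<le> e" and xy: "dist x y < \<delta>"
  shows "\<bar>polarize v c f x - polarize v c f y\<bar> \<le> e"
proof -
  let ?s = "hrefl v c"
  have a: "\<bar>f x - f y\<bar> \<le> e" by (rule f[OF xy])
  have b: "\<bar>f (?s x) - f (?s y)\<bar> \<le> e" by (rule f) (simp add: dist_hrefl_hrefl[OF v] xy)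
  have cross: "\<bar>f x - f (?s y)\<bar> \<le> e \<and> \<bar>f (?s x) - f y\<bar> \<le> e" if "(v \<bullet> x - c) * (v \<bullet> y - c) \<le> 0"
  proof -
    have "4 * (v \<bullet> x - c) * (v \<bullet> y - c) / (v \<bullet> v) \<le> 0"
      using v that by (simp only: mult.assoc) (auto intro!: divide_nonpos_nonneg)
    then have "(dist x (?s y))\<^sup>2 \<le> (dist x y)\<^sup>2" by (simp add: dist_hrefl[OF v])
    then have "dist x (?s y) \<le> dist x y" by simp
    then have d: "dist x (?s y) < \<delta>" using xy by simp
    then show ?thesis by (auto intro!: f simp: dist_hrefl_commute[OF v])
  qed
  consider "v \<bullet> x \<le> c" "v \<bullet> y \<le> c" | "v \<bullet> x > c" "v \<bullet> y > c" | "v \<bullet> x \<le> c" "v \<bullet> y > c" | "v \<bullet> x > c" "v \<bullet> y \<le> c"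
    by linarith
  then show ?thesis
  proof cases
    case 1 then show ?thesis using a b by (auto simp: polarize_def max_def abs_le_iff)
  next
    case 2 then show ?thesis using a b by (auto simp: polarize_def min_def abs_le_iff)
  next
    case 3
    then have "(v \<bullet> x - c) * (v \<bullet> y - c) \<le> 0" by (auto intro!: mult_nonpos_nonneg)
    from cross[OF this] show ?thesis using 3 a b by (auto simp: polarize_def min_def max_def abs_le_iff)
  next
    case 4
    then have "(v \<bullet> x - c) * (v \<bullet> y - c) \<le> 0" by (auto intro!: mult_nonneg_nonpos)
    from cross[OF this] show ?thesis using 4 a b by (auto simp: polarize_def min_def max_def abs_le_iff)
  qed
qed

lemma continuous_AE_eq_imp_eq:
  fixes f g :: "'a::euclidean_space \<Rightarrow> real"
  assumes "continuous_on UNIV f" "continuous_on UNIV g" "AE x in lborel. f x = g x"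
  shows "f x = g x"
proof (rule ccontr)
  assume ne: "f x \<noteq> g x"
  have op: "open {x. f x \<noteq> g x}"
    using assms(1,2) by (intro open_Collect_neq)
  have "AE x in lebesgue. x \<notin> {x. f x \<noteq> g x}"
    using assms(3) by (intro AE_completion) auto
  then have "negligible {x. f x \<noteq> g x}"
    using AE_iff_null_sets[of "{x. f x \<noteq> g x}" lebesgue] op
    by (auto simp: negligible_iff_null_sets borel_open)
  then show False using open_not_negligible[OF op] ne by auto
qed

lemma uniformly_continuous_compact_support:
  fixes f :: "'a::euclidean_space \<Rightarrow> real"
  assumes cont: "continuous_on UNIV f" and supp: "\<And>x. R < norm x \<Longrightarrow> f x = 0" and e: "0 < e"
  obtains \<delta> where "0 < \<delta>" "\<And>x y. dist x y < \<delta> \<Longrightarrow> \<bar>f x - f y\<bar> \<le> e"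
proof -
  have "uniformly_continuous_on (cball 0 (R + 1)) f"
    by (intro compact_uniformly_continuous continuous_on_subset[OF cont]) auto
  then obtain d where d: "0 < d"
    "\<And>x y. x \<in> cball 0 (R + 1) \<Longrightarrow> y \<in> cball 0 (R + 1) \<Longrightarrow> dist y x < d \<Longrightarrow> dist (f y) (f x) < e"
    using e unfolding uniformly_continuous_on_def by metis
  show ?thesis
  proof (rule that[of "min d 1"])
    show "0 < min d 1" using d by simp
    fix x y :: 'a assume xy: "dist x y < min d 1"
    have n: "norm x < norm y + 1" "norm y < norm x + 1"
      using xy norm_triangle_ineq2[of x y] norm_triangle_ineq2[of y x] by (auto simp: dist_norm norm_minus_commute)
    show "\<bar>f x - f y\<bar> \<le> e"
    proof (cases "norm x \<le> R + 1 \<and> norm y \<le> R + 1")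
      case True then show ?thesis using d(2)[of x y] xy by (simp add: dist_real_def dist_commute abs_minus_commute)
    next
      case False
      then have "R < norm x" "R < norm y" using n by auto
      then show ?thesis using supp e by simp
    qed
  qed
qed

definition second_moment :: "('a::euclidean_space \<Rightarrow> real) \<Rightarrow> ennreal" where
  "second_moment f = (\<integral>\<^sup>+x. ennreal ((norm x)\<^sup>2 * f x) \<partial>lborel)"

text \<open>On each mirror pair polarization hands the larger value to the point nearer the origin,
  which lowers the sum of the moments over the pair strictly if the values were in the wrong order.
  Continuity turns equality almost everywhere into equality at the given point.\<close>

lemma second_moment_polarize_eq_imp:
  fixes f :: "'a::euclidean_space \<Rightarrow> real"
  assumes v: "v \<noteq> 0" and c: "0 < c" and cont: "continuous_on UNIV f" "continuous_on UNIV (polarize v c f)"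
    and nonneg: "\<And>x. 0 \<le> f x" and fin: "second_moment f < \<infinity>"
    and le: "second_moment f \<le> second_moment (polarize v c f)" and x: "v \<bullet> x < c"
  shows "f (hrefl v c x) \<le> f x"
proof -
  let ?s = "hrefl v c" and ?p = "polarize v c f"
  define F where "F u x = (norm x)\<^sup>2 * u x + (norm (?s x))\<^sup>2 * u (?s x)" for u :: "'a \<Rightarrow> real" and x
  have [measurable]: "f \<in> borel_measurable borel" using cont by (intro borel_measurable_continuous_onI)
  have two: "(\<integral>\<^sup>+x. ennreal (F u x) \<partial>lborel) = 2 * second_moment u"
    if [measurable]: "u \<in> borel_measurable borel" and "\<And>x. 0 \<le> u x" for u :: "'a \<Rightarrow> real"
  proof -
    have "(\<integral>\<^sup>+x. ennreal (F u x) \<partial>lborel)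
      = (\<integral>\<^sup>+x. ennreal ((norm x)\<^sup>2 * u x) \<partial>lborel) + (\<integral>\<^sup>+x. ennreal ((norm (?s x))\<^sup>2 * u (?s x)) \<partial>lborel)"
      using that(2) unfolding F_def by (subst nn_integral_add[symmetric]) auto
    also have "(\<integral>\<^sup>+x. ennreal ((norm (?s x))\<^sup>2 * u (?s x)) \<partial>lborel) = second_moment u"
      unfolding second_moment_def by (rule nn_integral_hrefl[OF v, of "\<lambda>x. ennreal ((norm x)\<^sup>2 * u x)"]) measurable
    finally show ?thesis by (simp add: mult_2 second_moment_def)
  qed
  have ple: "F ?p x \<le> F f x" for x
  proof -
    have swap: "a * max A B + b * min A B \<le> a * A + b * B" if "a \<le> b" for a b A B :: real
      using mult_nonneg_nonneg[of "b - a" "B - A"] that by (auto simp: max_def min_def algebra_simps)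
    show ?thesis
    proof (cases "v \<bullet> x \<le> c")
      case True
      then have "(norm x)\<^sup>2 \<le> (norm (?s x))\<^sup>2" using norm_hrefl_mono[OF v _ True] c by (auto intro!: power_mono)
      from swap[OF this, of "f x" "f (?s x)"] show ?thesis
        using True hrefl_on_hyperplane[of v x c] unfolding F_def polarize_hrefl[OF v] by (auto simp: polarize_def)
    next
      case False
      then have "v \<bullet> ?s x \<le> c" using hrefl_side(2)[OF v, of c x] by simp
      then have "norm (?s x) \<le> norm x" using norm_hrefl_mono[OF v, of c "?s x"] c v by simp
      then have "(norm (?s x))\<^sup>2 \<le> (norm x)\<^sup>2" by (auto intro!: power_mono)
      from swap[OF this, of "f (?s x)" "f x"] show ?thesis
        using False unfolding F_def polarize_hrefl[OF v] by (auto simp: polarize_def max.commute min.commute add.commute)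
    qed
  qed
  have F0: "0 \<le> F ?p x" "0 \<le> F f x" for x unfolding F_def using nonneg polarize_nonneg[of f v c] by auto
  have "AE x in lborel. ennreal (F ?p x) = ennreal (F f x)"
  proof (rule AE_eq_of_nn_integral_eq)
    show "(\<lambda>x. ennreal (F ?p x)) \<in> borel_measurable lborel" "(\<lambda>x. ennreal (F f x)) \<in> borel_measurable lborel"
      unfolding F_def by measurable
    show "(\<integral>\<^sup>+x. ennreal (F f x) \<partial>lborel) \<le> (\<integral>\<^sup>+x. ennreal (F ?p x) \<partial>lborel)"
      using le by (simp add: two nonneg polarize_nonneg mult_left_mono)
    have "(\<integral>\<^sup>+x. ennreal (F ?p x) \<partial>lborel) \<le> (\<integral>\<^sup>+x. ennreal (F f x) \<partial>lborel)"
      by (intro nn_integral_mono ennreal_leI ple)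
    also have "\<dots> < \<infinity>" using fin by (simp add: two nonneg ennreal_mult_less_top)
    finally show "(\<integral>\<^sup>+x. ennreal (F ?p x) \<partial>lborel) < \<infinity>" .
  qed (auto intro!: ennreal_leI ple)
  then have AE: "AE x in lborel. F ?p x = F f x" by eventually_elim (use F0 in auto)
  have cs: "continuous_on UNIV (\<lambda>x. u (?s x))" if "continuous_on UNIV u" for u :: "'a \<Rightarrow> real"
    by (rule continuous_on_compose2[OF that continuous_on_hrefl]) auto
  have "F ?p x = F f x"
    by (rule continuous_AE_eq_imp_eq[OF _ _ AE])
      (auto simp: F_def[abs_def] intro!: continuous_intros cs cont)
  then have eq: "(norm x)\<^sup>2 * max (f x) (f (?s x)) + (norm (?s x))\<^sup>2 * min (f x) (f (?s x))
      = (norm x)\<^sup>2 * f x + (norm (?s x))\<^sup>2 * f (?s x)"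
    using x unfolding F_def polarize_hrefl[OF v] by (simp add: polarize_def)
  have "4 * c * (v \<bullet> x - c) / (v \<bullet> v) < 0" using c x v by (auto intro!: divide_neg_pos mult_pos_neg)
  then have lt: "(norm x)\<^sup>2 < (norm (?s x))\<^sup>2" by (simp add: norm_hrefl[OF v])
  show ?thesis
  proof (rule ccontr)
    assume neg: "\<not> f (?s x) \<le> f x"
    then have "((norm (?s x))\<^sup>2 - (norm x)\<^sup>2) * (f (?s x) - f x) = 0" using eq by (simp add: algebra_simps)
    then show False using lt neg by simp
  qed
qed

section \<open>Radial symmetrization\<close>

lemma limit_le_const_real:
  fixes X :: "nat \<Rightarrow> real"
  assumes "X \<longlonglongrightarrow> x" "\<And>n. X n \<le> b"
  shows "x \<le> b"
  using assms by (intro LIMSEQ_le_const2) auto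

text \<open>A sequence of iterated polarizations minimizing the second moment has a convergent
  subsequence by the Arzela-Ascoli theorem. Polarizing the limit cannot lower the moment further, so
  its values are ordered across every mirror with positive offset, which is monotonicity in the
  norm. The kernel is bounded by its finite value at zero, so energies pass to the limit by
  dominated convergence.\<close>

lemma symmetrize_continuous:
  fixes f :: "'a::euclidean_space \<Rightarrow> real" and \<kappa> :: "real \<Rightarrow> real"
  assumes cont: "continuous_on UNIV f" and nonneg: "\<And>x. 0 \<le> f x" and supp: "\<And>x. R < norm x \<Longrightarrow> f x = 0"
    and [measurable]: "\<kappa> \<in> borel_measurable borel" and \<kappa>0: "\<And>s. 0 \<le> \<kappa> s"
    and anti: "\<And>s t. 0 \<le> s \<Longrightarrow> s \<le> t \<Longrightarrow> \<kappa> t \<le> \<kappa> s"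
  obtains g :: "'a \<Rightarrow> real" where "continuous_on UNIV g" "\<And>x. 0 \<le> g x" "\<And>x y. norm x = norm y \<Longrightarrow> g x = g y"
    "(\<integral>\<^sup>+x. ennreal (g x) \<partial>lborel) = (\<integral>\<^sup>+x. ennreal (f x) \<partial>lborel)"
    "(\<integral>\<^sup>+x. ennreal ((g x)\<^sup>2) \<partial>lborel) = (\<integral>\<^sup>+x. ennreal ((f x)\<^sup>2) \<partial>lborel)"
    "riesz (\<lambda>s. ennreal (\<kappa> s)) f \<le> riesz (\<lambda>s. ennreal (\<kappa> s)) g"
proof -
  let ?k = "\<lambda>s. ennreal (\<kappa> s)"
  have fm[measurable]: "f \<in> borel_measurable borel" using cont by (rule borel_measurable_continuous_onI)
  have "bounded (f ` cball 0 R)"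
    by (intro compact_imp_bounded compact_continuous_image continuous_on_subset[OF cont]) auto
  then obtain b where b: "\<And>x. norm x \<le> R \<Longrightarrow> f x \<le> b"
    unfolding bounded_iff by (force simp: abs_le_iff)
  define B where "B = max b 0"
  have B: "f x \<le> B" for x using b[of x] supp[of x] by (cases "norm x \<le> R") (auto simp: B_def)
  have B0: "0 \<le> B" by (simp add: B_def)
  \<comment> \<open>A single modulus of continuity of \<open>f\<close>, chosen once, so that
    \<open>P\<close> is inherited by polarizations and by pointwise limits.\<close>
  define md where "md e = (SOME \<delta>. 0 < \<delta> \<and> (\<forall>x y. dist x y < \<delta> \<longrightarrow> \<bar>f x - f y\<bar> \<le> e))" for e :: real
  have md: "0 < md e" "\<And>x y. dist x y < md e \<Longrightarrow> \<bar>f x - f y\<bar> \<le> e" if "0 < e" for e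
  proof -
    have "\<exists>\<delta>. 0 < \<delta> \<and> (\<forall>x y. dist x y < \<delta> \<longrightarrow> \<bar>f x - f y\<bar> \<le> e)"
      by (rule uniformly_continuous_compact_support[OF cont supp that]) blast+
    from someI_ex[OF this] show "0 < md e" "\<And>x y. dist x y < md e \<Longrightarrow> \<bar>f x - f y\<bar> \<le> e"
      unfolding md_def by blast+
  qed
  define P where "P g \<longleftrightarrow> (\<forall>x. 0 \<le> g x \<and> g x \<le> B \<and> (R < norm x \<longrightarrow> g x = 0))
    \<and> (\<forall>e>0. \<forall>x y. dist x y < md e \<longrightarrow> \<bar>g x - g y\<bar> \<le> e)" for g :: "'a \<Rightarrow> real"
  define Q where "Q g \<longleftrightarrow> (\<integral>\<^sup>+x. ennreal (g x) \<partial>lborel) = (\<integral>\<^sup>+x. ennreal (f x) \<partial>lborel)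
    \<and> (\<integral>\<^sup>+x. ennreal ((g x)\<^sup>2) \<partial>lborel) = (\<integral>\<^sup>+x. ennreal ((f x)\<^sup>2) \<partial>lborel)
    \<and> riesz ?k f \<le> riesz ?k g" for g :: "'a \<Rightarrow> real"
  have Pcont: "continuous_on UNIV g" if "P g" for g
    unfolding continuous_on_iff
  proof (intro ballI allI impI)
    fix x :: 'a and e :: real assume "0 < e"
    then have "0 < e / 2" by simp
    have "dist (g x') (g x) < e" if "dist x' x < md (e / 2)" for x'
    proof -
      have "\<bar>g x' - g x\<bar> \<le> e / 2" using \<open>P g\<close> \<open>0 < e / 2\<close> that unfolding P_def by blast
      then show ?thesis using \<open>0 < e\<close> by (simp add: dist_real_def)
    qed
    with md(1)[OF \<open>0 < e / 2\<close>] show "\<exists>d>0. \<forall>x'\<in>UNIV. dist x' x < d \<longrightarrow> dist (g x') (g x) < e"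
      by blast
  qed
  have Ppol: "P (polarize v c g)" if g: "P g" and v: "v \<noteq> 0" and c: "0 \<le> c" for g v c
  proof -
    have "0 \<le> polarize v c g x \<and> polarize v c g x \<le> B \<and> (R < norm x \<longrightarrow> polarize v c g x = 0)" for x
    proof (intro conjI impI)
      show "0 \<le> polarize v c g x" "polarize v c g x \<le> B" using g by (auto simp: P_def polarize_def le_max_iff_disj min_le_iff_disj)
      assume R: "R < norm x"
      show "polarize v c g x = 0"
      proof (cases "v \<bullet> x \<le> c")
        case True
        with norm_hrefl_mono[OF v c True] R g show ?thesis by (simp add: P_def polarize_def)
      next
        case False
        with R g show ?thesis by (simp add: P_def polarize_def min_def)
      qed
    qed
    then show ?thesis using polarize_modulus[OF v, of "md _" g] g unfolding P_def by blast
  qed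
  have inv: "P g \<and> Q g" if "iterated_polarization f g" for g
    using that
  proof induction
    case base
    show ?case using nonneg B supp md by (auto simp: P_def Q_def)
  next
    case (step g v c)
    then have g: "P g" "Q g" by auto
    have [measurable]: "g \<in> borel_measurable borel" using Pcont[OF g(1)] by (rule borel_measurable_continuous_onI)
    have g0: "\<And>x. 0 \<le> g x" using g by (simp add: P_def)
    have "riesz ?k g \<le> riesz ?k (polarize v c g)"
      by (rule riesz_polarize_le[OF step.hyps(2) _ _ g0]) (auto intro!: ennreal_leI anti)
    then have "Q (polarize v c g)"
      using g(2) nn_integral_polarize[OF step.hyps(2), of g c] g0 by (auto simp: Q_def)
    with Ppol[OF g(1) step.hyps(2,3)] show ?case by simp
  qed
  define m where "m = Inf (second_moment ` {g. iterated_polarization f g})"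
  obtain u where u: "\<And>n. u n \<in> second_moment ` {g. iterated_polarization f g}" "u \<longlonglongrightarrow> m"
    using Inf_as_limit[of "second_moment ` {g. iterated_polarization f g}"] iterated_polarization.base
    unfolding m_def by blast
  then have "\<forall>n. \<exists>g. iterated_polarization f g \<and> second_moment g = u n" by (auto simp: image_iff) metis
  then obtain G where G: "\<And>n. iterated_polarization f (G n)" "\<And>n. second_moment (G n) = u n" by metis
  have GP: "P (G n)" "Q (G n)" for n using inv[OF G(1)] by auto
  obtain g0 r where "continuous_on (cball 0 R) g0" and r: "strict_mono (r :: nat \<Rightarrow> nat)"
    and conv: "\<And>e. 0 < e \<Longrightarrow> \<exists>N. \<forall>n x. n \<ge> N \<and> x \<in> cball 0 R \<longrightarrow> norm (G (r n) x - g0 x) < e"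
  proof (rule Arzela_Ascoli[of "cball 0 R" G B])
    show "norm (G n x) \<le> B" for n x using GP(1)[of n] by (auto simp: P_def)
    show "\<exists>d. 0 < d \<and> (\<forall>n y. y \<in> cball 0 R \<and> norm (x - y) < d \<longrightarrow> norm (G n x - G n y) < e)"
      if "0 < e" for x e
    proof -
      have "0 < e / 2" using that by simp
      have "norm (G n x - G n y) < e" if "norm (x - y) < md (e / 2)" for n y
      proof -
        have "\<bar>G n x - G n y\<bar> \<le> e / 2"
          using GP(1)[of n] \<open>0 < e / 2\<close> that unfolding P_def dist_norm by blast
        then show ?thesis using \<open>0 < e\<close> by simp
      qed
      then show ?thesis using md(1)[OF \<open>0 < e / 2\<close>] by blast
    qed
  qed auto
  define g where "g x = (if norm x \<le> R then g0 x else 0)" for x :: 'a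
  have lim: "(\<lambda>n. G (r n) x) \<longlonglongrightarrow> g x" for x
  proof (cases "norm x \<le> R")
    case True
    show ?thesis
    proof (rule LIMSEQ_I)
      fix e :: real assume "0 < e"
      from conv[OF this] True show "\<exists>no. \<forall>n\<ge>no. norm (G (r n) x - g x) < e" by (auto simp: g_def)
    qed
  next
    case False
    then have "G n x = 0" for n using GP(1)[of n] by (auto simp: P_def)
    then show ?thesis using False by (simp add: g_def)
  qed
  have Pg: "P g"
    unfolding P_def
  proof (intro conjI allI impI)
    fix x :: 'a show "0 \<le> g x" by (rule LIMSEQ_le_const[OF lim]) (use GP(1) in \<open>auto simp: P_def\<close>)
    show "g x \<le> B" by (rule limit_le_const_real[OF lim]) (use GP(1) in \<open>auto simp: P_def\<close>)
    show "g x = 0" if "R < norm x" using that by (simp add: g_def)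
  next
    fix e :: real and x y :: 'a assume e: "0 < e" and xy: "dist x y < md e"
    show "\<bar>g x - g y\<bar> \<le> e"
      by (rule limit_le_const_real[OF tendsto_rabs[OF tendsto_diff[OF lim lim]]])
        (use GP(1) e xy in \<open>auto simp: P_def\<close>)
  qed
  have Pm: "h \<in> borel_measurable borel" if "P h" for h
    using Pcont[OF that] by (rule borel_measurable_continuous_onI)
  have [measurable]: "cball (0::'a) R \<in> sets borel" by simp
  have cfin: "emeasure lborel (cball (0::'a) R) < top"
    using emeasure_lborel_cball_finite[of "0::'a" R] by simp
  define D where "D x = ennreal (B * indicator (cball 0 R) x)" for x :: 'a
  have [measurable]: "D \<in> borel_measurable borel" unfolding D_def[abs_def] by measurable
  have intD: "(\<integral>\<^sup>+x. D x \<partial>lborel) < \<infinity>"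
    unfolding D_def by (simp add: ennreal_mult' B0 nn_integral_cmult ennreal_mult_less_top cfin ennreal_indicator)
  have PD: "ennreal (h x) \<le> D x" "0 \<le> h x" "h x \<le> B" "R < norm x \<Longrightarrow> h x = 0" if "P h" for h and x :: 'a
    using that by (auto simp: P_def D_def indicator_def intro!: ennreal_leI)
  have dc: "(\<lambda>n. \<integral>\<^sup>+x. ennreal (w x (H n x)) \<partial>lborel) \<longlonglongrightarrow> (\<integral>\<^sup>+x. ennreal (w x (h x)) \<partial>lborel)"
    if H: "\<And>n. P (H n)" and h: "P h" and Hh: "\<And>x. (\<lambda>n. H n x) \<longlonglongrightarrow> h x"
      and [measurable]: "case_prod w \<in> borel_measurable (borel \<Otimes>\<^sub>M borel)"
      and w: "\<And>x. w x 0 = 0" "\<And>x. continuous_on UNIV (w x)"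
        "\<And>x z. norm x \<le> R \<Longrightarrow> 0 \<le> z \<Longrightarrow> z \<le> B \<Longrightarrow> w x z \<le> C" for H h w C
  proof -
    note [measurable] = Pm[OF H] Pm[OF h]
    show ?thesis
    proof (rule nn_integral_dominated_convergence[where w="\<lambda>x. ennreal (\<bar>C\<bar> * indicator (cball 0 R) x)"])
      have "w x (H n x) \<le> \<bar>C\<bar> * indicator (cball 0 R) x" for n x
        using w(3)[of x "H n x"] PD(2,3)[OF H, of n x] PD(4)[OF H, of x n] w(1)
        by (cases "norm x \<le> R") (auto simp: indicator_def)
      then show "AE x in lborel. ennreal (w x (H n x)) \<le> ennreal (\<bar>C\<bar> * indicator (cball 0 R) x)" for n
        by (auto intro!: AE_I2 ennreal_leI)
      show "(\<integral>\<^sup>+x. ennreal (\<bar>C\<bar> * indicator (cball (0::'a) R) x) \<partial>lborel) < \<infinity>"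
        by (simp add: ennreal_mult' ennreal_indicator nn_integral_cmult_indicator ennreal_mult_less_top cfin)
      show "AE x in lborel. (\<lambda>n. ennreal (w x (H n x))) \<longlonglongrightarrow> ennreal (w x (h x))"
        by (intro AE_I2 tendsto_ennrealI continuous_on_tendsto_compose[OF w(2) Hh]) auto
    qed (measurable)
  qed
  have mom: "(\<lambda>n. second_moment (H n)) \<longlonglongrightarrow> second_moment h"
    if "\<And>n. P (H n)" "P h" "\<And>x. (\<lambda>n. H n x) \<longlonglongrightarrow> h x" for H h
    unfolding second_moment_def
  proof (rule dc[where w="\<lambda>x z. (norm x)\<^sup>2 * z" and C="R\<^sup>2 * B"])
    show "(norm x)\<^sup>2 * z \<le> R\<^sup>2 * B" if "norm x \<le> R" "0 \<le> z" "z \<le> B" for x :: 'a and z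
      using that by (intro mult_mono power_mono) auto
  qed (use that in \<open>auto intro!: continuous_intros\<close>)
  have Qg: "Q g"
  proof -
    have "(\<lambda>n. \<integral>\<^sup>+x. ennreal (G (r n) x) \<partial>lborel) \<longlonglongrightarrow> (\<integral>\<^sup>+x. ennreal (g x) \<partial>lborel)"
      by (rule dc[where w="\<lambda>x z. z" and C=B]) (auto intro: GP Pg lim)
    then have 1: "(\<integral>\<^sup>+x. ennreal (g x) \<partial>lborel) = (\<integral>\<^sup>+x. ennreal (f x) \<partial>lborel)"
      using GP(2) by (auto simp: Q_def LIMSEQ_const_iff)
    have "(\<lambda>n. \<integral>\<^sup>+x. ennreal ((G (r n) x)\<^sup>2) \<partial>lborel) \<longlonglongrightarrow> (\<integral>\<^sup>+x. ennreal ((g x)\<^sup>2) \<partial>lborel)"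
      by (rule dc[where w="\<lambda>x z. z\<^sup>2" and C="B\<^sup>2"]) (auto intro!: GP Pg lim continuous_intros power_mono)
    then have 2: "(\<integral>\<^sup>+x. ennreal ((g x)\<^sup>2) \<partial>lborel) = (\<integral>\<^sup>+x. ennreal ((f x)\<^sup>2) \<partial>lborel)"
      using GP(2) by (auto simp: Q_def LIMSEQ_const_iff)
    note [measurable] = Pm[OF GP(1)] Pm[OF Pg]
    have "(\<lambda>n. riesz ?k (G (r n))) \<longlonglongrightarrow> riesz ?k g"
      unfolding riesz_def
    proof (rule nn_integral_dominated_convergence[where w="\<lambda>x. \<integral>\<^sup>+y. ?k 0 * (D x * D y) \<partial>lborel"])
      have dom: "?k ((dist x y)\<^sup>2) * ennreal (h x * h y) \<le> ?k 0 * (D x * D y)" if "P h" for h and x y :: 'a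
        using PD[OF that] by (intro mult_mono ennreal_leI anti) (auto simp: ennreal_mult' intro!: mult_mono)
      show "AE x in lborel. (\<integral>\<^sup>+y. ?k ((dist x y)\<^sup>2) * ennreal (G (r n) x * G (r n) y) \<partial>lborel)
          \<le> (\<integral>\<^sup>+y. ?k 0 * (D x * D y) \<partial>lborel)" for n
        by (intro AE_I2 nn_integral_mono dom GP)
      show "(\<integral>\<^sup>+x. \<integral>\<^sup>+y. ?k 0 * (D x * D y) \<partial>lborel \<partial>lborel) < \<infinity>"
        using intD by (simp add: nn_integral_cmult nn_integral_multc ennreal_mult_less_top)
      show "AE x in lborel. (\<lambda>n. \<integral>\<^sup>+y. ?k ((dist x y)\<^sup>2) * ennreal (G (r n) x * G (r n) y) \<partial>lborel)
          \<longlonglongrightarrow> (\<integral>\<^sup>+y. ?k ((dist x y)\<^sup>2) * ennreal (g x * g y) \<partial>lborel)"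
      proof (rule AE_I2)
        fix x :: 'a
        show "(\<lambda>n. \<integral>\<^sup>+y. ?k ((dist x y)\<^sup>2) * ennreal (G (r n) x * G (r n) y) \<partial>lborel)
          \<longlonglongrightarrow> (\<integral>\<^sup>+y. ?k ((dist x y)\<^sup>2) * ennreal (g x * g y) \<partial>lborel)"
        proof (rule nn_integral_dominated_convergence[where w="\<lambda>y. ?k 0 * (D x * D y)"])
          show "AE y in lborel. ?k ((dist x y)\<^sup>2) * ennreal (G (r n) x * G (r n) y) \<le> ?k 0 * (D x * D y)" for n
            by (intro AE_I2 dom GP)
          have "D x < top" by (simp add: D_def)
          then show "(\<integral>\<^sup>+y. ?k 0 * (D x * D y) \<partial>lborel) < \<infinity>"
            using intD by (simp add: nn_integral_cmult ennreal_mult_less_top)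
          show "AE y in lborel. (\<lambda>n. ?k ((dist x y)\<^sup>2) * ennreal (G (r n) x * G (r n) y))
              \<longlonglongrightarrow> ?k ((dist x y)\<^sup>2) * ennreal (g x * g y)"
            by (intro AE_I2 ennreal_tendsto_cmult tendsto_ennrealI tendsto_mult lim) auto
        qed (measurable)
      qed
    qed (measurable)
    then have "riesz ?k f \<le> riesz ?k g"
      by (rule LIMSEQ_le_const) (use GP(2) in \<open>auto simp: Q_def\<close>)
    with 1 2 show ?thesis by (simp add: Q_def)
  qed
  have momg: "second_moment g = m"
  proof -
    have "(\<lambda>n. second_moment (G (r n))) \<longlonglongrightarrow> second_moment g"
      by (rule mom[OF GP(1) Pg lim])
    moreover have "(\<lambda>n. second_moment (G (r n))) \<longlonglongrightarrow> m"
      unfolding G(2) using LIMSEQ_subseq_LIMSEQ[OF u(2) r] by (simp add: o_def)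
    ultimately show ?thesis by (rule LIMSEQ_unique)
  qed
  have "second_moment f < \<infinity>"
  proof -
    have "second_moment f \<le> (\<integral>\<^sup>+x. ennreal (R\<^sup>2) * D x \<partial>lborel)"
      unfolding second_moment_def
    proof (rule nn_integral_mono)
      fix x :: 'a
      have "(norm x)\<^sup>2 * f x \<le> R\<^sup>2 * (B * indicator (cball 0 R) x)"
        using nonneg[of x] B[of x] supp[of x] by (cases "norm x \<le> R") (auto intro!: mult_mono power_mono)
      then show "ennreal ((norm x)\<^sup>2 * f x) \<le> ennreal (R\<^sup>2) * D x"
        by (simp add: D_def ennreal_mult'[symmetric] ennreal_leI)
    qed
    also have "\<dots> < \<infinity>" using intD by (simp add: nn_integral_cmult ennreal_mult_less_top)
    finally show ?thesis .
  qed
  moreover have "m \<le> second_moment f" unfolding m_def by (intro Inf_lower) (auto intro: iterated_polarization.base)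
  ultimately have fin: "second_moment g < \<infinity>" using momg by simp
  \<comment> \<open>Polarization commutes with pointwise limits, and the polarized members of the
    sequence are again iterated polarizations, hence have moment at least \<open>m\<close>.\<close>
  have le_pol: "second_moment g \<le> second_moment (polarize v c g)" if v: "v \<noteq> 0" and c: "0 \<le> c" for v c
  proof -
    have "(\<lambda>n. second_moment (polarize v c (G (r n)))) \<longlonglongrightarrow> second_moment (polarize v c g)"
    proof (rule mom)
      show "(\<lambda>n. polarize v c (G (r n)) x) \<longlonglongrightarrow> polarize v c g x" for x
        unfolding polarize_def by (auto intro!: tendsto_max tendsto_min lim)
    qed (auto intro!: Ppol GP Pg v c)
    then show ?thesis
      unfolding momg
      by (rule LIMSEQ_le_const) (auto simp: m_def intro!: Inf_lower iterated_polarization.step G v c)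
  qed
  have mono: "g y \<le> g x" if "norm x < norm y" for x y :: 'a
  proof -
    have xy: "x \<noteq> y" using that by auto
    let ?v = "y - x" and ?c = "(y \<bullet> y - x \<bullet> x) / 2"
    have "(norm x)\<^sup>2 < (norm y)\<^sup>2" using that by (intro power_strict_mono) auto
    then have c: "0 < ?c" by (simp add: power2_norm_eq_inner)
    have "0 < (y - x) \<bullet> (y - x)" using xy by simp
    then have side: "?v \<bullet> x < ?c" by (simp add: inner_diff_left inner_diff_right inner_commute field_simps)
    have "g (hrefl ?v ?c x) \<le> g x"
      by (rule second_moment_polarize_eq_imp[OF _ c _ _ _ fin le_pol side])
        (use xy c Pg in \<open>auto intro!: Pcont Ppol simp: PD\<close>)
    then show ?thesis by (simp add: exists_hrefl[OF xy])
  qed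
  \<comment> \<open>A mirror through the origin leaves the second moment unchanged and gives no
    information, so points of equal norm are compared through shrunken copies of one of them and
    continuity.\<close>
  have radial_le: "g y \<le> g x" if "norm x = norm y" for x y :: 'a
  proof (cases "x = 0")
    case True then show ?thesis using that by simp
  next
    case False
    have "(\<lambda>n. g ((1 - 1 / real (Suc (Suc n))) *\<^sub>R x)) \<longlonglongrightarrow> g ((1 - 0) *\<^sub>R x)"
      by (intro continuous_on_tendsto_compose[OF Pcont[OF Pg]] tendsto_intros
          LIMSEQ_Suc[OF LIMSEQ_Suc[OF lim_1_over_n]]) auto
    then have *: "(\<lambda>n. g ((1 - 1 / real (Suc (Suc n))) *\<^sub>R x)) \<longlonglongrightarrow> g x" by simp
    show ?thesis
    proof (rule LIMSEQ_le_const[OF *], intro exI allI impI)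
      fix n :: nat
      have "norm ((1 - 1 / real (Suc (Suc n))) *\<^sub>R x) < norm y"
        using False that by (auto simp: field_simps)
      then show "g y \<le> g ((1 - 1 / real (Suc (Suc n))) *\<^sub>R x)" by (rule mono)
    qed
  qed
  show ?thesis
  proof (rule that[of g])
    show "continuous_on UNIV g" by (rule Pcont[OF Pg])
    show "g x = g y" if "norm x = norm y" for x y :: 'a using radial_le[of x y] radial_le[of y x] that by simp
  qed (use Pg Qg in \<open>auto simp: P_def Q_def\<close>)
qed

section \<open>Radial and axisymmetric integrals\<close>

text \<open>The derivative is asked for only inside the interval because the arcsine primitives used
  below are not differentiable at its ends.\<close>

lemma nn_integral_FTC_Ioo:
  fixes f F :: "real \<Rightarrow> real"
  assumes ab: "a \<le> b" and cont: "continuous_on {a..b} F"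
    and der: "\<And>x. a < x \<Longrightarrow> x < b \<Longrightarrow> (F has_real_derivative f x) (at x)"
    and nonneg: "\<And>x. a < x \<Longrightarrow> x < b \<Longrightarrow> 0 \<le> f x"
    and [measurable]: "f \<in> borel_measurable borel"
  shows "(\<integral>\<^sup>+x. ennreal (f x) * indicator {a<..<b} x \<partial>lborel) = ennreal (F b - F a)"
proof -
  have "(f has_integral (F b - F a)) {a..b}"
    by (rule fundamental_theorem_of_calculus_interior[OF ab cont])
      (use der in \<open>auto simp: has_real_derivative_iff_has_vector_derivative[symmetric]\<close>)
  then have "(f has_integral (F b - F a)) {a<..<b}"
    by (simp add: has_integral_Icc_iff_Ioo)
  then have "((\<lambda>x. if x \<in> {a<..<b} then f x else 0) has_integral (F b - F a)) UNIV"
    by (simp only: has_integral_restrict_UNIV)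
  then have "(\<integral>\<^sup>+x. ennreal (if x \<in> {a<..<b} then f x else 0) \<partial>lborel) = ennreal (F b - F a)"
    by (rule nn_integral_has_integral_lborel[rotated 2]) (auto simp: nonneg)
  moreover have "(\<integral>\<^sup>+x. ennreal (if x \<in> {a<..<b} then f x else 0) \<partial>lborel)
      = (\<integral>\<^sup>+x. ennreal (f x) * indicator {a<..<b} x \<partial>lborel)"
    by (intro nn_integral_cong) (auto simp: indicator_def)
  ultimately show ?thesis by simp
qed

text \<open>Density of the law of the squared norm under Lebesgue measure on a
  \<open>d\<close>-dimensional space: the derivative of the ball volume, which is
  \<open>unit_ball_vol d\<close> times \<open>v powr (d / 2)\<close>.\<close>

definition radial_density :: "nat \<Rightarrow> real \<Rightarrow> real" where
  "radial_density d v = (if 0 < v then real d / 2 * unit_ball_vol (real d) * v powr (real d / 2 - 1) else 0)"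

lemma radial_density_measurable [measurable]: "radial_density d \<in> borel_measurable borel"
  unfolding radial_density_def by measurable

lemma radial_density_nonneg: "0 \<le> radial_density d v"
  by (simp add: radial_density_def)

lemma distr_norm_square:
  "distr lborel borel (\<lambda>x::'a::euclidean_space. (norm x)\<^sup>2) =
     density lborel (\<lambda>v. ennreal (radial_density DIM('a) v))"
proof (rule measure_eqI_generator_eq[where E="range (\<lambda>t::real. {..t})" and \<Omega>=UNIV and A="\<lambda>n. {..real n}"])
  let ?d = "real DIM('a)"
  have d: "0 < ?d" by simp
  have pre: "{x::'a. (norm x)\<^sup>2 \<le> t} = (if 0 \<le> t then cball 0 (sqrt t) else {})" for t
    by (auto simp: real_le_rsqrt real_sqrt_le_iff intro: order_trans[OF zero_le_power2])
       (metis norm_ge_zero real_sqrt_le_iff real_sqrt_abs2 abs_of_nonneg power2_eq_square real_sqrt_le_mono real_sqrt_pow2 power_mono)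
  have emb: "emeasure (distr lborel borel (\<lambda>x::'a. (norm x)\<^sup>2)) {..t}
     = ennreal (if 0 \<le> t then unit_ball_vol ?d * t powr (?d / 2) else 0)" for t
  proof -
    have "emeasure (distr lborel borel (\<lambda>x::'a. (norm x)\<^sup>2)) {..t} = emeasure lborel {x::'a. (norm x)\<^sup>2 \<le> t}"
      by (subst emeasure_distr) (auto intro!: arg_cong[where f="emeasure lborel"])
    also have "\<dots> = ennreal (if 0 \<le> t then unit_ball_vol ?d * t powr (?d / 2) else 0)"
    proof (cases "0 \<le> t")
      case True
      have "sqrt t ^ DIM('a) = t powr (?d / 2)"
      proof (cases "t = 0")
        case True then show ?thesis by simp
      next
        case False
        with \<open>0 \<le> t\<close> show ?thesis by (simp add: powr_half_sqrt[symmetric] powr_realpow[symmetric] powr_powr)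
      qed
      then show ?thesis using True by (simp add: pre emeasure_cball)
    qed (simp add: pre)
    finally show ?thesis .
  qed
  show "emeasure (distr lborel borel (\<lambda>x::'a. (norm x)\<^sup>2)) X = emeasure (density lborel (\<lambda>v. ennreal (radial_density DIM('a) v))) X"
    if X: "X \<in> range (\<lambda>t::real. {..t})" for X
  proof -
    from X obtain t :: real where X: "X = {..t}" by (auto simp: image_iff)
    have "emeasure (density lborel (\<lambda>v. ennreal (radial_density DIM('a) v))) {..t}
      = (\<integral>\<^sup>+v. ennreal (radial_density DIM('a) v * indicator {0..t} v) \<partial>lborel)"
      by (subst emeasure_density)
        (auto intro!: nn_integral_cong simp: indicator_def radial_density_def)
    also have "\<dots> = ennreal (if 0 \<le> t then unit_ball_vol ?d * t powr (?d / 2) else 0)"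
    proof (cases "0 \<le> t")
      case True
      have "((\<lambda>v. v powr (?d / 2 - 1)) has_integral (t powr (?d / 2 - 1 + 1) / (?d / 2 - 1 + 1))) {0..t}"
        by (rule has_integral_powr_from_0) (use True d in auto)
      then have "((\<lambda>v. ?d / 2 * unit_ball_vol ?d * v powr (?d / 2 - 1)) has_integral
          (?d / 2 * unit_ball_vol ?d * (t powr (?d / 2 - 1 + 1) / (?d / 2 - 1 + 1)))) {0..t}"
        by (rule has_integral_mult_right)
      also have "?d / 2 * unit_ball_vol ?d * (t powr (?d / 2 - 1 + 1) / (?d / 2 - 1 + 1)) = unit_ball_vol ?d * t powr (?d / 2)"
        using d by (simp add: field_simps)
      finally have "(radial_density DIM('a) has_integral unit_ball_vol ?d * t powr (?d / 2)) {0..t}"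
        by (rule has_integral_spike[OF negligible_sing[of 0], rotated]) (auto simp: radial_density_def)
      then have "((\<lambda>v. if v \<in> {0..t} then radial_density DIM('a) v else 0) has_integral unit_ball_vol ?d * t powr (?d / 2)) UNIV"
        by (simp only: has_integral_restrict_UNIV)
      moreover have "(\<lambda>v. if v \<in> {0..t} then radial_density DIM('a) v else 0) = (\<lambda>v. radial_density DIM('a) v * indicator {0..t} v)"
        by (auto simp: indicator_def)
      ultimately show ?thesis
        using True by (subst nn_integral_has_integral_lborel) (auto simp: radial_density_nonneg)
    qed simp
    finally show ?thesis unfolding X emb ..
  qed
  show "emeasure (distr lborel borel (\<lambda>x::'a. (norm x)\<^sup>2)) {..real i} \<noteq> \<infinity>" for i
    unfolding emb by simp
  show "sets (distr lborel borel (\<lambda>x::'a. (norm x)\<^sup>2)) = sigma_sets UNIV (range (\<lambda>t::real. {..t}))"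
    by (simp add: borel_eq_atMost)
  show "sets (density lborel (\<lambda>v. ennreal (radial_density DIM('a) v))) = sigma_sets UNIV (range (\<lambda>t::real. {..t}))"
    by (simp add: borel_eq_atMost)
  show "Int_stable (range (\<lambda>t::real. {..t}))"
    by (auto simp: Int_stable_def image_iff intro: exI[of _ "min _ _"])
  show "(\<Union>i. {..real i}) = UNIV" by (auto intro: real_arch_simple)
qed auto

lemma nn_integral_norm_square:
  assumes [measurable]: "h \<in> borel_measurable borel"
  shows "(\<integral>\<^sup>+x. h ((norm (x::'a::euclidean_space))\<^sup>2) \<partial>lborel) =
    (\<integral>\<^sup>+v. ennreal (radial_density DIM('a) v) * h v \<partial>lborel)"
proof -
  have "(\<integral>\<^sup>+x. h ((norm (x::'a))\<^sup>2) \<partial>lborel) = (\<integral>\<^sup>+v. h v \<partial>distr lborel borel (\<lambda>x::'a. (norm x)\<^sup>2))"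
    by (subst nn_integral_distr) auto
  then show ?thesis by (simp add: distr_norm_square nn_integral_density)
qed

lemma nn_integral_lborel_prod:
  fixes F :: "'a::euclidean_space \<times> 'b::euclidean_space \<Rightarrow> ennreal"
  assumes [measurable]: "F \<in> borel_measurable borel"
  shows "(\<integral>\<^sup>+z. F z \<partial>lborel) = (\<integral>\<^sup>+x. \<integral>\<^sup>+y. F (x, y) \<partial>lborel \<partial>lborel)"
proof -
  have "F \<in> borel_measurable (lborel \<Otimes>\<^sub>M lborel)"
    by (simp add: borel_prod lborel_prod)
  from lborel.nn_integral_fst[OF this] show ?thesis by (simp add: lborel_prod)
qed

text \<open>For \<open>z = (t, y)\<close> of squared norm \<open>u\<close> the squared norm of
  \<open>y\<close> is \<open>u - t\<^sup>2\<close>, so each sphere is sliced orthogonally to the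
  axis; the density vanishes where the slice is empty.\<close>

lemma nn_integral_cylindrical:
  fixes F :: "real \<Rightarrow> real \<Rightarrow> ennreal"
  assumes [measurable]: "case_prod F \<in> borel_measurable (borel \<Otimes>\<^sub>M borel)"
  shows "(\<integral>\<^sup>+z. F (fst z) ((norm (z::real \<times> 'a::euclidean_space))\<^sup>2) \<partial>lborel) =
    (\<integral>\<^sup>+u. \<integral>\<^sup>+t. ennreal (radial_density DIM('a) (u - t\<^sup>2)) * F t u \<partial>lborel \<partial>lborel)"
proof -
  have [measurable]: "(fst :: real \<times> 'a \<Rightarrow> real) \<in> borel_measurable borel"
    by (intro borel_measurable_continuous_onI continuous_intros)
  have "(\<integral>\<^sup>+z. F (fst z) ((norm (z::real \<times> 'a))\<^sup>2) \<partial>lborel)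
      = (\<integral>\<^sup>+t. \<integral>\<^sup>+y. F t (t\<^sup>2 + (norm (y::'a))\<^sup>2) \<partial>lborel \<partial>lborel)"
    by (subst nn_integral_lborel_prod) (auto simp: norm_Pair)
  also have "\<dots> = (\<integral>\<^sup>+t. \<integral>\<^sup>+v. ennreal (radial_density DIM('a) v) * F t (t\<^sup>2 + v) \<partial>lborel \<partial>lborel)"
    by (intro nn_integral_cong nn_integral_norm_square) measurable
  also have "\<dots> = (\<integral>\<^sup>+t. \<integral>\<^sup>+u. ennreal (radial_density DIM('a) (u - t\<^sup>2)) * F t u \<partial>lborel \<partial>lborel)"
  proof (rule nn_integral_cong)
    fix t :: real
    show "(\<integral>\<^sup>+v. ennreal (radial_density DIM('a) v) * F t (t\<^sup>2 + v) \<partial>lborel)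
      = (\<integral>\<^sup>+u. ennreal (radial_density DIM('a) (u - t\<^sup>2)) * F t u \<partial>lborel)"
      using nn_integral_lborel_translate[of "\<lambda>u. ennreal (radial_density DIM('a) (u - t\<^sup>2)) * F t u" "t\<^sup>2"]
      by (simp add: add.commute)
  qed
  also have "\<dots> = (\<integral>\<^sup>+u. \<integral>\<^sup>+t. ennreal (radial_density DIM('a) (u - t\<^sup>2)) * F t u \<partial>lborel \<partial>lborel)"
    by (rule lborel_pair.Fubini') measurable
  finally show ?thesis .
qed

text \<open>The mirror bisecting two points of equal norm passes through the origin, so it preserves
  norms and exchanges the points. In the kernel computations this moves the base point to the
  axis.\<close>

lemma nn_integral_norm_square_dist:
  fixes x x' :: "'a::euclidean_space" and F :: "real \<Rightarrow> real \<Rightarrow> ennreal"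
  assumes [measurable]: "case_prod F \<in> borel_measurable (borel \<Otimes>\<^sub>M borel)" and eq: "norm x = norm x'"
  shows "(\<integral>\<^sup>+y. F ((norm y)\<^sup>2) ((dist x y)\<^sup>2) \<partial>lborel) = (\<integral>\<^sup>+y. F ((norm y)\<^sup>2) ((dist x' y)\<^sup>2) \<partial>lborel)"
proof (cases "x = x'")
  case False
  let ?v = "x' - x"
  have v: "?v \<noteq> 0" using False by simp
  have "(x' \<bullet> x' - x \<bullet> x) / 2 = 0" using eq by (simp add: norm_eq_sqrt_inner)
  with exists_hrefl[OF False] have x': "hrefl ?v 0 x = x'" by simp
  have "(\<integral>\<^sup>+y. F ((norm y)\<^sup>2) ((dist x y)\<^sup>2) \<partial>lborel)
    = (\<integral>\<^sup>+y. F ((norm (hrefl ?v 0 y))\<^sup>2) ((dist x (hrefl ?v 0 y))\<^sup>2) \<partial>lborel)"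
    by (rule nn_integral_hrefl[OF v, of "\<lambda>y. F ((norm y)\<^sup>2) ((dist x y)\<^sup>2)", symmetric]) measurable
  also have "\<dots> = (\<integral>\<^sup>+y. F ((norm y)\<^sup>2) ((dist x' y)\<^sup>2) \<partial>lborel)"
    unfolding dist_hrefl_commute[OF v, symmetric] x' norm_hrefl[OF v] by simp
  finally show ?thesis .
qed simp

text \<open>In dimension one the law of the squared norm is the substitution
  \<open>v = q\<^sup>2\<close>, counted twice because of the two signs of \<open>q\<close>.\<close>

lemma nn_integral_square_substitution:
  assumes [measurable]: "g \<in> borel_measurable borel"
  shows "(\<integral>\<^sup>+v. g v * indicator {0<..} v \<partial>lborel) = (\<integral>\<^sup>+q. ennreal (2 * q) * g (q\<^sup>2) * indicator {0<..} q \<partial>lborel)"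
proof -
  define F where "F q = ennreal q * g (q\<^sup>2) * indicator {0<..} q" for q :: real
  have [measurable]: "F \<in> borel_measurable borel" unfolding F_def[abs_def] by measurable
  have "(\<integral>\<^sup>+v. g v * indicator {0<..} v \<partial>lborel)
     = (\<integral>\<^sup>+v. ennreal (radial_density DIM(real) v) * (ennreal (sqrt v) * g v) \<partial>lborel)"
  proof (intro nn_integral_cong)
    fix v :: real
    have "radial_density DIM(real) v * sqrt v = 1" if "0 < v"
    proof -
      have "v powr (- 1 / 2) * v powr (1 / 2) = 1" using that by (simp add: powr_add[symmetric])
      then show ?thesis using that by (simp add: radial_density_def powr_half_sqrt[symmetric])
    qed
    then have "ennreal (radial_density DIM(real) v) * (ennreal (sqrt v) * g v) = g v" if "0 < v"
      using that by (simp add: mult.assoc[symmetric] ennreal_mult[symmetric] radial_density_nonneg)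
    then show "g v * indicator {0<..} v = ennreal (radial_density DIM(real) v) * (ennreal (sqrt v) * g v)"
      by (cases "0 < v") (auto simp: radial_density_def)
  qed
  also have "\<dots> = (\<integral>\<^sup>+q. ennreal (sqrt ((norm (q::real))\<^sup>2)) * g ((norm q)\<^sup>2) \<partial>lborel)"
    by (rule nn_integral_norm_square[symmetric]) measurable
  also have "\<dots> = (\<integral>\<^sup>+q. (F q + F (- q)) \<partial>lborel)"
    by (intro nn_integral_cong) (auto simp: F_def indicator_def split: if_splits)
  also have "\<dots> = (\<integral>\<^sup>+q. F q \<partial>lborel) + (\<integral>\<^sup>+q. F (- q) \<partial>lborel)"
    by (rule nn_integral_add) measurable
  also have "(\<integral>\<^sup>+q. F (- q) \<partial>lborel) = (\<integral>\<^sup>+q. F q \<partial>distr lborel borel uminus)"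
    by (subst nn_integral_distr) auto
  also have "(\<integral>\<^sup>+q. F q \<partial>lborel) + (\<integral>\<^sup>+q. F q \<partial>distr lborel borel uminus) = 2 * (\<integral>\<^sup>+q. F q \<partial>lborel)"
    by (simp add: lborel_distr_uminus mult_2)
  also have "\<dots> = (\<integral>\<^sup>+q. 2 * F q \<partial>lborel)" by (simp add: nn_integral_cmult)
  also have "\<dots> = (\<integral>\<^sup>+q. ennreal (2 * q) * g (q\<^sup>2) * indicator {0<..} q \<partial>lborel)"
    by (intro nn_integral_cong) (auto simp: F_def indicator_def ennreal_mult mult.assoc)
  finally show ?thesis .
qed

section \<open>Two explicit integrals along the axis\<close>

lemma DERIV_arcsin_comp:
  assumes q: "(q has_real_derivative q') (at t)" and pos: "0 < w" and eq: "1 - (q t)\<^sup>2 = w\<^sup>2"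
  shows "((\<lambda>t. arcsin (q t)) has_real_derivative q' / w) (at t)"
proof -
  have "(q t)\<^sup>2 < 1" using eq pos by (smt (verit) zero_less_power)
  then have "\<bar>q t\<bar> < 1" by (simp add: abs_square_less_1)
  moreover have "sqrt (1 - (q t)\<^sup>2) = w" using eq pos by simp
  ultimately show ?thesis
    using DERIV_chain2[OF DERIV_arcsin[of "q t"] q] by (simp add: divide_inverse mult.commute)
qed

text \<open>This is Newton's theorem for a sphere of radius \<open>s\<close> in four dimensions and
  a base point at distance \<open>r\<close>: slicing orthogonally to the axis through the base point
  gives the slices a density proportional to the square root in the numerator.\<close>

lemma nn_integral_semicircle_kernel:
  fixes r s :: real
  assumes r: "0 < r" and s: "0 < s" and rs: "r \<noteq> s"
  shows "(\<integral>\<^sup>+t. ennreal (sqrt (s\<^sup>2 - t\<^sup>2) / (r\<^sup>2 + s\<^sup>2 - 2 * r * t)) * indicator {- s<..<s} t \<partial>lborel) =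
    ennreal (pi / 2 * s\<^sup>2 / max (r\<^sup>2) (s\<^sup>2))"
proof -
  define A B D where "A = r\<^sup>2 + s\<^sup>2" and "B = 2 * r" and "D = \<bar>r\<^sup>2 - s\<^sup>2\<bar>"
  have B: "0 < B" using r by (simp add: B_def)
  have D2: "D\<^sup>2 = A\<^sup>2 - B\<^sup>2 * s\<^sup>2" by (simp add: A_def B_def D_def power2_eq_square algebra_simps)
  have D: "0 < D" using r s rs by (simp add: D_def power2_eq_iff)
  have ABs: "B * s < A"
  proof -
    have "0 < (r - s)\<^sup>2" using rs by simp
    then show ?thesis by (simp add: A_def B_def power2_eq_square algebra_simps)
  qed
  have pos: "0 < A - B * t" if "- s \<le> t" "t \<le> s" for t
    using ABs mult_left_mono[OF that(2) less_imp_le[OF B]] by simp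
  \<comment> \<open>A fractional linear map sending \<open>- s\<close> and \<open>s\<close> to
    \<open>- 1\<close> and \<open>1\<close>. Its arcsine integrates the part of the integrand that
    keeps the linear denominator after partial fractions; the other two terms of \<open>F\<close>
    integrate the rest.\<close>
  define q where "q t = (A * t - B * s\<^sup>2) / (s * (A - B * t))" for t
  define F where "F t = - sqrt (s\<^sup>2 - t\<^sup>2) / B + A / B\<^sup>2 * arcsin (t / s) - D / B\<^sup>2 * arcsin (q t)" for t
  have qid: "1 - (q t)\<^sup>2 = D\<^sup>2 * (s\<^sup>2 - t\<^sup>2) / (s * (A - B * t))\<^sup>2" if "- s \<le> t" "t \<le> s" for t
  proof -
    have "(s * (A - B * t))\<^sup>2 - (A * t - B * s\<^sup>2)\<^sup>2 = D\<^sup>2 * (s\<^sup>2 - t\<^sup>2)"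
      unfolding D2 by (simp add: power2_eq_square algebra_simps)
    moreover have "(s * (A - B * t))\<^sup>2 \<noteq> 0" using pos[OF that] s by simp
    ultimately show ?thesis unfolding q_def power_divide by (simp add: field_simps)
  qed
  have q1: "\<bar>q t\<bar> \<le> 1" if t: "- s \<le> t" "t \<le> s" for t
  proof -
    have "t\<^sup>2 \<le> s\<^sup>2" using abs_le_square_iff[of t s] t by (simp add: abs_le_iff)
    then have "0 \<le> 1 - (q t)\<^sup>2" unfolding qid[OF t] by (intro divide_nonneg_nonneg mult_nonneg_nonneg) auto
    then show ?thesis by (simp add: abs_square_le_1)
  qed
  have "(\<integral>\<^sup>+t. ennreal (sqrt (s\<^sup>2 - t\<^sup>2) / (A - B * t)) * indicator {- s<..<s} t \<partial>lborel) = ennreal (F s - F (- s))"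
  proof (rule nn_integral_FTC_Ioo)
    have "continuous_on {- s..s} q"
      unfolding q_def using s pos by (intro continuous_intros) (auto simp: less_imp_neq[symmetric])
    then have c3: "continuous_on {- s..s} (\<lambda>t. arcsin (q t))"
      using q1 by (intro continuous_on_arcsin) (auto simp: abs_le_iff)
    have c2: "continuous_on {- s..s} (\<lambda>t. arcsin (t / s))"
      using s by (intro continuous_on_arcsin continuous_intros) (auto simp: field_simps)
    show "continuous_on {- s..s} F"
      unfolding F_def using B by (intro continuous_intros c2 c3) auto
    fix t assume t: "- s < t" "t < s"
    define w where "w = sqrt (s\<^sup>2 - t\<^sup>2)"
    have ts: "t\<^sup>2 < s\<^sup>2" using abs_le_square_iff[of s t] t s by (auto simp: not_le[symmetric])
    then have w: "0 < w" "w\<^sup>2 = s\<^sup>2 - t\<^sup>2" by (simp_all add: w_def)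
    have p: "0 < A - B * t" using pos t by simp
    show "0 \<le> sqrt (s\<^sup>2 - t\<^sup>2) / (A - B * t)" using ts p by simp
    have d1: "((\<lambda>t. - sqrt (s\<^sup>2 - t\<^sup>2) / B) has_real_derivative t / (B * w)) (at t)"
      unfolding w_def using ts B by (auto intro!: derivative_eq_intros simp: field_simps)
    have d2: "((\<lambda>t. arcsin (t / s)) has_real_derivative (1 / s) / (w / s)) (at t)"
      by (rule DERIV_arcsin_comp) (use s w in \<open>auto intro!: derivative_eq_intros simp: power_divide field_simps\<close>)
    have "(q has_real_derivative (A * (s * (A - B * t)) - (A * t - B * s\<^sup>2) * (s * (- B))) / ((s * (A - B * t)) * (s * (A - B * t)))) (at t)"
      unfolding q_def using p s by (auto intro!: derivative_eq_intros)
    also have "(A * (s * (A - B * t)) - (A * t - B * s\<^sup>2) * (s * (- B))) / ((s * (A - B * t)) * (s * (A - B * t)))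
        = D\<^sup>2 / (s * (A - B * t)\<^sup>2)"
    proof -
      have num: "A * (s * (A - B * t)) - (A * t - B * s\<^sup>2) * (s * (- B)) = s * D\<^sup>2"
        unfolding D2 by (simp add: power2_eq_square algebra_simps)
      show ?thesis unfolding num using s p by (simp add: power2_eq_square)
    qed
    finally have "((\<lambda>t. arcsin (q t)) has_real_derivative D\<^sup>2 / (s * (A - B * t)\<^sup>2) / (D * w / (s * (A - B * t)))) (at t)"
      by (rule DERIV_arcsin_comp) (use D w s p qid[of t] t in \<open>auto simp: power_divide power_mult_distrib\<close>)
    also have "D\<^sup>2 / (s * (A - B * t)\<^sup>2) / (D * w / (s * (A - B * t))) = D / (w * (A - B * t))"
    proof -
      have "D\<^sup>2 / (s * m\<^sup>2) / (D * w / (s * m)) = D / (w * m)" if "0 < m" for m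
        using s w D that by (simp add: power2_eq_square)
      from this[OF p] show ?thesis .
    qed
    finally have d3: "((\<lambda>t. arcsin (q t)) has_real_derivative D / (w * (A - B * t))) (at t)" .
    have "(F has_real_derivative t / (B * w) + A / B\<^sup>2 * ((1 / s) / (w / s)) - D / B\<^sup>2 * (D / (w * (A - B * t)))) (at t)"
      unfolding F_def by (intro DERIV_add DERIV_diff DERIV_cmult d1 d2 d3)
    also have "t / (B * w) + A / B\<^sup>2 * ((1 / s) / (w / s)) - D / B\<^sup>2 * (D / (w * (A - B * t))) = w / (A - B * t)"
    proof -
      have ne: "B \<noteq> 0" "w \<noteq> 0" "A - B * t \<noteq> 0" "s \<noteq> 0" using B w p s by auto
      have num: "(t * B + A) * (A - B * t) - D\<^sup>2 = B\<^sup>2 * w\<^sup>2"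
        unfolding D2 w by (simp add: power2_eq_square algebra_simps)
      have "t / (B * w) + A / B\<^sup>2 * ((1 / s) / (w / s)) - D / B\<^sup>2 * (D / (w * (A - B * t)))
        = ((t * B + A) * (A - B * t) - D\<^sup>2) / (B\<^sup>2 * w * (A - B * t))"
      proof -
        have "t / (B * w) + A / B\<^sup>2 * ((1 / s) / (w / s)) - D / B\<^sup>2 * (D / (w * m))
          = ((t * B + A) * m - D\<^sup>2) / (B\<^sup>2 * w * m)" if "m \<noteq> 0" for m
          using ne(1,2,4) that by (simp add: field_simps power2_eq_square)
        from this[OF ne(3)] show ?thesis .
      qed
      also have "\<dots> = w / (A - B * t)"
        unfolding num using ne by (simp add: power2_eq_square)
      finally show ?thesis .
    qed
    finally show "(F has_real_derivative sqrt (s\<^sup>2 - t\<^sup>2) / (A - B * t)) (at t)" by (simp add: w_def)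
  qed (use s in auto)
  also have "F s - F (- s) = pi * (A - D) / B\<^sup>2"
  proof -
    have "A - B * s \<noteq> 0" "A + B * s \<noteq> 0" using pos[of s] pos[of "- s"] s by auto
    have "A * s - B * s\<^sup>2 = s * (A - B * s)" "A * (- s) - B * s\<^sup>2 = - (s * (A - B * (- s)))"
      by (simp_all add: power2_eq_square algebra_simps)
    then have "q s = 1" "q (- s) = - 1"
      unfolding q_def using s \<open>A - B * s \<noteq> 0\<close> \<open>A + B * s \<noteq> 0\<close> by simp_all
    then show ?thesis using s by (simp add: F_def diff_divide_distrib right_diff_distrib mult_ac)
  qed
  \<comment> \<open>\<open>A - D\<close> is twice the smaller of \<open>r\<^sup>2\<close> and
    \<open>s\<^sup>2\<close>, and this produces the maximum in the denominator.\<close>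
  also have "\<dots> = pi / 2 * s\<^sup>2 / max (r\<^sup>2) (s\<^sup>2)"
  proof (cases "r < s")
    case True
    then have "r\<^sup>2 < s\<^sup>2" using r by (intro power_strict_mono) auto
    then show ?thesis using r s by (simp add: A_def D_def B_def power2_eq_square)
  next
    case False
    then have "s\<^sup>2 < r\<^sup>2" using rs s by (intro power_strict_mono) auto
    then show ?thesis using r s by (simp add: A_def D_def B_def power2_eq_square)
  qed
  finally show ?thesis by (simp add: A_def B_def)
qed

lemma nn_integral_log_kernel:
  fixes r s T :: real
  assumes r: "0 < r" and s: "0 < s" and T: "0 < T"
  shows "(\<integral>\<^sup>+t. ennreal (1 / (T + r\<^sup>2 + s\<^sup>2 - 2 * r * t)) * indicator {- s<..<s} t \<partial>lborel) =
    ennreal (1 / (2 * r) * ln ((T + (r + s)\<^sup>2) / (T + (r - s)\<^sup>2)))"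
proof -
  define F where "F t = - ln (T + r\<^sup>2 + s\<^sup>2 - 2 * r * t) / (2 * r)" for t
  have pos: "0 < T + r\<^sup>2 + s\<^sup>2 - 2 * r * t" if "t \<le> s" for t
  proof -
    have "0 \<le> (r - s)\<^sup>2" by simp
    then have "2 * r * s \<le> r\<^sup>2 + s\<^sup>2" by (simp add: power2_eq_square algebra_simps)
    moreover have "2 * r * t \<le> 2 * r * s" using r that by simp
    ultimately show ?thesis using T by simp
  qed
  have "(\<integral>\<^sup>+t. ennreal (1 / (T + r\<^sup>2 + s\<^sup>2 - 2 * r * t)) * indicator {- s<..<s} t \<partial>lborel) = ennreal (F s - F (- s))"
  proof (rule nn_integral_FTC_Ioo)
    show "continuous_on {- s..s} F"
      unfolding F_def using pos r by (intro continuous_intros) (auto simp: less_imp_neq[symmetric])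
    show "(F has_real_derivative 1 / (T + r\<^sup>2 + s\<^sup>2 - 2 * r * t)) (at t)" if "- s < t" "t < s" for t
    proof -
      have "((\<lambda>t. ln (T + r\<^sup>2 + s\<^sup>2 - 2 * r * t)) has_real_derivative (- (2 * r)) / (T + r\<^sup>2 + s\<^sup>2 - 2 * r * t)) (at t)"
        using pos[of t] that by (auto intro!: derivative_eq_intros)
      from DERIV_cdivide[OF DERIV_minus[OF this], of "2 * r"] show ?thesis
        unfolding F_def using r by simp
    qed
    show "0 \<le> 1 / (T + r\<^sup>2 + s\<^sup>2 - 2 * r * t)" if "- s < t" "t < s" for t
      using pos[of t] that by simp
  qed (use s in auto)
  also have "F s - F (- s) = 1 / (2 * r) * ln ((T + (r + s)\<^sup>2) / (T + (r - s)\<^sup>2))"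
  proof -
    have e: "T + (r + s)\<^sup>2 = T + r\<^sup>2 + s\<^sup>2 - 2 * r * (- s)" "T + (r - s)\<^sup>2 = T + r\<^sup>2 + s\<^sup>2 - 2 * r * s"
      by (simp_all add: power2_eq_square algebra_simps)
    show ?thesis
      unfolding e F_def using pos[of s] pos[of "- s"] s r
      by (subst ln_div) (auto simp: field_simps)
  qed
  finally show ?thesis .
qed

section \<open>The Coulomb kernel in dimension four and axisymmetric lifts\<close>

type_synonym r4 = "real \<times> (real \<times> (real \<times> real))"

text \<open>Up to a constant the fundamental solution of the Laplacian in dimension four, as a
  function of the squared distance; in \<open>ennreal\<close> its value at zero is infinite.\<close>

definition coulomb :: "real \<Rightarrow> ennreal" where
  "coulomb s = inverse (ennreal s)"

lemma coulomb_measurable [measurable]: "coulomb \<in> borel_measurable borel"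
  unfolding coulomb_def[abs_def] by measurable

lemma coulomb_pos: "0 < s \<Longrightarrow> coulomb s = ennreal (1 / s)"
  by (simp add: coulomb_def inverse_ennreal divide_inverse)

lemma dist_axis:
  fixes y :: "real \<times> 'a::euclidean_space"
  shows "(dist (r, 0) y)\<^sup>2 = r\<^sup>2 + (norm y)\<^sup>2 - 2 * r * fst y"
proof (cases y)
  case (Pair a b)
  have "(dist (r, 0) y)\<^sup>2 = (r - a)\<^sup>2 + (norm b)\<^sup>2" "(norm y)\<^sup>2 = a\<^sup>2 + (norm b)\<^sup>2"
    by (simp_all add: Pair dist_Pair_Pair norm_Pair dist_real_def)
  then show ?thesis by (simp add: Pair power2_diff)
qed

lemma radial_density_3: "radial_density 3 v = (if 0 < v then 2 * pi * sqrt v else 0)"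
  by (simp add: radial_density_def unit_ball_vol_3 powr_half_sqrt)

lemma radial_density_2: "radial_density 2 v = (if 0 < v then pi else 0)"
  by (simp add: radial_density_def unit_ball_vol_2)

lemma radial_density_4: "radial_density 4 v = (if 0 < v then pi\<^sup>2 * v else 0)"
  by (simp add: radial_density_def unit_ball_vol_4)

lemma DIM_2: "DIM(real \<times> real) = 2" and DIM_3: "DIM(real \<times> (real \<times> real)) = 3"
  and DIM_4: "DIM(r4) = 4"
  by simp_all

lemma axis_denominator_pos:
  fixes r s t T :: real
  assumes "0 < r" "t < s" "0 \<le> T" "T > 0 \<or> r \<noteq> s"
  shows "0 < T + r\<^sup>2 + s\<^sup>2 - 2 * r * t"
proof -
  have "2 * r * t < 2 * r * s" using assms by simp
  moreover have "0 \<le> (r - s)\<^sup>2" by simp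
  ultimately show ?thesis using assms(3) by (simp add: power2_eq_square algebra_simps)
qed

lemma interval_square: "0 < (u::real) \<Longrightarrow> t\<^sup>2 < u \<longleftrightarrow> - sqrt u < t \<and> t < sqrt u"
  using real_sqrt_less_iff[of "t\<^sup>2" u] by (auto simp: abs_less_iff)

text \<open>Newton's theorem: averaged over the sphere of squared radius \<open>u\<close>, the
  kernel becomes the reciprocal of the larger of the two squared radii. The remaining factor is
  \<open>radial_density 4\<close>.\<close>

lemma newton_kernel:
  fixes x :: "r4"
  assumes x: "x \<noteq> 0" and [measurable]: "h \<in> borel_measurable borel"
  shows "(\<integral>\<^sup>+y. h ((norm y)\<^sup>2) * coulomb ((dist x y)\<^sup>2) \<partial>lborel) =
    (\<integral>\<^sup>+u. ennreal (pi\<^sup>2 * u / max ((norm x)\<^sup>2) u) * h u * indicator {0<..} u \<partial>lborel)"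
proof -
  define r where "r = norm x"
  have r: "0 < r" using x by (simp add: r_def)
  have "(\<integral>\<^sup>+y. h ((norm y)\<^sup>2) * coulomb ((dist x y)\<^sup>2) \<partial>lborel)
    = (\<integral>\<^sup>+y. h ((norm y)\<^sup>2) * coulomb ((dist (r, 0 :: real \<times> real \<times> real) y)\<^sup>2) \<partial>lborel)"
    using nn_integral_norm_square_dist[of "\<lambda>a b. h a * coulomb b" x "(r, 0)"] r by (simp add: r_def norm_Pair)
  also have "\<dots> = (\<integral>\<^sup>+y. h ((norm y)\<^sup>2) * coulomb (r\<^sup>2 + (norm (y :: r4))\<^sup>2 - 2 * r * fst y) \<partial>lborel)"
    unfolding dist_axis ..
  also have "\<dots> = (\<integral>\<^sup>+u. \<integral>\<^sup>+t. ennreal (radial_density DIM(real \<times> (real \<times> real)) (u - t\<^sup>2)) *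
      (h u * coulomb (r\<^sup>2 + u - 2 * r * t)) \<partial>lborel \<partial>lborel)"
    by (rule nn_integral_cylindrical) measurable
  also have "\<dots> = (\<integral>\<^sup>+u. ennreal (pi\<^sup>2 * u / max ((norm x)\<^sup>2) u) * h u * indicator {0<..} u \<partial>lborel)"
  proof (rule nn_integral_cong_AE)
    \<comment> \<open>The sphere through the base point is a single value of \<open>u\<close>; off
      it the denominators stay positive.\<close>
    have "AE u in lborel. u \<noteq> r\<^sup>2" by (rule AE_lborel_singleton)
    then show "AE u in lborel. (\<integral>\<^sup>+t. ennreal (radial_density DIM(real \<times> (real \<times> real)) (u - t\<^sup>2)) *
      (h u * coulomb (r\<^sup>2 + u - 2 * r * t)) \<partial>lborel)
      = ennreal (pi\<^sup>2 * u / max ((norm x)\<^sup>2) u) * h u * indicator {0<..} u"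
    proof eventually_elim
      case (elim u)
      show ?case
      proof (cases "0 < u")
        case False
        then have "radial_density 3 (u - t\<^sup>2) = 0" for t
          by (auto simp: radial_density_3 dest: le_less_trans[OF zero_le_power2])
        then show ?thesis unfolding DIM_3 using False by simp
      next
        case True
        define s where "s = sqrt u"
        have s: "0 < s" "s\<^sup>2 = u" using True by (simp_all add: s_def)
        have rs: "r \<noteq> s" using elim s by auto
        have "(\<integral>\<^sup>+t. ennreal (radial_density 3 (u - t\<^sup>2)) * (h u * coulomb (r\<^sup>2 + u - 2 * r * t)) \<partial>lborel)
          = (\<integral>\<^sup>+t. (h u * ennreal (2 * pi)) * (ennreal (sqrt (s\<^sup>2 - t\<^sup>2) / (r\<^sup>2 + s\<^sup>2 - 2 * r * t)) * indicator {- s<..<s} t) \<partial>lborel)"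
        proof (rule nn_integral_cong)
          fix t
          show "ennreal (radial_density 3 (u - t\<^sup>2)) * (h u * coulomb (r\<^sup>2 + u - 2 * r * t))
            = (h u * ennreal (2 * pi)) * (ennreal (sqrt (s\<^sup>2 - t\<^sup>2) / (r\<^sup>2 + s\<^sup>2 - 2 * r * t)) * indicator {- s<..<s} t)"
          proof (cases "t\<^sup>2 < u")
            case t: True
            then have ts: "- s < t" "t < s" using interval_square[OF True] by (auto simp: s_def)
            have p: "0 < r\<^sup>2 + s\<^sup>2 - 2 * r * t" using axis_denominator_pos[OF r ts(2), of 0] rs by simp
            have "ennreal (radial_density 3 (u - t\<^sup>2)) * coulomb (r\<^sup>2 + u - 2 * r * t)
              = ennreal (2 * pi) * ennreal (sqrt (s\<^sup>2 - t\<^sup>2) / (r\<^sup>2 + s\<^sup>2 - 2 * r * t))"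
              using t p unfolding s(2)[symmetric]
              by (simp add: radial_density_3 coulomb_pos ennreal_mult[symmetric])
            then show ?thesis using ts by (simp add: mult_ac)
          next
            case False
            then show ?thesis using interval_square[OF True, of t] by (auto simp: radial_density_3 s_def indicator_def)
          qed
        qed
        also have "\<dots> = (h u * ennreal (2 * pi)) * ennreal (pi / 2 * s\<^sup>2 / max (r\<^sup>2) (s\<^sup>2))"
          by (subst nn_integral_cmult) (auto simp: nn_integral_semicircle_kernel[OF r s(1) rs])
        also have "\<dots> = h u * ennreal (pi\<^sup>2 * u / max ((norm x)\<^sup>2) u)"
          using True unfolding s(2) r_def[symmetric]
          by (simp add: mult.assoc ennreal_mult[symmetric] power2_eq_square)
        finally show ?thesis unfolding DIM_3 using True by (simp add: mult.commute)
      qed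
    qed
  qed
  finally show ?thesis .
qed

text \<open>The average runs over spheres of the three-dimensional space orthogonal to the axis.
  Their slices have constant density, as Archimedes found, so the kernel is integrated without
  weight and yields a logarithm. This is the origin of the logarithm in \<open>G\<close>, with
  \<open>T\<close> the squared difference of the axial coordinates.\<close>

lemma log_kernel:
  fixes x :: "real \<times> (real \<times> real)"
  assumes x: "x \<noteq> 0" and T: "0 < T" and [measurable]: "h \<in> borel_measurable borel"
  shows "(\<integral>\<^sup>+y. h ((norm y)\<^sup>2) * coulomb (T + (dist x y)\<^sup>2) \<partial>lborel) =
    (\<integral>\<^sup>+u. ennreal (pi / (2 * norm x) * ln ((T + (norm x + sqrt u)\<^sup>2) / (T + (norm x - sqrt u)\<^sup>2)))
       * h u * indicator {0<..} u \<partial>lborel)"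
proof -
  define r where "r = norm x"
  have r: "0 < r" using x by (simp add: r_def)
  have "(\<integral>\<^sup>+y. h ((norm y)\<^sup>2) * coulomb (T + (dist x y)\<^sup>2) \<partial>lborel)
    = (\<integral>\<^sup>+y. h ((norm y)\<^sup>2) * coulomb (T + (dist (r, 0 :: real \<times> real) y)\<^sup>2) \<partial>lborel)"
    using nn_integral_norm_square_dist[of "\<lambda>a b. h a * coulomb (T + b)" x "(r, 0)"] r by (simp add: r_def norm_Pair)
  also have "\<dots> = (\<integral>\<^sup>+y. h ((norm y)\<^sup>2) * coulomb (T + (r\<^sup>2 + (norm (y :: real \<times> real \<times> real))\<^sup>2 - 2 * r * fst y)) \<partial>lborel)"
    unfolding dist_axis ..
  also have "\<dots> = (\<integral>\<^sup>+u. \<integral>\<^sup>+t. ennreal (radial_density DIM(real \<times> real) (u - t\<^sup>2)) *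
      (h u * coulomb (T + (r\<^sup>2 + u - 2 * r * t))) \<partial>lborel \<partial>lborel)"
    by (rule nn_integral_cylindrical) measurable
  also have "\<dots> = (\<integral>\<^sup>+u. ennreal (pi / (2 * r) * ln ((T + (r + sqrt u)\<^sup>2) / (T + (r - sqrt u)\<^sup>2)))
       * h u * indicator {0<..} u \<partial>lborel)"
  proof (rule nn_integral_cong)
    fix u :: real
    show "(\<integral>\<^sup>+t. ennreal (radial_density DIM(real \<times> real) (u - t\<^sup>2)) *
      (h u * coulomb (T + (r\<^sup>2 + u - 2 * r * t))) \<partial>lborel)
      = ennreal (pi / (2 * r) * ln ((T + (r + sqrt u)\<^sup>2) / (T + (r - sqrt u)\<^sup>2))) * h u * indicator {0<..} u"
    proof (cases "0 < u")
      case False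
      then have "radial_density 2 (u - t\<^sup>2) = 0" for t
          by (auto simp: radial_density_2 dest: le_less_trans[OF zero_le_power2])
      then show ?thesis unfolding DIM_2 using False by simp
    next
      case True
      define s where "s = sqrt u"
      have s: "0 < s" "s\<^sup>2 = u" using True by (simp_all add: s_def)
      have "(\<integral>\<^sup>+t. ennreal (radial_density 2 (u - t\<^sup>2)) * (h u * coulomb (T + (r\<^sup>2 + u - 2 * r * t))) \<partial>lborel)
        = (\<integral>\<^sup>+t. (h u * ennreal pi) * (ennreal (1 / (T + r\<^sup>2 + s\<^sup>2 - 2 * r * t)) * indicator {- s<..<s} t) \<partial>lborel)"
      proof (rule nn_integral_cong)
        fix t
        show "ennreal (radial_density 2 (u - t\<^sup>2)) * (h u * coulomb (T + (r\<^sup>2 + u - 2 * r * t)))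
          = (h u * ennreal pi) * (ennreal (1 / (T + r\<^sup>2 + s\<^sup>2 - 2 * r * t)) * indicator {- s<..<s} t)"
        proof (cases "t\<^sup>2 < u")
          case t: True
          then have ts: "- s < t" "t < s" using interval_square[OF True] by (auto simp: s_def)
          have p: "0 < T + r\<^sup>2 + s\<^sup>2 - 2 * r * t" using axis_denominator_pos[OF r ts(2), of T] T by simp
          have e: "T + (r\<^sup>2 + u - 2 * r * t) = T + r\<^sup>2 + s\<^sup>2 - 2 * r * t" using s by simp
          show ?thesis
            unfolding e coulomb_pos[OF p] using t ts by (simp add: radial_density_2 mult_ac)
        next
          case False
          then show ?thesis using interval_square[OF True, of t] by (auto simp: radial_density_2 s_def indicator_def)
        qed
      qed
      also have "\<dots> = (h u * ennreal pi) * ennreal (1 / (2 * r) * ln ((T + (r + s)\<^sup>2) / (T + (r - s)\<^sup>2)))"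
        by (subst nn_integral_cmult) (auto simp: nn_integral_log_kernel[OF r s(1) T])
      also have "\<dots> = h u * ennreal (pi / (2 * r) * ln ((T + (r + s)\<^sup>2) / (T + (r - s)\<^sup>2)))"
        by (simp add: mult.assoc ennreal_mult'[symmetric])
      finally show ?thesis unfolding DIM_2 using True by (simp add: mult.commute s_def)
    qed
  qed
  finally show ?thesis by (simp add: r_def)
qed

text \<open>The function \<open>\<zeta>\<close> of the overview. On the axis, a null set, division
  by zero gives it the value zero.\<close>

definition lift :: "(real \<times> real \<Rightarrow> real) \<Rightarrow> r4 \<Rightarrow> real" where
  "lift \<omega> z = \<omega> (fst z, norm (snd z)) / norm (snd z)"

lemma fst_borel [measurable]: "(fst :: 'a::euclidean_space \<times> 'b::euclidean_space \<Rightarrow> 'a) \<in> borel_measurable borel"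
  and snd_borel [measurable]: "(snd :: 'a::euclidean_space \<times> 'b::euclidean_space \<Rightarrow> 'b) \<in> borel_measurable borel"
  by (intro borel_measurable_continuous_onI continuous_intros)+

lemma Pair_borel [measurable (raw)]:
  assumes "f \<in> borel_measurable M" "g \<in> borel_measurable M"
  shows "(\<lambda>x. (f x, g x) :: 'a::euclidean_space \<times> 'b::euclidean_space) \<in> borel_measurable M"
  using measurable_Pair[OF assms] by (simp add: borel_prod)

lemma half_plane_borel [measurable]: "half_plane \<in> sets borel"
  unfolding half_plane_def by measurable

lemma lift_measurable [measurable]:
  assumes [measurable]: "\<omega> \<in> borel_measurable borel"
  shows "lift \<omega> \<in> borel_measurable borel"
  unfolding lift_def[abs_def] by measurable

text \<open>The weight is the area of the sphere of radius \<open>snd x\<close> in three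
  dimensions.\<close>

lemma nn_integral_axisymmetric:
  fixes H :: "real \<times> real \<Rightarrow> ennreal"
  assumes [measurable]: "H \<in> borel_measurable borel"
  shows "(\<integral>\<^sup>+z. H (fst z, norm (snd (z :: r4))) \<partial>lborel) =
    (\<integral>\<^sup>+x. ennreal (4 * pi * (snd x)\<^sup>2) * H x * indicator half_plane x \<partial>lborel)"
proof -
  have "(\<integral>\<^sup>+z. H (fst z, norm (snd (z :: r4))) \<partial>lborel)
    = (\<integral>\<^sup>+t. \<integral>\<^sup>+z. H (t, norm (z :: real \<times> (real \<times> real))) \<partial>lborel \<partial>lborel)"
    by (subst nn_integral_lborel_prod) auto
  also have "\<dots> = (\<integral>\<^sup>+t. \<integral>\<^sup>+q. ennreal (4 * pi * q\<^sup>2) * H (t, q) * indicator half_plane (t, q) \<partial>lborel \<partial>lborel)"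
  proof (rule nn_integral_cong)
    fix t :: real
    have "(\<integral>\<^sup>+z. H (t, norm (z :: real \<times> (real \<times> real))) \<partial>lborel)
      = (\<integral>\<^sup>+z. H (t, sqrt ((norm (z :: real \<times> (real \<times> real)))\<^sup>2)) \<partial>lborel)" by simp
    also have "\<dots> = (\<integral>\<^sup>+v. ennreal (radial_density 3 v) * H (t, sqrt v) \<partial>lborel)"
      unfolding DIM_3[symmetric] by (rule nn_integral_norm_square) measurable
    also have "\<dots> = (\<integral>\<^sup>+v. (ennreal (2 * pi * sqrt v) * H (t, sqrt v)) * indicator {0<..} v \<partial>lborel)"
      by (intro nn_integral_cong) (auto simp: radial_density_3 indicator_def)
    also have "\<dots> = (\<integral>\<^sup>+q. ennreal (2 * q) * (ennreal (2 * pi * sqrt (q\<^sup>2)) * H (t, sqrt (q\<^sup>2))) * indicator {0<..} q \<partial>lborel)"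
      by (rule nn_integral_square_substitution) measurable
    also have "\<dots> = (\<integral>\<^sup>+q. ennreal (4 * pi * q\<^sup>2) * H (t, q) * indicator half_plane (t, q) \<partial>lborel)"
    proof (rule nn_integral_cong)
      fix q :: real
      have "ennreal (2 * q) * ennreal (2 * pi * q) = ennreal (4 * pi * q\<^sup>2)" if "0 < q"
        using that by (simp add: ennreal_mult[symmetric] power2_eq_square mult_ac)
      then show "ennreal (2 * q) * (ennreal (2 * pi * sqrt (q\<^sup>2)) * H (t, sqrt (q\<^sup>2))) * indicator {0<..} q
        = ennreal (4 * pi * q\<^sup>2) * H (t, q) * indicator half_plane (t, q)"
        by (cases "0 < q") (auto simp: half_plane_def mult.assoc[symmetric])
    qed
    finally show "(\<integral>\<^sup>+z. H (t, norm (z :: real \<times> (real \<times> real))) \<partial>lborel)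
      = (\<integral>\<^sup>+q. ennreal (4 * pi * q\<^sup>2) * H (t, q) * indicator half_plane (t, q) \<partial>lborel)" .
  qed
  also have "\<dots> = (\<integral>\<^sup>+x. ennreal (4 * pi * (snd x)\<^sup>2) * H x * indicator half_plane x \<partial>lborel)"
    by (subst nn_integral_lborel_prod) auto
  finally show ?thesis .
qed

lemma G_eq_ln:
  assumes "t \<noteq> s" "0 < r" "0 < q"
  shows "G (t, r) (s, q) = 1 / (4 * pi) * ln (((t - s)\<^sup>2 + (r + q)\<^sup>2) / ((t - s)\<^sup>2 + (r - q)\<^sup>2))"
proof -
  define b where "b = (t - s)\<^sup>2 + (r - q)\<^sup>2"
  have n: "(norm ((t, r) - (s, q)))\<^sup>2 = b" by (simp add: norm_Pair b_def)
  have "0 < (t - s)\<^sup>2" using assms by simp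
  then have b: "0 < b" unfolding b_def by (intro add_pos_nonneg) auto
  have c: "(t - s)\<^sup>2 + (r + q)\<^sup>2 = b + 4 * r * q"
    by (simp add: b_def power2_eq_square algebra_simps)
  have "1 + 4 * r * q / b = (b + 4 * r * q) / b" using b by (simp add: add_divide_distrib)
  then show ?thesis unfolding G_def n c b_def[symmetric] by simp
qed

lemma G_nonneg: "x \<in> half_plane \<Longrightarrow> y \<in> half_plane \<Longrightarrow> 0 \<le> G x y"
  by (simp add: G_def half_plane_def ln_ge_zero)

lemma G_measurable [measurable]: "case_prod G \<in> borel_measurable (borel \<Otimes>\<^sub>M borel)"
  unfolding G_def by measurable

text \<open>The Coulomb potential of the lift is, up to the factor \<open>4 * pi\<^sup>2\<close>,
  the stream function of \<open>\<omega>\<close> divided by the distance to the axis. The slice at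
  the axial coordinate of the base point, where \<open>T\<close> would be zero, is a null
  set.\<close>

lemma nn_integral_coulomb_lift:
  fixes \<omega> :: "real \<times> real \<Rightarrow> real"
  assumes [measurable]: "\<omega> \<in> borel_measurable borel" and nonneg: "\<And>x. 0 \<le> \<omega> x" and y': "y' \<noteq> 0"
  shows "(\<integral>\<^sup>+z. coulomb ((dist (t, y') z)\<^sup>2) * ennreal (lift \<omega> z) \<partial>lborel) =
    ennreal (4 * pi\<^sup>2 / norm y') * (\<integral>\<^sup>+x. ennreal (G (t, norm y') x * \<omega> x) * indicator half_plane x \<partial>lborel)"
proof -
  define r where "r = norm y'"
  have r: "0 < r" using y' by (simp add: r_def)
  have "(\<integral>\<^sup>+z. coulomb ((dist (t, y') z)\<^sup>2) * ennreal (lift \<omega> z) \<partial>lborel)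
    = (\<integral>\<^sup>+s. \<integral>\<^sup>+z. coulomb ((dist (t, y') (s, z))\<^sup>2) * ennreal (lift \<omega> (s, z)) \<partial>lborel \<partial>lborel)"
    by (rule nn_integral_lborel_prod) measurable
  also have "\<dots> = (\<integral>\<^sup>+s. \<integral>\<^sup>+q. ennreal (4 * pi\<^sup>2 / r) * (ennreal (G (t, r) (s, q) * \<omega> (s, q)) * indicator half_plane (s, q)) \<partial>lborel \<partial>lborel)"
  proof (rule nn_integral_cong_AE)
    have "AE s in lborel. s \<noteq> t" by (rule AE_lborel_singleton)
    then show "AE s in lborel. (\<integral>\<^sup>+z. coulomb ((dist (t, y') (s, z))\<^sup>2) * ennreal (lift \<omega> (s, z)) \<partial>lborel)
      = (\<integral>\<^sup>+q. ennreal (4 * pi\<^sup>2 / r) * (ennreal (G (t, r) (s, q) * \<omega> (s, q)) * indicator half_plane (s, q)) \<partial>lborel)"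
    proof eventually_elim
      case (elim s)
      define T where "T = (t - s)\<^sup>2"
      have T: "0 < T" using elim by (simp add: T_def)
      define h where "h v = ennreal (\<omega> (s, sqrt v) / sqrt v)" for v
      have [measurable]: "h \<in> borel_measurable borel" unfolding h_def[abs_def] by measurable
      have "(\<integral>\<^sup>+z. coulomb ((dist (t, y') (s, z))\<^sup>2) * ennreal (lift \<omega> (s, z)) \<partial>lborel)
        = (\<integral>\<^sup>+z. h ((norm z)\<^sup>2) * coulomb (T + (dist y' z)\<^sup>2) \<partial>lborel)"
        by (intro nn_integral_cong)
          (simp add: h_def lift_def T_def dist_Pair_Pair dist_real_def mult.commute)
      also have "\<dots> = (\<integral>\<^sup>+u. ennreal (pi / (2 * r) * ln ((T + (r + sqrt u)\<^sup>2) / (T + (r - sqrt u)\<^sup>2)))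
          * h u * indicator {0<..} u \<partial>lborel)"
        unfolding r_def by (rule log_kernel[OF y' T]) measurable
      also have "\<dots> = (\<integral>\<^sup>+q. ennreal (2 * q) * (ennreal (pi / (2 * r) * ln ((T + (r + sqrt (q\<^sup>2))\<^sup>2) / (T + (r - sqrt (q\<^sup>2))\<^sup>2)))
          * h (q\<^sup>2)) * indicator {0<..} q \<partial>lborel)"
        by (rule nn_integral_square_substitution) measurable
      also have "\<dots> = (\<integral>\<^sup>+q. ennreal (4 * pi\<^sup>2 / r) * (ennreal (G (t, r) (s, q) * \<omega> (s, q)) * indicator half_plane (s, q)) \<partial>lborel)"
      proof (rule nn_integral_cong)
        fix q :: real
        show "ennreal (2 * q) * (ennreal (pi / (2 * r) * ln ((T + (r + sqrt (q\<^sup>2))\<^sup>2) / (T + (r - sqrt (q\<^sup>2))\<^sup>2)))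
          * h (q\<^sup>2)) * indicator {0<..} q
          = ennreal (4 * pi\<^sup>2 / r) * (ennreal (G (t, r) (s, q) * \<omega> (s, q)) * indicator half_plane (s, q))"
        proof (cases "0 < q")
          case False
          then show ?thesis by (simp add: half_plane_def)
        next
          case True
          define l where "l = ln ((T + (r + q)\<^sup>2) / (T + (r - q)\<^sup>2))"
          have Gl: "G (t, r) (s, q) = l / (4 * pi)"
            using G_eq_ln[of t s r q] elim r True by (simp add: l_def T_def)
          have "0 \<le> G (t, r) (s, q)" using r True by (intro G_nonneg) (auto simp: half_plane_def)
          then have l0: "0 \<le> l" unfolding Gl using pi_gt_zero by (auto simp: zero_le_divide_iff)
          have "(2 * q) * (pi / (2 * r) * l * (\<omega> (s, q) / q)) = 4 * pi\<^sup>2 / r * (l / (4 * pi) * \<omega> (s, q))"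
            using True r by (simp add: field_simps power2_eq_square)
          then have "ennreal (2 * q) * (ennreal (pi / (2 * r) * l) * ennreal (\<omega> (s, q) / q))
            = ennreal (4 * pi\<^sup>2 / r) * ennreal (l / (4 * pi) * \<omega> (s, q))"
            using True r l0 nonneg by (simp add: ennreal_mult[symmetric])
          then show ?thesis using True unfolding Gl l_def[symmetric]
            by (simp add: h_def half_plane_def l_def[symmetric] mult_ac)
        qed
      qed
      finally show ?case .
    qed
  qed
  also have "\<dots> = (\<integral>\<^sup>+x. ennreal (4 * pi\<^sup>2 / r) * (ennreal (G (t, r) x * \<omega> x) * indicator half_plane x) \<partial>lborel)"
    by (subst nn_integral_lborel_prod) measurable
  also have "\<dots> = ennreal (4 * pi\<^sup>2 / r) * (\<integral>\<^sup>+x. ennreal (G (t, r) x * \<omega> x) * indicator half_plane x \<partial>lborel)"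
    by (rule nn_integral_cmult) measurable
  finally show ?thesis by (simp add: r_def)
qed

lemma AE_snd_nonzero: "AE z in lborel. snd (z :: r4) \<noteq> 0"
proof -
  have "(\<integral>\<^sup>+z. indicator {z. snd (z :: r4) = 0} z \<partial>lborel)
     = (\<integral>\<^sup>+t. \<integral>\<^sup>+y. indicator {0 :: real \<times> (real \<times> real)} y \<partial>lborel \<partial>(lborel :: real measure))"
  proof (subst nn_integral_lborel_prod)
    have "indicator {z. snd z = 0} (t, y) = (indicator {0} y :: ennreal)" for t :: real and y :: "real \<times> (real \<times> real)"
      by (simp add: indicator_def)
    then show "(\<integral>\<^sup>+t. \<integral>\<^sup>+y. indicator {z. snd (z :: r4) = 0} (t, y) \<partial>lborel \<partial>lborel)
      = (\<integral>\<^sup>+t. \<integral>\<^sup>+y. indicator {0 :: real \<times> (real \<times> real)} y \<partial>lborel \<partial>(lborel :: real measure))"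
      by (simp only:)
  qed measurable
  also have "(\<integral>\<^sup>+y. indicator {0 :: real \<times> (real \<times> real)} y \<partial>lborel) = 0"
    by (subst nn_integral_indicator) auto
  finally have "(\<integral>\<^sup>+z. indicator {z. snd (z :: r4) = 0} z \<partial>lborel) = 0" by simp
  then have "AE z in lborel. indicator {z. snd (z :: r4) = 0} z = (0::ennreal)"
    by (subst (asm) nn_integral_0_iff_AE) auto
  then show ?thesis by eventually_elim (auto simp: indicator_def)
qed

text \<open>The constant is the factor \<open>4 * pi\<close> of the sphere area times the factor
  \<open>4 * pi\<^sup>2\<close> of the potential; the powers of the distance to the axis
  cancel.\<close>

lemma riesz_lift:
  fixes \<omega> :: "real \<times> real \<Rightarrow> real"
  assumes [measurable]: "\<omega> \<in> borel_measurable borel" and nonneg: "\<And>x. 0 \<le> \<omega> x"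
  shows "riesz coulomb (lift \<omega>) = ennreal (16 * pi ^ 3) *
    (\<integral>\<^sup>+x. \<integral>\<^sup>+y. ennreal (G x y * \<omega> x * \<omega> y) * indicator half_plane x * indicator half_plane y \<partial>lborel \<partial>lborel)"
proof -
  define P where "P x = (\<integral>\<^sup>+y. ennreal (G x y * \<omega> y) * indicator half_plane y \<partial>lborel)" for x
  have [measurable]: "P \<in> borel_measurable borel" unfolding P_def[abs_def] by measurable
  define H where "H x = ennreal (4 * pi\<^sup>2 / snd x * (\<omega> x / snd x)) * P x" for x
  have [measurable]: "H \<in> borel_measurable borel" unfolding H_def[abs_def] by measurable
  have l0: "0 \<le> lift \<omega> z" for z by (simp add: lift_def nonneg)
  have "riesz coulomb (lift \<omega>) = (\<integral>\<^sup>+z. H (fst z, norm (snd (z :: r4))) \<partial>lborel)"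
    unfolding riesz_def
  proof (rule nn_integral_cong_AE)
    show "AE z in lborel. (\<integral>\<^sup>+y. coulomb ((dist z y)\<^sup>2) * ennreal (lift \<omega> z * lift \<omega> y) \<partial>lborel) = H (fst z, norm (snd z))"
      using AE_snd_nonzero
    proof eventually_elim
      case (elim z)
      obtain t y' where z: "z = (t, y')" by (cases z)
      have y': "y' \<noteq> 0" using elim z by simp
      have "(\<integral>\<^sup>+y. coulomb ((dist z y)\<^sup>2) * ennreal (lift \<omega> z * lift \<omega> y) \<partial>lborel)
        = (\<integral>\<^sup>+y. ennreal (lift \<omega> z) * (coulomb ((dist (t, y') y)\<^sup>2) * ennreal (lift \<omega> y)) \<partial>lborel)"
        by (intro nn_integral_cong) (simp add: z ennreal_mult l0 mult_ac)
      also have "\<dots> = ennreal (lift \<omega> z) * (ennreal (4 * pi\<^sup>2 / norm y') * P (t, norm y'))"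
        unfolding P_def by (subst nn_integral_cmult) (auto simp: nn_integral_coulomb_lift[OF assms y'])
      also have "\<dots> = H (fst z, norm (snd z))"
      proof -
        have "ennreal (4 * pi\<^sup>2 / norm y' * (\<omega> (t, norm y') / norm y'))
          = ennreal (4 * pi\<^sup>2 / norm y') * ennreal (\<omega> (t, norm y') / norm y')"
          by (rule ennreal_mult) (auto simp: nonneg)
        then show ?thesis unfolding H_def by (simp only: z lift_def fst_conv snd_conv mult_ac)
      qed
      finally show ?case .
    qed
  qed
  also have "\<dots> = (\<integral>\<^sup>+x. ennreal (4 * pi * (snd x)\<^sup>2) * H x * indicator half_plane x \<partial>lborel)"
    by (rule nn_integral_axisymmetric) measurable
  also have "\<dots> = (\<integral>\<^sup>+x. ennreal (16 * pi ^ 3) * (\<integral>\<^sup>+y. ennreal (G x y * \<omega> x * \<omega> y) * indicator half_plane x * indicator half_plane y \<partial>lborel) \<partial>lborel)"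
  proof (rule nn_integral_cong)
    fix x :: "real \<times> real"
    show "ennreal (4 * pi * (snd x)\<^sup>2) * H x * indicator half_plane x
      = ennreal (16 * pi ^ 3) * (\<integral>\<^sup>+y. ennreal (G x y * \<omega> x * \<omega> y) * indicator half_plane x * indicator half_plane y \<partial>lborel)"
    proof (cases "x \<in> half_plane")
      case False then show ?thesis by simp
    next
      case True
      then have x: "0 < snd x" by (simp add: half_plane_def)
      have "4 * pi * (snd x)\<^sup>2 * (4 * pi\<^sup>2 / snd x * (\<omega> x / snd x)) = 16 * pi ^ 3 * \<omega> x"
        using x by (simp add: field_simps power2_eq_square power3_eq_cube)
      then have "ennreal (4 * pi * (snd x)\<^sup>2) * H x = ennreal (16 * pi ^ 3) * (ennreal (\<omega> x) * P x)"
        unfolding H_def using x nonneg[of x]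
        by (simp add: mult.assoc[symmetric] ennreal_mult[symmetric])
      also have "ennreal (\<omega> x) * P x = (\<integral>\<^sup>+y. ennreal (\<omega> x) * (ennreal (G x y * \<omega> y) * indicator half_plane y) \<partial>lborel)"
        unfolding P_def by (rule nn_integral_cmult[symmetric]) measurable
      also have "\<dots> = (\<integral>\<^sup>+y. ennreal (G x y * \<omega> x * \<omega> y) * indicator half_plane x * indicator half_plane y \<partial>lborel)"
        using True G_nonneg[OF True] nonneg
        by (intro nn_integral_cong) (auto simp: indicator_def ennreal_mult[symmetric] mult_ac)
      finally show ?thesis using True by simp
    qed
  qed
  also have "\<dots> = ennreal (16 * pi ^ 3) *
    (\<integral>\<^sup>+x. \<integral>\<^sup>+y. ennreal (G x y * \<omega> x * \<omega> y) * indicator half_plane x * indicator half_plane y \<partial>lborel \<partial>lborel)"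
    by (rule nn_integral_cmult) measurable
  finally show ?thesis .
qed

section \<open>The radial problem\<close>

lemma nn_integral_inverse_square_tail:
  assumes "0 < m"
  shows "(\<integral>\<^sup>+w. ennreal (1 / w\<^sup>2) * indicator {m<..} w \<partial>lborel) = ennreal (1 / m)"
proof -
  have "(\<integral>\<^sup>+w. ennreal (1 / w\<^sup>2) * indicator {m<..} w \<partial>lborel) = (\<integral>\<^sup>+w. ennreal (1 / w\<^sup>2) * indicator {m..} w \<partial>lborel)"
    by (rule nn_integral_cong_AE) (use AE_lborel_singleton[of m] in \<open>eventually_elim, auto simp: indicator_def\<close>)
  also have "\<dots> = ennreal (0 - (- (1 / m)))"
  proof (rule nn_integral_FTC_atLeast)
    show "((\<lambda>w. - (1 / w)) has_real_derivative 1 / x\<^sup>2) (at x)" if "m \<le> x" for x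
      using that assms by (auto intro!: derivative_eq_intros simp: power2_eq_square)
    show "((\<lambda>w::real. - (1 / w)) \<longlongrightarrow> 0) at_top"
      using tendsto_minus[OF tendsto_inverse_0_at_top[OF filterlim_ident]] by (simp add: inverse_eq_divide)
  qed auto
  finally show ?thesis by simp
qed

text \<open>\<open>n\<close> is a mass density in the variable u = |X|^2, so this is the mass inside
  the sphere of squared radius \<open>u\<close>.\<close>

definition mass :: "(real \<Rightarrow> real) \<Rightarrow> real \<Rightarrow> ennreal" where
  "mass n u = (\<integral>\<^sup>+v. ennreal (n v) * indicator {0<..<u} v \<partial>lborel)"

lemma mass_measurable [measurable]:
  assumes [measurable]: "n \<in> borel_measurable borel"
  shows "mass n \<in> borel_measurable borel"
proof -
  have "mass n = (\<lambda>u. \<integral>\<^sup>+v. (if 0 < v \<and> v < u then ennreal (n v) else 0) \<partial>lborel)"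
    unfolding mass_def by (intro ext nn_integral_cong) (auto simp: indicator_def)
  then show ?thesis by (simp only:) measurable
qed

text \<open>The reciprocal of the maximum of two squared radii is the integral of 1 / w^2 over all w
  beyond both. After exchanging the integrals the two inner ones decouple into a square.\<close>

lemma riesz_coulomb_radial:
  fixes h :: "real \<Rightarrow> real" and f :: "r4 \<Rightarrow> real"
  assumes [measurable]: "h \<in> borel_measurable borel" and h0: "\<And>u. 0 \<le> h u"
    and f: "\<And>x. f x = h ((norm x)\<^sup>2)"
  defines "n \<equiv> \<lambda>v. pi\<^sup>2 * v * h v"
  shows "riesz coulomb f = (\<integral>\<^sup>+w. ennreal (1 / w\<^sup>2) * (mass n w)\<^sup>2 * indicator {0<..} w \<partial>lborel)"
proof -
  have [measurable]: "n \<in> borel_measurable borel" unfolding n_def by measurable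
  have n0: "0 \<le> n v" if "0 < v" for v using that h0 by (simp add: n_def)
  define P where "P a = (\<integral>\<^sup>+u. ennreal (n u / max a u) * indicator {0<..} u \<partial>lborel)" for a
  have [measurable]: "P \<in> borel_measurable borel" unfolding P_def[abs_def] by measurable
  have "riesz coulomb f = (\<integral>\<^sup>+x. ennreal (h ((norm (x :: r4))\<^sup>2)) * P ((norm x)\<^sup>2) \<partial>lborel)"
    unfolding riesz_def
  proof (rule nn_integral_cong_AE)
    have "AE x in lborel. x \<noteq> (0 :: r4)" by (rule AE_lborel_singleton)
    then show "AE x in lborel. (\<integral>\<^sup>+y. coulomb ((dist x y)\<^sup>2) * ennreal (f x * f y) \<partial>lborel)
      = ennreal (h ((norm x)\<^sup>2)) * P ((norm x)\<^sup>2)"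
    proof eventually_elim
      case (elim x)
      have "(\<integral>\<^sup>+y. coulomb ((dist x y)\<^sup>2) * ennreal (f x * f y) \<partial>lborel)
        = (\<integral>\<^sup>+y. ennreal (h ((norm x)\<^sup>2)) * (ennreal (h ((norm y)\<^sup>2)) * coulomb ((dist x y)\<^sup>2)) \<partial>lborel)"
        by (intro nn_integral_cong) (simp add: f ennreal_mult h0 mult_ac)
      also have "\<dots> = ennreal (h ((norm x)\<^sup>2)) * (\<integral>\<^sup>+y. ennreal (h ((norm y)\<^sup>2)) * coulomb ((dist x y)\<^sup>2) \<partial>lborel)"
        by (rule nn_integral_cmult) measurable
      also have "(\<integral>\<^sup>+y. ennreal (h ((norm y)\<^sup>2)) * coulomb ((dist x y)\<^sup>2) \<partial>lborel)
        = (\<integral>\<^sup>+u. ennreal (pi\<^sup>2 * u / max ((norm x)\<^sup>2) u) * ennreal (h u) * indicator {0<..} u \<partial>lborel)"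
        by (rule newton_kernel[OF elim]) measurable
      also have "\<dots> = P ((norm x)\<^sup>2)"
        unfolding P_def by (intro nn_integral_cong) (auto simp: n_def indicator_def ennreal_mult'[symmetric] h0)
      finally show ?case .
    qed
  qed
  also have "\<dots> = (\<integral>\<^sup>+v. ennreal (radial_density 4 v) * (ennreal (h v) * P v) \<partial>lborel)"
    unfolding DIM_4[symmetric] by (rule nn_integral_norm_square) measurable
  also have "\<dots> = (\<integral>\<^sup>+v. \<integral>\<^sup>+u. \<integral>\<^sup>+w. (ennreal (1 / w\<^sup>2) * indicator {0<..} w) *
      ((ennreal (n v) * indicator {0<..<w} v) * (ennreal (n u) * indicator {0<..<w} u)) \<partial>lborel \<partial>lborel \<partial>lborel)"
  proof (rule nn_integral_cong)
    fix v :: real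
    have "ennreal (radial_density 4 v) * (ennreal (h v) * P v) = (ennreal (n v) * indicator {0<..} v) * P v"
      by (auto simp: radial_density_4 n_def indicator_def ennreal_mult' h0 mult.assoc)
    also have "\<dots> = (\<integral>\<^sup>+u. (ennreal (n v) * indicator {0<..} v) * (ennreal (n u / max v u) * indicator {0<..} u) \<partial>lborel)"
      unfolding P_def by (rule nn_integral_cmult[symmetric]) measurable
    also have "\<dots> = (\<integral>\<^sup>+u. \<integral>\<^sup>+w. (ennreal (1 / w\<^sup>2) * indicator {0<..} w) *
      ((ennreal (n v) * indicator {0<..<w} v) * (ennreal (n u) * indicator {0<..<w} u)) \<partial>lborel \<partial>lborel)"
    proof (rule nn_integral_cong)
      fix u :: real
      show "(ennreal (n v) * indicator {0<..} v) * (ennreal (n u / max v u) * indicator {0<..} u)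
        = (\<integral>\<^sup>+w. (ennreal (1 / w\<^sup>2) * indicator {0<..} w) *
      ((ennreal (n v) * indicator {0<..<w} v) * (ennreal (n u) * indicator {0<..<w} u)) \<partial>lborel)"
      proof (cases "0 < u \<and> 0 < v")
        case False then show ?thesis by auto
      next
        case True
        then have m: "0 < max v u" by (simp add: less_max_iff_disj)
        have "(\<integral>\<^sup>+w. (ennreal (1 / w\<^sup>2) * indicator {0<..} w) *
            ((ennreal (n v) * indicator {0<..<w} v) * (ennreal (n u) * indicator {0<..<w} u)) \<partial>lborel)
          = (\<integral>\<^sup>+w. (ennreal (n v) * ennreal (n u)) * (ennreal (1 / w\<^sup>2) * indicator {max v u<..} w) \<partial>lborel)"
          using True by (intro nn_integral_cong) (auto simp: indicator_def mult_ac)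
        also have "\<dots> = (ennreal (n v) * ennreal (n u)) * ennreal (1 / max v u)"
          by (subst nn_integral_cmult) (auto simp: nn_integral_inverse_square_tail[OF m])
        also have "\<dots> = ennreal (n v) * ennreal (n u / max v u)"
          using True n0[of u] m by (simp add: mult.assoc ennreal_mult[symmetric])
        finally show ?thesis using True by simp
      qed
    qed
    finally show "ennreal (radial_density 4 v) * (ennreal (h v) * P v) = (\<integral>\<^sup>+u. \<integral>\<^sup>+w. (ennreal (1 / w\<^sup>2) * indicator {0<..} w) *
      ((ennreal (n v) * indicator {0<..<w} v) * (ennreal (n u) * indicator {0<..<w} u)) \<partial>lborel \<partial>lborel)" .
  qed
  also have "\<dots> = (\<integral>\<^sup>+w. (ennreal (1 / w\<^sup>2) * indicator {0<..} w) * (mass n w)\<^sup>2 \<partial>lborel)"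
  proof -
    have ind: "(indicator {0<..<w} v :: ennreal) = (if 0 < v \<and> v < w then 1 else 0)" for v w :: real
      by (simp add: indicator_def)
    define k where "k w = ennreal (1 / w\<^sup>2) * indicator {0<..} w" for w :: real
    define N where "N v w = ennreal (n v) * indicator {0<..<w} v" for v w
    have [measurable]: "case_prod N \<in> borel_measurable (borel \<Otimes>\<^sub>M borel)" "k \<in> borel_measurable borel"
      unfolding N_def k_def[abs_def] ind by measurable
    have "(\<integral>\<^sup>+v. \<integral>\<^sup>+u. \<integral>\<^sup>+w. k w * (N v w * N u w) \<partial>lborel \<partial>lborel \<partial>lborel)
      = (\<integral>\<^sup>+v. \<integral>\<^sup>+w. \<integral>\<^sup>+u. k w * (N v w * N u w) \<partial>lborel \<partial>lborel \<partial>lborel)"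
      by (intro nn_integral_cong lborel_pair.Fubini') measurable
    also have "\<dots> = (\<integral>\<^sup>+w. \<integral>\<^sup>+v. \<integral>\<^sup>+u. k w * (N v w * N u w) \<partial>lborel \<partial>lborel \<partial>lborel)"
      by (rule lborel_pair.Fubini') measurable
    also have "\<dots> = (\<integral>\<^sup>+w. k w * (mass n w)\<^sup>2 \<partial>lborel)"
      by (intro nn_integral_cong) (simp add: nn_integral_cmult nn_integral_multc mass_def N_def power2_eq_square)
    finally show ?thesis unfolding k_def N_def .
  qed
  finally show ?thesis by (simp add: mult_ac)
qed

text \<open>A weight for which the Cauchy-Schwarz argument loses nothing. \<open>mass_n0\<close> and
  \<open>tail\<close> are the integrated forms of N0' = n0 and c (n0 / v)' = - N0 / v^2 with n0 / v
  vanishing at \<open>A\<close>: the Euler-Lagrange system of the radial problem, where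
  \<open>A\<close> is the squared radius of the extremal ball.\<close>

locale hardy_profile =
  fixes n0 N0 :: "real \<Rightarrow> real" and A c :: real
  assumes A: "0 < A" and c: "0 < c"
    and n0_measurable [measurable]: "n0 \<in> borel_measurable borel"
    and N0_measurable [measurable]: "N0 \<in> borel_measurable borel"
    and n0_pos: "0 < v \<Longrightarrow> v < A \<Longrightarrow> 0 < n0 v"
    and N0_pos: "0 < u \<Longrightarrow> u \<le> A \<Longrightarrow> 0 < N0 u"
    and mass_n0: "0 < u \<Longrightarrow> u \<le> A \<Longrightarrow> mass n0 u = ennreal (N0 u)"
    and tail: "0 < v \<Longrightarrow> v < A \<Longrightarrow>
      (\<integral>\<^sup>+u. ennreal (N0 u / u\<^sup>2) * indicator {v<..<A} u \<partial>lborel) = ennreal (c * n0 v / v)"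
begin

definition weighted :: "(real \<Rightarrow> real) \<Rightarrow> real \<Rightarrow> ennreal" where
  "weighted n u = (\<integral>\<^sup>+v. ennreal ((n v)\<^sup>2 / n0 v) * indicator {0<..<u} v \<partial>lborel)"

lemma weighted_measurable [measurable]:
  assumes [measurable]: "n \<in> borel_measurable borel"
  shows "weighted n \<in> borel_measurable borel"
proof -
  have "weighted n = (\<lambda>u. \<integral>\<^sup>+v. (if 0 < v \<and> v < u then ennreal ((n v)\<^sup>2 / n0 v) else 0) \<partial>lborel)"
    unfolding weighted_def by (intro ext nn_integral_cong) (auto simp: indicator_def)
  then show ?thesis by (simp only:) measurable
qed

text \<open>Cauchy-Schwarz for \<open>n\<close> written as \<open>n / sqrt n0\<close> times
  \<open>sqrt n0\<close>.\<close>

lemma mass_le_weighted: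
  assumes [measurable]: "n \<in> borel_measurable borel" and n: "\<And>v. 0 \<le> n v" and u: "0 < u" "u \<le> A"
  shows "(mass n u)\<^sup>2 \<le> ennreal (N0 u) * weighted n u"
proof -
  define F where "F v = ennreal (n v / sqrt (n0 v)) * indicator {0<..<u} v" for v
  define H where "H v = ennreal (sqrt (n0 v)) * indicator {0<..<u} v" for v
  have [measurable]: "F \<in> borel_measurable borel" "H \<in> borel_measurable borel"
    unfolding F_def[abs_def] H_def[abs_def] by measurable
  have pos: "0 < n0 v" if "0 < v" "v < u" for v using that u by (intro n0_pos) auto
  have "mass n u = (\<integral>\<^sup>+v. F v * H v \<partial>lborel)"
    unfolding mass_def F_def H_def
  proof (rule nn_integral_cong)
    fix v
    show "ennreal (n v) * indicator {0<..<u} v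
      = ennreal (n v / sqrt (n0 v)) * indicator {0<..<u} v * (ennreal (sqrt (n0 v)) * indicator {0<..<u} v)"
    proof (cases "0 < v \<and> v < u")
      case True
      with pos[of v] have "ennreal (n v) = ennreal (n v / sqrt (n0 v)) * ennreal (sqrt (n0 v))"
        using n[of v] by (subst ennreal_mult[symmetric]) auto
      then show ?thesis using True by simp
    qed auto
  qed
  also have "(\<dots>)\<^sup>2 \<le> (\<integral>\<^sup>+v. (F v)\<^sup>2 \<partial>lborel) * (\<integral>\<^sup>+v. (H v)\<^sup>2 \<partial>lborel)"
    by (rule Cauchy_Schwarz_nn_integral) measurable
  also have "(\<integral>\<^sup>+v. (F v)\<^sup>2 \<partial>lborel) = weighted n u"
    unfolding weighted_def F_def
  proof (rule nn_integral_cong)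
    fix v
    show "(ennreal (n v / sqrt (n0 v)) * indicator {0<..<u} v)\<^sup>2 = ennreal ((n v)\<^sup>2 / n0 v) * indicator {0<..<u} v"
    proof (cases "0 < v \<and> v < u")
      case True
      then have "0 < n0 v" using pos by blast
      then show ?thesis using True n[of v] by (simp add: ennreal_power power_divide)
    qed auto
  qed
  also have "(\<integral>\<^sup>+v. (H v)\<^sup>2 \<partial>lborel) = mass n0 u"
    unfolding mass_def H_def
    by (intro nn_integral_cong) (use pos in \<open>auto simp: indicator_def ennreal_power less_imp_le\<close>)
  finally show ?thesis by (simp add: mass_n0[OF u] mult.commute)
qed

text \<open>Exchanging the integrals leaves exactly the tail integral of \<open>N0\<close>, and
  \<open>tail\<close> cancels the weight \<open>n0\<close> in the denominator.\<close>

lemma nn_integral_weighted: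
  assumes [measurable]: "n \<in> borel_measurable borel" and n: "\<And>v. 0 \<le> n v"
  shows "(\<integral>\<^sup>+u. ennreal (1 / u\<^sup>2) * (ennreal (N0 u) * weighted n u) * indicator {0<..<A} u \<partial>lborel)
    = ennreal c * (\<integral>\<^sup>+v. ennreal ((n v)\<^sup>2 / v) * indicator {0<..<A} v \<partial>lborel)"
proof -
  define k where "k u = ennreal (N0 u / u\<^sup>2) * indicator {0<..<A} u" for u
  define p where "p u v = ennreal ((n v)\<^sup>2 / n0 v) * indicator {0<..<u} v" for u v
  have ind: "(indicator {0<..<u} v :: ennreal) = (if 0 < v \<and> v < u then 1 else 0)" for v u :: real
    by (simp add: indicator_def)
  have [measurable]: "k \<in> borel_measurable borel" unfolding k_def[abs_def] by measurable
  have [measurable]: "case_prod p \<in> borel_measurable (borel \<Otimes>\<^sub>M borel)"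
    unfolding p_def ind by measurable
  have "(\<integral>\<^sup>+u. ennreal (1 / u\<^sup>2) * (ennreal (N0 u) * weighted n u) * indicator {0<..<A} u \<partial>lborel)
    = (\<integral>\<^sup>+u. \<integral>\<^sup>+v. k u * p u v \<partial>lborel \<partial>lborel)"
  proof (rule nn_integral_cong)
    fix u
    have "ennreal (1 / u\<^sup>2) * (ennreal (N0 u) * weighted n u) * indicator {0<..<A} u = k u * weighted n u"
      using N0_pos[of u] by (auto simp: k_def indicator_def mult.assoc[symmetric] ennreal_mult'[symmetric])
    then show "ennreal (1 / u\<^sup>2) * (ennreal (N0 u) * weighted n u) * indicator {0<..<A} u = (\<integral>\<^sup>+v. k u * p u v \<partial>lborel)"
      unfolding weighted_def p_def[symmetric] by (simp add: nn_integral_cmult)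
  qed
  also have "\<dots> = (\<integral>\<^sup>+v. \<integral>\<^sup>+u. k u * p u v \<partial>lborel \<partial>lborel)"
    by (rule lborel_pair.Fubini') measurable
  also have "\<dots> = (\<integral>\<^sup>+v. ennreal c * (ennreal ((n v)\<^sup>2 / v) * indicator {0<..<A} v) \<partial>lborel)"
  proof (rule nn_integral_cong)
    fix v
    show "(\<integral>\<^sup>+u. k u * p u v \<partial>lborel) = ennreal c * (ennreal ((n v)\<^sup>2 / v) * indicator {0<..<A} v)"
    proof (cases "0 < v \<and> v < A")
      case False
      then have "k u * p u v = 0" for u by (auto simp: k_def p_def indicator_def)
      then have "(\<integral>\<^sup>+u. k u * p u v \<partial>lborel) = 0" by (simp only:) simp
      then show ?thesis using False by auto
    next
      case True
      have "(\<integral>\<^sup>+u. k u * p u v \<partial>lborel)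
        = (\<integral>\<^sup>+u. ennreal ((n v)\<^sup>2 / n0 v) * (ennreal (N0 u / u\<^sup>2) * indicator {v<..<A} u) \<partial>lborel)"
        using True by (intro nn_integral_cong) (auto simp: k_def p_def indicator_def mult_ac)
      also have "\<dots> = ennreal ((n v)\<^sup>2 / n0 v) * ennreal (c * n0 v / v)"
        using True by (subst nn_integral_cmult) (auto simp: tail)
      also have "\<dots> = ennreal (c * ((n v)\<^sup>2 / v))"
        using True n0_pos[of v] c by (simp add: ennreal_mult[symmetric])
      also have "\<dots> = ennreal c * ennreal ((n v)\<^sup>2 / v)"
        using True c by (intro ennreal_mult) auto
      finally show ?thesis using True by simp
    qed
  qed
  also have "\<dots> = ennreal c * (\<integral>\<^sup>+v. ennreal ((n v)\<^sup>2 / v) * indicator {0<..<A} v \<partial>lborel)"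
    by (rule nn_integral_cmult) measurable
  finally show ?thesis .
qed

lemma hardy_inequality:
  assumes [measurable]: "n \<in> borel_measurable borel" and n: "\<And>v. 0 \<le> n v"
  shows "(\<integral>\<^sup>+u. ennreal (1 / u\<^sup>2) * (mass n u)\<^sup>2 * indicator {0<..<A} u \<partial>lborel)
    \<le> ennreal c * (\<integral>\<^sup>+v. ennreal ((n v)\<^sup>2 / v) * indicator {0<..<A} v \<partial>lborel)"
  unfolding nn_integral_weighted[OF assms, symmetric]
  by (intro nn_integral_mono) (auto simp: indicator_def intro!: mult_left_mono mass_le_weighted n)

text \<open>The defect in Cauchy-Schwarz is the integral of the square of
  \<open>n - \<kappa> * n0\<close> divided by \<open>n0\<close>, where \<open>\<kappa>\<close> is
  the ratio of the two masses.\<close>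

lemma hardy_equality_local:
  assumes [measurable]: "n \<in> borel_measurable borel" and n: "\<And>v. 0 \<le> n v" and u: "0 < u" "u \<le> A"
    and eq: "(mass n u)\<^sup>2 = ennreal (N0 u) * weighted n u" and fin: "mass n u < \<infinity>"
  shows "\<exists>\<kappa>. AE v in lborel. 0 < v \<longrightarrow> v < u \<longrightarrow> n v = \<kappa> * n0 v"
proof -
  obtain N where N: "mass n u = ennreal N" "0 \<le> N"
    using fin by (cases "mass n u") (auto simp: less_top)
  define Z where "Z = N0 u"
  have Z: "0 < Z" using N0_pos[OF u] by (simp add: Z_def)
  define \<kappa> where "\<kappa> = N / Z"
  have \<kappa>: "0 \<le> \<kappa>" using N Z by (simp add: \<kappa>_def)
  have pos: "0 < n0 v" if "0 < v" "v < u" for v using that u by (intro n0_pos) auto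
  have W: "weighted n u = ennreal (N * \<kappa>)"
  proof -
    have "ennreal Z * weighted n u = ennreal Z * ennreal (N * \<kappa>)"
      using eq N Z \<kappa> by (simp add: Z_def[symmetric] power2_eq_square ennreal_mult[symmetric] \<kappa>_def)
    then show ?thesis using Z by (simp add: ennreal_mult_cancel_left)
  qed
  define X where "X v = ennreal ((n v - \<kappa> * n0 v)\<^sup>2 / n0 v) * indicator {0<..<u} v" for v
  have [measurable]: "X \<in> borel_measurable borel" unfolding X_def[abs_def] by measurable
  \<comment> \<open>The square is completed with all terms on their positive side, because
    subtraction in \<open>ennreal\<close> is truncated; the common finite term is cancelled at the
    end.\<close>
  have "(\<integral>\<^sup>+v. X v \<partial>lborel) + ennreal (2 * \<kappa> * N)
    = (\<integral>\<^sup>+v. X v + ennreal (2 * \<kappa>) * (ennreal (n v) * indicator {0<..<u} v) \<partial>lborel)"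
    using \<kappa> N by (subst nn_integral_add) (auto simp: nn_integral_cmult mass_def[symmetric] ennreal_mult)
  also have "\<dots> = (\<integral>\<^sup>+v. ennreal ((n v)\<^sup>2 / n0 v) * indicator {0<..<u} v
      + ennreal (\<kappa>\<^sup>2) * (ennreal (n0 v) * indicator {0<..<u} v) \<partial>lborel)"
  proof (rule nn_integral_cong)
    fix v
    show "X v + ennreal (2 * \<kappa>) * (ennreal (n v) * indicator {0<..<u} v)
      = ennreal ((n v)\<^sup>2 / n0 v) * indicator {0<..<u} v + ennreal (\<kappa>\<^sup>2) * (ennreal (n0 v) * indicator {0<..<u} v)"
    proof (cases "0 < v \<and> v < u")
      case True
      with pos have p: "0 < n0 v" by auto
      have "(n v - \<kappa> * n0 v)\<^sup>2 / n0 v + 2 * \<kappa> * n v = (n v)\<^sup>2 / n0 v + \<kappa>\<^sup>2 * n0 v"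
        using p by (simp add: field_simps power2_eq_square)
      then have "ennreal ((n v - \<kappa> * n0 v)\<^sup>2 / n0 v) + ennreal (2 * \<kappa> * n v) = ennreal ((n v)\<^sup>2 / n0 v) + ennreal (\<kappa>\<^sup>2 * n0 v)"
        using p n \<kappa> by (simp add: ennreal_plus[symmetric] del: ennreal_plus)
      then show ?thesis using True p n \<kappa> by (simp add: X_def ennreal_mult)
    qed (auto simp: X_def)
  qed
  also have "\<dots> = weighted n u + ennreal (\<kappa>\<^sup>2) * mass n0 u"
    unfolding weighted_def mass_def by (subst nn_integral_add) (auto simp: nn_integral_cmult)
  also have "\<dots> = ennreal (N * \<kappa> + \<kappa>\<^sup>2 * Z)"
    using W \<kappa> N Z by (simp add: mass_n0[OF u] Z_def[symmetric] ennreal_mult)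
  also have "N * \<kappa> + \<kappa>\<^sup>2 * Z = 2 * \<kappa> * N"
    using Z by (simp add: \<kappa>_def field_simps power2_eq_square)
  finally have "(\<integral>\<^sup>+v. X v \<partial>lborel) + ennreal (2 * \<kappa> * N) = 0 + ennreal (2 * \<kappa> * N)" by simp
  then have "(\<integral>\<^sup>+v. X v \<partial>lborel) = 0"
    by (subst (asm) ennreal_add_left_cancel[of "ennreal (2 * \<kappa> * N)", unfolded add.commute[of "ennreal (2 * \<kappa> * N)"]]) auto
  then have "AE v in lborel. X v = 0" by (subst (asm) nn_integral_0_iff_AE) auto
  then have "AE v in lborel. 0 < v \<longrightarrow> v < u \<longrightarrow> n v = \<kappa> * n0 v"
  proof eventually_elim
    case (elim v)
    show ?case
    proof (intro impI)
      assume v: "0 < v" "v < u"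
      then have "(n v - \<kappa> * n0 v)\<^sup>2 / n0 v \<le> 0" using elim by (auto simp: X_def ennreal_eq_0_iff)
      then have "(n v - \<kappa> * n0 v)\<^sup>2 \<le> 0" using pos[OF v] by (simp add: divide_le_0_iff)
      then show "n v = \<kappa> * n0 v" by simp
    qed
  qed
  then show ?thesis by blast
qed

lemma AE_interval_witness:
  fixes a b :: real
  assumes "a < b" "AE x in lborel. P x"
  obtains x where "a < x" "x < b" "P x"
proof -
  have "\<exists>x. a < x \<and> x < b \<and> P x"
  proof (rule ccontr)
    assume "\<not> ?thesis"
    then have "AE x in lborel. x \<notin> {a<..<b}" using assms(2) by (auto elim!: eventually_mono)
    then have "emeasure lborel {a<..<b} = 0"
      using AE_iff_null_sets[of "{a<..<b}" lborel] by (auto simp: null_sets_def)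
    then show False using assms(1) by simp
  qed
  then show ?thesis using that by blast
qed

text \<open>Equality holds at almost every radius below \<open>A\<close>, each with its own factor;
  the endpoint \<open>A\<close> is not accessible to a statement almost everywhere. On overlaps the
  factors agree because \<open>n0\<close> is positive, and radii tending to \<open>A\<close> exhaust
  the interval.\<close>

lemma hardy_equality:
  assumes [measurable]: "n \<in> borel_measurable borel" and n: "\<And>v. 0 \<le> n v"
    and eq: "ennreal c * (\<integral>\<^sup>+v. ennreal ((n v)\<^sup>2 / v) * indicator {0<..<A} v \<partial>lborel)
      \<le> (\<integral>\<^sup>+u. ennreal (1 / u\<^sup>2) * (mass n u)\<^sup>2 * indicator {0<..<A} u \<partial>lborel)"
    and fin: "(\<integral>\<^sup>+u. ennreal (1 / u\<^sup>2) * (mass n u)\<^sup>2 * indicator {0<..<A} u \<partial>lborel) < \<infinity>"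
  shows "\<exists>\<kappa>. AE v in lborel. 0 < v \<longrightarrow> v < A \<longrightarrow> n v = \<kappa> * n0 v"
proof -
  have "AE u in lborel. ennreal (1 / u\<^sup>2) * (mass n u)\<^sup>2 * indicator {0<..<A} u
    = ennreal (1 / u\<^sup>2) * (ennreal (N0 u) * weighted n u) * indicator {0<..<A} u"
    by (rule AE_eq_of_nn_integral_eq)
      (use eq fin nn_integral_weighted[OF assms(1,2)] in
        \<open>auto simp: indicator_def intro!: mult_left_mono mass_le_weighted n\<close>)
  moreover have "AE u in lborel. ennreal (1 / u\<^sup>2) * (mass n u)\<^sup>2 * indicator {0<..<A} u \<noteq> \<infinity>"
    by (rule nn_integral_noteq_infinite) (use fin in auto)
  ultimately have AE: "AE u in lborel. 0 < u \<longrightarrow> u < A \<longrightarrow>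
    (\<exists>\<kappa>. AE v in lborel. 0 < v \<longrightarrow> v < u \<longrightarrow> n v = \<kappa> * n0 v)"
  proof eventually_elim
    case (elim u)
    show ?case
    proof (intro impI)
      assume u: "0 < u" "u < A"
      have "ennreal (1 / u\<^sup>2) \<noteq> 0" using u by simp
      then have "(mass n u)\<^sup>2 = ennreal (N0 u) * weighted n u"
        using elim(1) u by (simp add: ennreal_mult_cancel_left)
      moreover have "mass n u < \<infinity>"
        using elim(2) u by (auto simp: ennreal_mult_eq_top_iff power2_eq_square less_top)
      ultimately show "\<exists>\<kappa>. AE v in lborel. 0 < v \<longrightarrow> v < u \<longrightarrow> n v = \<kappa> * n0 v"
        using u by (intro hardy_equality_local) (auto simp: n)
    qed
  qed
  define Q where "Q u \<longleftrightarrow> (\<exists>\<kappa>. AE v in lborel. 0 < v \<longrightarrow> v < u \<longrightarrow> n v = \<kappa> * n0 v)" for u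
  have AEQ: "AE u in lborel. 0 < u \<longrightarrow> u < A \<longrightarrow> Q u" unfolding Q_def by (rule AE)
  have "\<exists>u. A * (1 - 1 / real (k + 2)) < u \<and> u < A \<and> 0 < u \<and> Q u" for k
  proof -
    have lt: "A * (1 - 1 / real (k + 2)) < A" "0 \<le> A * (1 - 1 / real (k + 2))" using A by auto
    obtain u where u: "A * (1 - 1 / real (k + 2)) < u" "u < A" "0 < u \<longrightarrow> u < A \<longrightarrow> Q u"
      by (rule AE_interval_witness[OF lt(1) AEQ])
    then have "0 < u" using lt(2) by linarith
    then show ?thesis using u by blast
  qed
  then obtain u where uk: "\<And>k. A * (1 - 1 / real (k + 2)) < u k" "\<And>k. u k < A" "\<And>k. 0 < u k" and "\<And>k. Q (u k)"
    by metis
  then have "\<forall>k. \<exists>\<kappa>. AE v in lborel. 0 < v \<longrightarrow> v < u k \<longrightarrow> n v = \<kappa> * n0 v" unfolding Q_def by blast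
  from choice[OF this] obtain \<kappa> where AEk: "\<And>k. AE v in lborel. 0 < v \<longrightarrow> v < u k \<longrightarrow> n v = \<kappa> k * n0 v" by blast
  have same: "\<kappa> k = \<kappa> 0" for k
  proof -
    have AE2: "AE v in lborel. 0 < v \<longrightarrow> v < u k \<longrightarrow> v < u 0 \<longrightarrow> \<kappa> k * n0 v = \<kappa> 0 * n0 v"
      using AEk[of k] AEk[of 0] by eventually_elim auto
    have m: "0 < min (u k) (u 0)" using uk(3)[of k] uk(3)[of 0] by simp
    obtain v where v: "0 < v" "v < min (u k) (u 0)"
      "0 < v \<longrightarrow> v < u k \<longrightarrow> v < u 0 \<longrightarrow> \<kappa> k * n0 v = \<kappa> 0 * n0 v"
      by (rule AE_interval_witness[OF m AE2])
    have "v < A" using v(2) uk(2)[of k] by simp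
    then have "0 < n0 v" by (rule n0_pos[OF v(1)])
    then show ?thesis using v by simp
  qed
  have "AE v in lborel. \<forall>k. 0 < v \<longrightarrow> v < u k \<longrightarrow> n v = \<kappa> 0 * n0 v"
    unfolding AE_all_countable
  proof
    fix k show "AE v in lborel. 0 < v \<longrightarrow> v < u k \<longrightarrow> n v = \<kappa> 0 * n0 v"
      using AEk[of k] unfolding same[of k] .
  qed
  then have "AE v in lborel. 0 < v \<longrightarrow> v < A \<longrightarrow> n v = \<kappa> 0 * n0 v"
  proof eventually_elim
    case (elim v)
    show ?case
    proof (intro impI)
      assume v: "0 < v" "v < A"
      obtain k where k: "A / (A - v) < real k" using reals_Archimedean2 by blast
      have "A < real k * (A - v)" using k v by (simp add: field_simps)
      also have "\<dots> \<le> real (k + 2) * (A - v)" using v by (intro mult_right_mono) auto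
      finally have "A / real (k + 2) < A - v" by (simp add: divide_less_eq mult.commute)
      then have "v < A * (1 - 1 / real (k + 2))" by (simp add: right_diff_distrib)
      then have "v < u k" using uk(1)[of k] by simp
      then show "n v = \<kappa> 0 * n0 v" using elim v by blast
    qed
  qed
  then show ?thesis by blast
qed

end

section \<open>Energy, mass and square norm of radial densities\<close>

definition shell_energy :: "(real \<Rightarrow> real) \<Rightarrow> ennreal" where
  "shell_energy n = (\<integral>\<^sup>+w. ennreal (1 / w\<^sup>2) * (mass n w)\<^sup>2 * indicator {0<..} w \<partial>lborel)"

definition total_mass :: "(real \<Rightarrow> real) \<Rightarrow> ennreal" where
  "total_mass n = (\<integral>\<^sup>+v. ennreal (n v) * indicator {0<..} v \<partial>lborel)"

definition shell_square :: "(real \<Rightarrow> real) \<Rightarrow> ennreal" where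
  "shell_square n = (\<integral>\<^sup>+v. ennreal ((n v)\<^sup>2 / v) * indicator {0<..} v \<partial>lborel)"

lemma mass_le_total_mass: "mass n u \<le> total_mass n"
  unfolding mass_def total_mass_def by (intro nn_integral_mono) (auto simp: indicator_def)

lemma mass_cong: "(\<And>v. 0 < v \<Longrightarrow> n v = n' v) \<Longrightarrow> mass n u = mass n' u"
  unfolding mass_def by (intro nn_integral_cong) (auto simp: indicator_def)

lemma nn_integral_indicator_split:
  fixes A :: real and f :: "real \<Rightarrow> ennreal"
  assumes [measurable]: "f \<in> borel_measurable borel" and A: "0 < A"
  shows "(\<integral>\<^sup>+v. f v * indicator {0<..} v \<partial>lborel)
    = (\<integral>\<^sup>+v. f v * indicator {0<..<A} v \<partial>lborel) + (\<integral>\<^sup>+v. f v * indicator {A<..} v \<partial>lborel)"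
proof -
  have "(\<integral>\<^sup>+v. f v * indicator {0<..} v \<partial>lborel) = (\<integral>\<^sup>+v. f v * indicator {0<..<A} v + f v * indicator {A<..} v \<partial>lborel)"
  proof (rule nn_integral_cong_AE)
    show "AE v in lborel. f v * indicator {0<..} v = f v * indicator {0<..<A} v + f v * indicator {A<..} v"
      using AE_lborel_singleton[of A] by eventually_elim (use A in \<open>auto simp: indicator_def\<close>)
  qed
  then show ?thesis by (simp add: nn_integral_add)
qed

context hardy_profile
begin

lemma shell_energy_split:
  assumes [measurable]: "n \<in> borel_measurable borel"
  shows "shell_energy n = (\<integral>\<^sup>+w. ennreal (1 / w\<^sup>2) * (mass n w)\<^sup>2 * indicator {0<..<A} w \<partial>lborel)
    + (\<integral>\<^sup>+w. ennreal (1 / w\<^sup>2) * (mass n w)\<^sup>2 * indicator {A<..} w \<partial>lborel)"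
  unfolding shell_energy_def by (intro nn_integral_indicator_split A) measurable

lemma tail_energy:
  "(\<integral>\<^sup>+w. ennreal (1 / w\<^sup>2) * (total_mass n)\<^sup>2 * indicator {A<..} w \<partial>lborel) = ennreal (1 / A) * (total_mass n)\<^sup>2"
proof -
  have "(\<integral>\<^sup>+w. ennreal (1 / w\<^sup>2) * (total_mass n)\<^sup>2 * indicator {A<..} w \<partial>lborel)
    = (\<integral>\<^sup>+w. ennreal (1 / w\<^sup>2) * indicator {A<..} w * (total_mass n)\<^sup>2 \<partial>lborel)"
    by (simp add: mult_ac)
  also have "\<dots> = (\<integral>\<^sup>+w. ennreal (1 / w\<^sup>2) * indicator {A<..} w \<partial>lborel) * (total_mass n)\<^sup>2"
    by (rule nn_integral_multc) measurable
  finally show ?thesis by (simp only: nn_integral_inverse_square_tail[OF A])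
qed

lemma tail_energy_le:
  "(\<integral>\<^sup>+w. ennreal (1 / w\<^sup>2) * (mass n w)\<^sup>2 * indicator {A<..} w \<partial>lborel) \<le> ennreal (1 / A) * (total_mass n)\<^sup>2"
  unfolding tail_energy[symmetric]
  by (intro nn_integral_mono mult_right_mono mult_left_mono power_mono mass_le_total_mass) auto

lemma shell_inequality:
  assumes [measurable]: "n \<in> borel_measurable borel" and n: "\<And>v. 0 \<le> n v"
  shows "shell_energy n \<le> ennreal c * shell_square n + ennreal (1 / A) * (total_mass n)\<^sup>2"
proof -
  have "(\<integral>\<^sup>+v. ennreal ((n v)\<^sup>2 / v) * indicator {0<..<A} v \<partial>lborel) \<le> shell_square n"
    unfolding shell_square_def by (intro nn_integral_mono) (auto simp: indicator_def)
  then show ?thesis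
    unfolding shell_energy_split[OF assms(1)]
    by (intro add_mono tail_energy_le order_trans[OF hardy_inequality[OF assms]] mult_left_mono) auto
qed

text \<open>The inequality is a sum of estimates, so each of them is an equality: the Hardy part
  yields the profile below \<open>A\<close>, and the part of the square norm beyond
  \<open>A\<close>, which the Hardy part does not use, must vanish.\<close>

lemma shell_equality:
  assumes [measurable]: "n \<in> borel_measurable borel" and n: "\<And>v. 0 \<le> n v"
    and eq: "ennreal c * shell_square n + ennreal (1 / A) * (total_mass n)\<^sup>2 \<le> shell_energy n"
    and fin: "shell_energy n < \<infinity>"
  shows "\<exists>\<kappa>. AE v in lborel. 0 < v \<longrightarrow> n v = (if v < A then \<kappa> * n0 v else 0)"
proof -
  define I1 where "I1 = (\<integral>\<^sup>+w. ennreal (1 / w\<^sup>2) * (mass n w)\<^sup>2 * indicator {0<..<A} w \<partial>lborel)"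
  define I2 where "I2 = (\<integral>\<^sup>+w. ennreal (1 / w\<^sup>2) * (mass n w)\<^sup>2 * indicator {A<..} w \<partial>lborel)"
  define S1 where "S1 = (\<integral>\<^sup>+v. ennreal ((n v)\<^sup>2 / v) * indicator {0<..<A} v \<partial>lborel)"
  define S2 where "S2 = (\<integral>\<^sup>+v. ennreal ((n v)\<^sup>2 / v) * indicator {A<..} v \<partial>lborel)"
  define T where "T = ennreal (1 / A) * (total_mass n)\<^sup>2"
  have I: "shell_energy n = I1 + I2" unfolding I1_def I2_def by (rule shell_energy_split) fact
  have S: "shell_square n = S1 + S2" unfolding S1_def S2_def shell_square_def
    by (intro nn_integral_indicator_split A) measurable
  have le: "I1 \<le> ennreal c * S1" "I2 \<le> T"
    unfolding I1_def I2_def S1_def T_def using hardy_inequality[OF assms(1) n] tail_energy_le by auto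
  have e: "ennreal c * S1 + ennreal c * S2 + T \<le> I1 + I2" using eq unfolding I S T_def by (simp add: distrib_left)
  have f: "I1 + I2 < top" using fin I by simp
  \<comment> \<open>All terms are finite, so the comparison moves to the reals, where terms
    cancel.\<close>
  have "ennreal c * S1 < top" "ennreal c * S2 < top" "T < top" "I1 < top" "I2 < top"
    using le_less_trans[OF e f] f by (auto simp: less_top)
  then obtain s1 s2 t i1 i2 where r: "ennreal c * S1 = ennreal s1" "ennreal c * S2 = ennreal s2" "T = ennreal t"
      "I1 = ennreal i1" "I2 = ennreal i2" "0 \<le> s1" "0 \<le> s2" "0 \<le> t" "0 \<le> i1" "0 \<le> i2"
    by (metis less_top_ennreal)
  have "s1 + s2 + t \<le> i1 + i2" "i1 \<le> s1" "i2 \<le> t"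
    using e le r by (auto simp: ennreal_plus[symmetric] simp del: ennreal_plus)
  then have "s2 = 0" "i1 = s1" using r by auto
  then have S2: "S2 = 0" and I1: "ennreal c * S1 \<le> I1" using r c by auto
  have "\<exists>\<kappa>. AE v in lborel. 0 < v \<longrightarrow> v < A \<longrightarrow> n v = \<kappa> * n0 v"
    by (rule hardy_equality[OF assms(1) n]) (use I1 f in \<open>auto simp: I1_def S1_def less_top\<close>)
  then obtain \<kappa> where \<kappa>: "AE v in lborel. 0 < v \<longrightarrow> v < A \<longrightarrow> n v = \<kappa> * n0 v" by blast
  have "AE v in lborel. ennreal ((n v)\<^sup>2 / v) * indicator {A<..} v = 0"
    using S2 unfolding S2_def by (subst (asm) nn_integral_0_iff_AE) auto
  with \<kappa> AE_lborel_singleton[of A] have "AE v in lborel. 0 < v \<longrightarrow> n v = (if v < A then \<kappa> * n0 v else 0)"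
  proof eventually_elim
    case (elim v)
    show ?case
    proof (cases "v < A")
      case False
      then have v: "A < v" using elim by auto
      then have "(n v)\<^sup>2 / v \<le> 0" using elim by (simp add: ennreal_eq_0_iff)
      then show ?thesis using v A by (simp add: divide_le_0_iff)
    qed (use elim in auto)
  qed
  then show ?thesis by blast
qed

text \<open>A multiple of the weight makes Cauchy-Schwarz exact at every radius up to
  \<open>A\<close>, and beyond \<open>A\<close> the mass is already the total mass, so neither
  estimate loses anything.\<close>

lemma shell_attained:
  assumes [measurable]: "n \<in> borel_measurable borel" and \<kappa>: "0 \<le> \<kappa>"
    and n: "\<And>v. n v = (if 0 < v \<and> v < A then \<kappa> * n0 v else 0)"
  shows "total_mass n = ennreal (\<kappa> * N0 A)"
    and "shell_energy n = ennreal c * shell_square n + ennreal (1 / A) * (total_mass n)\<^sup>2"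
proof -
  have nn: "0 \<le> n v" for v using n0_pos[of v] \<kappa> by (auto simp: n)
  have ms: "mass n u = ennreal (\<kappa> * N0 u)" if u: "0 < u" "u \<le> A" for u
  proof -
    have "mass n u = (\<integral>\<^sup>+v. ennreal \<kappa> * (ennreal (n0 v) * indicator {0<..<u} v) \<partial>lborel)"
      unfolding mass_def using u \<kappa> by (intro nn_integral_cong) (auto simp: indicator_def n ennreal_mult')
    also have "\<dots> = ennreal \<kappa> * mass n0 u" unfolding mass_def by (rule nn_integral_cmult) measurable
    finally show ?thesis using \<kappa> by (simp add: mass_n0[OF u] ennreal_mult')
  qed
  have big: "mass n u = total_mass n" if "A \<le> u" for u
    unfolding mass_def total_mass_def using that by (intro nn_integral_cong) (auto simp: indicator_def n)
  show "total_mass n = ennreal (\<kappa> * N0 A)" using big[of A] ms[of A] A by simp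
  have wt: "(mass n u)\<^sup>2 = ennreal (N0 u) * weighted n u" if u: "0 < u" "u \<le> A" for u
  proof -
    have "weighted n u = (\<integral>\<^sup>+v. ennreal (\<kappa>\<^sup>2) * (ennreal (n0 v) * indicator {0<..<u} v) \<partial>lborel)"
      unfolding weighted_def
    proof (rule nn_integral_cong)
      fix v
      show "ennreal ((n v)\<^sup>2 / n0 v) * indicator {0<..<u} v = ennreal (\<kappa>\<^sup>2) * (ennreal (n0 v) * indicator {0<..<u} v)"
      proof (cases "0 < v \<and> v < u")
        case True
        then have "0 < n0 v" "n v = \<kappa> * n0 v" using u n0_pos[of v] by (auto simp: n)
        then have "(n v)\<^sup>2 / n0 v = \<kappa>\<^sup>2 * n0 v" by (simp add: power2_eq_square)
        then show ?thesis using True by (simp add: ennreal_mult')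
      qed auto
    qed
    also have "\<dots> = ennreal (\<kappa>\<^sup>2) * mass n0 u" unfolding mass_def by (rule nn_integral_cmult) measurable
    finally show ?thesis
      using \<kappa> N0_pos[OF u] by (simp add: ms[OF u] mass_n0[OF u] ennreal_power ennreal_mult[symmetric] power_mult_distrib power2_eq_square mult_ac)
  qed
  have I1: "(\<integral>\<^sup>+w. ennreal (1 / w\<^sup>2) * (mass n w)\<^sup>2 * indicator {0<..<A} w \<partial>lborel)
    = ennreal c * (\<integral>\<^sup>+v. ennreal ((n v)\<^sup>2 / v) * indicator {0<..<A} v \<partial>lborel)"
    unfolding nn_integral_weighted[OF assms(1) nn, symmetric]
    by (intro nn_integral_cong) (auto simp: indicator_def wt)
  have "(\<integral>\<^sup>+v. ennreal ((n v)\<^sup>2 / v) * indicator {0<..<A} v \<partial>lborel) = shell_square n"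
    unfolding shell_square_def by (intro nn_integral_cong) (auto simp: indicator_def n)
  moreover have "(\<integral>\<^sup>+w. ennreal (1 / w\<^sup>2) * (mass n w)\<^sup>2 * indicator {A<..} w \<partial>lborel) = ennreal (1 / A) * (total_mass n)\<^sup>2"
    unfolding tail_energy[symmetric] by (intro nn_integral_cong) (auto simp: indicator_def big)
  ultimately show "shell_energy n = ennreal c * shell_square n + ennreal (1 / A) * (total_mass n)\<^sup>2"
    unfolding shell_energy_split[OF assms(1)] I1 by simp
qed

end

text \<open>\<open>radial_density 4\<close> times the profile. The maximum makes it vanish for
  negative arguments, hence nonnegative everywhere for nonnegative \<open>h\<close>.\<close>

definition shell_profile :: "(real \<Rightarrow> real) \<Rightarrow> real \<Rightarrow> real" where
  "shell_profile h v = pi\<^sup>2 * max 0 v * h v"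

lemma shell_profile_measurable [measurable]:
  assumes [measurable]: "h \<in> borel_measurable borel"
  shows "shell_profile h \<in> borel_measurable borel"
  unfolding shell_profile_def[abs_def] by measurable

lemma radial_integrals:
  fixes h :: "real \<Rightarrow> real" and f :: "r4 \<Rightarrow> real"
  assumes [measurable]: "h \<in> borel_measurable borel" and h0: "\<And>u. 0 \<le> h u"
    and f: "\<And>x. f x = h ((norm x)\<^sup>2)"
  shows "riesz coulomb f = shell_energy (shell_profile h)"
    and "(\<integral>\<^sup>+x. ennreal (f x) \<partial>lborel) = total_mass (shell_profile h)"
    and "ennreal (pi\<^sup>2) * (\<integral>\<^sup>+x. ennreal ((f x)\<^sup>2) \<partial>lborel) = shell_square (shell_profile h)"
proof -
  have "mass (\<lambda>v. pi\<^sup>2 * v * h v) = mass (shell_profile h)"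
    by (intro ext mass_cong) (simp add: shell_profile_def)
  then show "riesz coulomb f = shell_energy (shell_profile h)"
    unfolding shell_energy_def riesz_coulomb_radial[OF assms] by simp
  have "(\<integral>\<^sup>+x. ennreal (f x) \<partial>lborel) = (\<integral>\<^sup>+v. ennreal (radial_density 4 v) * ennreal (h v) \<partial>lborel)"
    unfolding DIM_4[symmetric] f by (rule nn_integral_norm_square) measurable
  also have "\<dots> = total_mass (shell_profile h)"
    unfolding total_mass_def
    by (intro nn_integral_cong) (auto simp: radial_density_4 shell_profile_def indicator_def ennreal_mult' h0)
  finally show "(\<integral>\<^sup>+x. ennreal (f x) \<partial>lborel) = total_mass (shell_profile h)" .
  have "(\<integral>\<^sup>+x. ennreal ((f x)\<^sup>2) \<partial>lborel) = (\<integral>\<^sup>+v. ennreal (radial_density 4 v) * ennreal ((h v)\<^sup>2) \<partial>lborel)"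
    unfolding DIM_4[symmetric] f by (rule nn_integral_norm_square) measurable
  then have "ennreal (pi\<^sup>2) * (\<integral>\<^sup>+x. ennreal ((f x)\<^sup>2) \<partial>lborel)
    = (\<integral>\<^sup>+v. ennreal (pi\<^sup>2) * (ennreal (radial_density 4 v) * ennreal ((h v)\<^sup>2)) \<partial>lborel)"
    by (simp add: nn_integral_cmult)
  also have "\<dots> = shell_square (shell_profile h)"
    unfolding shell_square_def
  proof (rule nn_integral_cong)
    fix v :: real
    have "(shell_profile h v)\<^sup>2 / v = pi\<^sup>2 * (pi\<^sup>2 * v * (h v)\<^sup>2)" if "0 < v"
      using that by (simp add: shell_profile_def power2_eq_square)
    then show "ennreal (pi\<^sup>2) * (ennreal (radial_density 4 v) * ennreal ((h v)\<^sup>2))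
      = ennreal ((shell_profile h v)\<^sup>2 / v) * indicator {0<..} v"
      by (cases "0 < v") (auto simp: radial_density_4 ennreal_mult'[symmetric])
  qed
  finally show "ennreal (pi\<^sup>2) * (\<integral>\<^sup>+x. ennreal ((f x)\<^sup>2) \<partial>lborel) = shell_square (shell_profile h)" .
qed

section \<open>The sharp inequality\<close>

text \<open>Lower semicontinuity of the energy under almost everywhere convergence, by Fatou's lemma
  in each variable. The kernel varies with \<open>n\<close> and may be infinite in the limit at
  distance zero, which for each \<open>x\<close> concerns one point \<open>y\<close> only.\<close>

lemma riesz_fatou:
  fixes F :: "nat \<Rightarrow> 'a::euclidean_space \<Rightarrow> real" and K :: "nat \<Rightarrow> real \<Rightarrow> ennreal"
  assumes [measurable]: "\<And>n. F n \<in> borel_measurable borel" "f \<in> borel_measurable borel"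
      "\<And>n. K n \<in> borel_measurable borel" "k \<in> borel_measurable borel"
    and conv: "AE x in lborel. (\<lambda>n. F n x) \<longlonglongrightarrow> f x"
    and K: "\<And>s. 0 < s \<Longrightarrow> (\<lambda>n. K n s) \<longlonglongrightarrow> k s" and k: "\<And>s. 0 < s \<Longrightarrow> k s < \<infinity>"
    and B: "\<And>n. riesz (K n) (F n) \<le> B n" and L: "B \<longlonglongrightarrow> L"
  shows "riesz k f \<le> L"
proof -
  define I where "I n x y = K n ((dist x y)\<^sup>2) * ennreal (F n x * F n y)" for n x y
  have [measurable]: "case_prod (I n) \<in> borel_measurable (borel \<Otimes>\<^sub>M borel)" for n unfolding I_def by measurable
  have "riesz k f \<le> (\<integral>\<^sup>+x. liminf (\<lambda>n. \<integral>\<^sup>+y. I n x y \<partial>lborel) \<partial>lborel)"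
    unfolding riesz_def
  proof (rule nn_integral_mono_AE)
    show "AE x in lborel. (\<integral>\<^sup>+y. k ((dist x y)\<^sup>2) * ennreal (f x * f y) \<partial>lborel) \<le> liminf (\<lambda>n. \<integral>\<^sup>+y. I n x y \<partial>lborel)"
      using conv
    proof eventually_elim
      case (elim x)
      have "(\<integral>\<^sup>+y. k ((dist x y)\<^sup>2) * ennreal (f x * f y) \<partial>lborel) \<le> (\<integral>\<^sup>+y. liminf (\<lambda>n. I n x y) \<partial>lborel)"
      proof (rule nn_integral_mono_AE)
        show "AE y in lborel. k ((dist x y)\<^sup>2) * ennreal (f x * f y) \<le> liminf (\<lambda>n. I n x y)"
          using conv AE_lborel_singleton[of x]
        proof eventually_elim
          case (elim y)
          then have d: "0 < (dist x y)\<^sup>2" by simp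
          have "(\<lambda>n. I n x y) \<longlonglongrightarrow> k ((dist x y)\<^sup>2) * ennreal (f x * f y)"
            unfolding I_def
            by (rule tendsto_mult_ennreal) (use K[OF d] k[OF d] elim \<open>(\<lambda>n. F n x) \<longlonglongrightarrow> f x\<close> in \<open>auto intro!: tendsto_intros\<close>)
          from lim_imp_Liminf[OF _ this] show ?case by simp
        qed
      qed
      also have "\<dots> \<le> liminf (\<lambda>n. \<integral>\<^sup>+y. I n x y \<partial>lborel)"
        by (rule nn_integral_liminf) measurable
      finally show ?case .
    qed
  qed
  also have "\<dots> \<le> liminf (\<lambda>n. \<integral>\<^sup>+x. \<integral>\<^sup>+y. I n x y \<partial>lborel \<partial>lborel)"
    by (rule nn_integral_liminf) measurable
  also have "\<dots> \<le> liminf B"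
    by (rule Liminf_mono) (use B in \<open>auto simp: riesz_def I_def\<close>)
  also have "\<dots> = L" by (rule lim_imp_Liminf[OF _ L]) simp
  finally show ?thesis .
qed

lemma riesz_kernel_mono:
  "(\<And>s. 0 \<le> s \<Longrightarrow> k s \<le> k' s) \<Longrightarrow> riesz k f \<le> riesz k' f"
  unfolding riesz_def by (intro nn_integral_mono mult_right_mono) auto

lemma borel_AE_limit_of_continuous:
  fixes f :: "'a::euclidean_space \<Rightarrow> real"
  assumes "f \<in> borel_measurable borel"
  obtains g where "\<And>n::nat. continuous_on UNIV (g n)" "AE x in lborel. (\<lambda>n. g n x) \<longlonglongrightarrow> f x"
proof -
  have "f \<in> borel_measurable lebesgue" using assms by (simp add: measurable_completion)
  then have "f measurable_on UNIV" by (intro lebesgue_measurable_imp_measurable_on) (simp_all add: lebesgue_on_UNIV_eq)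
  then obtain N g where N: "negligible N" and g: "\<And>n::nat. continuous_on UNIV (g n)"
    "\<And>x. x \<notin> N \<Longrightarrow> (\<lambda>n. g n x) \<longlonglongrightarrow> (if x \<in> UNIV then f x else 0)"
    unfolding measurable_on_def by blast
  have "AE x in lebesgue. x \<notin> N"
    using N by (intro AE_not_in) (simp add: negligible_iff_null_sets)
  then have "AE x in lebesgue. (\<lambda>n. g n x) \<longlonglongrightarrow> f x" by eventually_elim (use g(2) in force)
  then have "AE x in lborel. (\<lambda>n. g n x) \<longlonglongrightarrow> f x" by (simp add: AE_completion_iff)
  with g(1) show ?thesis by (rule that)
qed

context hardy_profile
begin

text \<open>The factor \<open>pi\<^sup>2\<close> converts the square norm into
  \<open>shell_square\<close>, see \<open>radial_integrals\<close>.\<close>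

definition sharp_bound :: "(r4 \<Rightarrow> real) \<Rightarrow> ennreal" where
  "sharp_bound f = ennreal (c * pi\<^sup>2) * (\<integral>\<^sup>+x. ennreal ((f x)\<^sup>2) \<partial>lborel)
     + ennreal (1 / A) * (\<integral>\<^sup>+x. ennreal (f x) \<partial>lborel)\<^sup>2"

lemma sharp_bound_radial:
  assumes "h \<in> borel_measurable borel" "\<And>u. 0 \<le> h u" "\<And>x. f x = h ((norm x)\<^sup>2)"
  shows "sharp_bound f = ennreal c * shell_square (shell_profile h) + ennreal (1 / A) * (total_mass (shell_profile h))\<^sup>2"
  unfolding sharp_bound_def radial_integrals(3)[OF assms, symmetric] radial_integrals(2)[OF assms]
  using c by (simp add: ennreal_mult mult.assoc)

lemma sharp_inequality_radial:
  assumes "h \<in> borel_measurable borel" "\<And>u. 0 \<le> h u" "\<And>x. f x = h ((norm x)\<^sup>2)"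
  shows "riesz coulomb f \<le> sharp_bound f"
  unfolding sharp_bound_radial[OF assms] radial_integrals(1)[OF assms]
  by (rule shell_inequality) (use assms(1,2) in \<open>auto simp: shell_profile_def\<close>)

lemma sharp_inequality_continuous:
  assumes cont: "continuous_on UNIV f" and nonneg: "\<And>x. 0 \<le> f x" and supp: "\<And>x. R < norm x \<Longrightarrow> f x = 0"
  shows "riesz coulomb f \<le> sharp_bound f"
proof -
  \<comment> \<open>Bounded kernels below the Coulomb kernel, decreasing in the squared distance and
    converging to it away from zero; boundedness is what the symmetrization uses.\<close>
  define \<kappa> where "\<kappa> n s = 1 / (\<bar>s\<bar> + 1 / real (Suc n))" for n s
  have [measurable]: "\<kappa> n \<in> borel_measurable borel" for n unfolding \<kappa>_def[abs_def] by measurable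
  have [measurable]: "f \<in> borel_measurable borel" by (rule borel_measurable_continuous_onI[OF cont])
  show ?thesis
  proof (rule riesz_fatou[where F="\<lambda>n. f" and K="\<lambda>n s. ennreal (\<kappa> n s)" and B="\<lambda>n. sharp_bound f"])
    fix n
    have den: "0 < \<bar>s\<bar> + 1 / real (Suc n)" for s :: real by (intro add_nonneg_pos) auto
    have \<kappa>0: "0 \<le> \<kappa> n s" for s using den[of s] by (simp add: \<kappa>_def)
    have anti: "\<kappa> n t \<le> \<kappa> n s" if "0 \<le> s" "s \<le> t" for s t
      unfolding \<kappa>_def using den[of s] den[of t] that by (intro divide_left_mono) auto
    have \<kappa>m: "\<kappa> n \<in> borel_measurable borel" by measurable
    obtain g :: "r4 \<Rightarrow> real" where g: "continuous_on UNIV g" "\<And>x. 0 \<le> g x" "\<And>x y. norm x = norm y \<Longrightarrow> g x = g y"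
      "(\<integral>\<^sup>+x. ennreal (g x) \<partial>lborel) = (\<integral>\<^sup>+x. ennreal (f x) \<partial>lborel)"
      "(\<integral>\<^sup>+x. ennreal ((g x)\<^sup>2) \<partial>lborel) = (\<integral>\<^sup>+x. ennreal ((f x)\<^sup>2) \<partial>lborel)"
      "riesz (\<lambda>s. ennreal (\<kappa> n s)) f \<le> riesz (\<lambda>s. ennreal (\<kappa> n s)) g"
      using symmetrize_continuous[OF cont nonneg supp \<kappa>m \<kappa>0 anti] by blast
    \<comment> \<open>By radiality the profile can be read off along the axis.\<close>
    define h where "h u = g (sqrt u, 0)" for u
    have "riesz (\<lambda>s. ennreal (\<kappa> n s)) g \<le> riesz coulomb g"
    proof (rule riesz_kernel_mono)
      fix s :: real assume s: "0 \<le> s"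
      show "ennreal (\<kappa> n s) \<le> coulomb s"
      proof (cases "s = 0")
        case True then show ?thesis by (simp add: coulomb_def)
      next
        case False
        then have "0 < s" using s by simp
        then show ?thesis using den[of s] unfolding coulomb_pos[OF \<open>0 < s\<close>] \<kappa>_def
          by (intro ennreal_leI divide_left_mono) auto
      qed
    qed
    also have "\<dots> \<le> sharp_bound g"
    proof (rule sharp_inequality_radial)
      have "continuous_on UNIV h" unfolding h_def
        by (rule continuous_on_compose2[OF g(1)]) (auto intro!: continuous_intros)
      then show "h \<in> borel_measurable borel" by (rule borel_measurable_continuous_onI)
      show "0 \<le> h u" for u by (simp add: h_def g)
      show "g x = h ((norm x)\<^sup>2)" for x unfolding h_def by (rule g(3)) (simp add: norm_Pair)
    qed
    finally show "riesz (\<lambda>s. ennreal (\<kappa> n s)) f \<le> sharp_bound f"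
      using g(4-6) by (auto simp: sharp_bound_def)
  next
    fix s :: real assume s: "0 < s"
    have "(\<lambda>n. 1 / (\<bar>s\<bar> + 1 / real (Suc n))) \<longlonglongrightarrow> 1 / (\<bar>s\<bar> + 0)"
      by (intro tendsto_intros LIMSEQ_Suc[OF lim_1_over_n]) (use s in auto)
    then show "(\<lambda>n. ennreal (\<kappa> n s)) \<longlonglongrightarrow> coulomb s"
      unfolding coulomb_pos[OF s] \<kappa>_def using s by (intro tendsto_ennrealI) simp
    show "coulomb s < \<infinity>" by (simp add: coulomb_pos[OF s])
  qed auto
qed

text \<open>The continuous approximants are cut in height and support, so that both norms converge
  by dominated convergence; for the energy lower semicontinuity suffices.\<close>

lemma sharp_inequality_bounded:
  assumes [measurable]: "f \<in> borel_measurable borel" and f: "\<And>x. 0 \<le> f x" "\<And>x. f x \<le> C" and supp: "\<And>x. R < norm x \<Longrightarrow> f x = 0"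
  shows "riesz coulomb f \<le> sharp_bound f"
proof -
  obtain g :: "nat \<Rightarrow> r4 \<Rightarrow> real"
    where g: "\<And>n. continuous_on UNIV (g n)" "AE x in lborel. (\<lambda>n. g n x) \<longlonglongrightarrow> f x"
    using borel_AE_limit_of_continuous[OF assms(1)] by blast
  have C: "0 \<le> C" using f[of 0] by simp
  define cut :: "r4 \<Rightarrow> real" where "cut x = max 0 (min 1 (R + 1 - norm x))" for x
  define F where "F n x = min C (max 0 (g n x)) * cut x" for n x
  have cut: "0 \<le> cut x" "cut x \<le> 1" "R + 1 < norm x \<Longrightarrow> cut x = 0" "norm x \<le> R \<Longrightarrow> cut x = 1" for x
    by (auto simp: cut_def)
  have Fcont: "continuous_on UNIV (F n)" for n
    unfolding F_def cut_def by (intro continuous_intros g)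
  then have [measurable]: "F n \<in> borel_measurable borel" for n by (rule borel_measurable_continuous_onI)
  have F0: "0 \<le> F n x" for n x using C cut[of x] by (simp add: F_def)
  have Fsupp: "R + 1 < norm x \<Longrightarrow> F n x = 0" for n x using cut[of x] by (simp add: F_def)
  have FC: "F n x \<le> C" for n x
    using mult_mono[of "min C (max 0 (g n x))" C "cut x" 1] C cut[of x] by (simp add: F_def)
  have conv: "AE x in lborel. (\<lambda>n. F n x) \<longlonglongrightarrow> f x"
    using g(2)
  proof eventually_elim
    case (elim x)
    have "(\<lambda>n. F n x) \<longlonglongrightarrow> min C (max 0 (f x)) * cut x"
      unfolding F_def by (intro tendsto_intros tendsto_min tendsto_max elim)
    moreover have "min C (max 0 (f x)) * cut x = f x"
      using f[of x] supp[of x] cut[of x] C by (cases "norm x \<le> R") auto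
    ultimately show ?case by simp
  qed
  have [measurable]: "cball (0 :: r4) (R + 1) \<in> sets borel" by simp
  have cfin: "emeasure lborel (cball (0 :: r4) (R + 1)) < top"
    using emeasure_lborel_cball_finite[of "0 :: r4" "R + 1"] by simp
  have dc: "(\<lambda>n. \<integral>\<^sup>+x. ennreal (w (F n x)) \<partial>lborel) \<longlonglongrightarrow> (\<integral>\<^sup>+x. ennreal (w (f x)) \<partial>lborel)"
    and dcfin: "(\<integral>\<^sup>+x. ennreal (w (f x)) \<partial>lborel) < top"
    if w: "continuous_on UNIV w" "w 0 = 0" "\<And>z. 0 \<le> z \<Longrightarrow> z \<le> C \<Longrightarrow> w z \<le> D" "0 \<le> D" for w D
  proof -
    have [measurable]: "w \<in> borel_measurable borel" using w(1) by (rule borel_measurable_continuous_onI)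
    let ?d = "\<lambda>x :: r4. ennreal D * indicator (cball 0 (R + 1)) x"
    have dfin: "(\<integral>\<^sup>+x. ?d x \<partial>lborel) < \<infinity>"
      using cfin by (subst nn_integral_cmult_indicator) (auto simp: ennreal_mult_less_top)
    have le: "ennreal (w z) \<le> ?d x" if "0 \<le> z" "z \<le> C" "R + 1 < norm x \<Longrightarrow> z = 0" for x z
      using that w by (cases "norm x \<le> R + 1") (auto simp: indicator_def intro!: ennreal_leI)
    show "(\<lambda>n. \<integral>\<^sup>+x. ennreal (w (F n x)) \<partial>lborel) \<longlonglongrightarrow> (\<integral>\<^sup>+x. ennreal (w (f x)) \<partial>lborel)"
    proof (rule nn_integral_dominated_convergence[where w="?d"])
      show "AE x in lborel. ennreal (w (F n x)) \<le> ?d x" for n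
        by (intro AE_I2 le F0 FC) (rule Fsupp)
      show "AE x in lborel. (\<lambda>n. ennreal (w (F n x))) \<longlonglongrightarrow> ennreal (w (f x))"
        using conv by eventually_elim (intro tendsto_ennrealI continuous_on_tendsto_compose[OF w(1)], auto)
      show "?d \<in> borel_measurable lborel" by measurable
    qed (use dfin in auto)
    have "(\<integral>\<^sup>+x. ennreal (w (f x)) \<partial>lborel) \<le> (\<integral>\<^sup>+x. ?d x \<partial>lborel)"
      by (intro nn_integral_mono le f) (auto intro: supp)
    then show "(\<integral>\<^sup>+x. ennreal (w (f x)) \<partial>lborel) < top" using dfin by simp
  qed
  have l1: "(\<lambda>n. \<integral>\<^sup>+x. ennreal (F n x) \<partial>lborel) \<longlonglongrightarrow> (\<integral>\<^sup>+x. ennreal (f x) \<partial>lborel)" "(\<integral>\<^sup>+x. ennreal (f x) \<partial>lborel) < top"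
    using dc[of "\<lambda>z. z" C] dcfin[of "\<lambda>z. z" C] C by auto
  have l2: "(\<lambda>n. \<integral>\<^sup>+x. ennreal ((F n x)\<^sup>2) \<partial>lborel) \<longlonglongrightarrow> (\<integral>\<^sup>+x. ennreal ((f x)\<^sup>2) \<partial>lborel)"
  proof -
    have c2: "continuous_on UNIV (\<lambda>z::real. z\<^sup>2)" by (intro continuous_intros)
    show ?thesis by (rule dc[OF c2, of "C\<^sup>2"]) (auto intro: power_mono)
  qed
  have "(\<lambda>n. sharp_bound (F n)) \<longlonglongrightarrow> sharp_bound f"
    unfolding sharp_bound_def power2_eq_square[of "integral\<^sup>N _ _"]
    by (intro tendsto_add ennreal_tendsto_cmult tendsto_mult_ennreal l1 l2) (use l1(2) in auto)
  then show ?thesis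
    by (intro riesz_fatou[OF _ _ _ _ conv, where K="\<lambda>n. coulomb" and B="\<lambda>n. sharp_bound (F n)"]
        sharp_inequality_continuous[OF Fcont F0 Fsupp]) (auto simp: coulomb_pos)
qed

text \<open>Truncation in height and support converges to \<open>f\<close> from below and the bound
  is monotone in the function, so only the energy has to pass to a limit.\<close>

theorem sharp_inequality:
  assumes [measurable]: "f \<in> borel_measurable borel" and f: "\<And>x. 0 \<le> f x"
  shows "riesz coulomb f \<le> sharp_bound f"
proof -
  define F where "F n x = min (f x) (real n) * indicator (cball 0 (real n)) x" for n x
  have [measurable]: "cball (0 :: r4) (real n) \<in> sets borel" for n by simp
  have [measurable]: "F n \<in> borel_measurable borel" for n unfolding F_def[abs_def] by measurable
  have F: "0 \<le> F n x" "F n x \<le> f x" "F n x \<le> real n" "real n < norm x \<Longrightarrow> F n x = 0" for n x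
    using f[of x] by (auto simp: F_def indicator_def)
  have conv: "(\<lambda>n. F n x) \<longlonglongrightarrow> f x" for x
  proof -
    obtain N where N: "max (f x) (norm x) \<le> real N" using real_arch_simple by blast
    have "eventually (\<lambda>n. f x = F n x) sequentially"
      using eventually_ge_at_top[of N]
    proof eventually_elim
      case (elim n)
      then have "max (f x) (norm x) \<le> real n" using N by (meson of_nat_le_iff order_trans)
      then show ?case by (simp add: F_def)
    qed
    then show ?thesis by (rule Lim_transform_eventually[OF tendsto_const])
  qed
  have "riesz coulomb (F n) \<le> sharp_bound f" for n
  proof -
    have "riesz coulomb (F n) \<le> sharp_bound (F n)"
      by (rule sharp_inequality_bounded[OF _ F(1,3,4)]) measurable
    also have "\<dots> \<le> sharp_bound f"
      unfolding sharp_bound_def using F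
      by (intro add_mono mult_left_mono power_mono nn_integral_mono ennreal_leI) auto
    finally show ?thesis .
  qed
  then show ?thesis
    by (intro riesz_fatou[where F=F and f=f and K="\<lambda>n. coulomb" and B="\<lambda>n. sharp_bound f"])
      (auto simp: coulomb_pos conv)
qed

end

section \<open>Extremal functions\<close>

lemma riesz_translate:
  fixes f :: "'a::euclidean_space \<Rightarrow> real"
  assumes [measurable]: "f \<in> borel_measurable borel" "k \<in> borel_measurable borel"
  shows "riesz k (\<lambda>x. f (x + a)) = riesz k f"
proof -
  have inner: "(\<integral>\<^sup>+y. k ((dist x y)\<^sup>2) * ennreal (f (x + a) * f (y + a)) \<partial>lborel)
    = (\<integral>\<^sup>+y. k ((dist (x + a) y)\<^sup>2) * ennreal (f (x + a) * f y) \<partial>lborel)" for x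
    using nn_integral_lborel_translate[of "\<lambda>y. k ((dist (x + a) y)\<^sup>2) * ennreal (f (x + a) * f y)" a]
    by simp
  show ?thesis
    unfolding riesz_def inner
    by (rule nn_integral_lborel_translate[of "\<lambda>x. \<integral>\<^sup>+y. k ((dist x y)\<^sup>2) * ennreal (f x * f y) \<partial>lborel"]) measurable
qed

lemma AE_fst_neq: "AE z in lborel. fst (z :: real \<times> 'a::euclidean_space) \<noteq> t"
proof -
  have [measurable]: "{z :: real \<times> 'a. fst z = t} \<in> sets borel" by measurable
  have "(\<integral>\<^sup>+z. indicator {z :: real \<times> 'a. fst z = t} z \<partial>lborel)
    = (\<integral>\<^sup>+s. \<integral>\<^sup>+y. indicator {z :: real \<times> 'a. fst z = t} (s, y) \<partial>lborel \<partial>lborel)"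
    by (rule nn_integral_lborel_prod) measurable
  also have "\<dots> = (\<integral>\<^sup>+s. 0 \<partial>(lborel :: real measure))"
  proof (rule nn_integral_cong_AE)
    have "AE s in lborel. s \<noteq> t" by (rule AE_lborel_singleton)
    then show "AE s in lborel. (\<integral>\<^sup>+y. indicator {z :: real \<times> 'a. fst z = t} (s, y) \<partial>lborel) = 0"
      by eventually_elim (simp add: indicator_def)
  qed
  finally have "(\<integral>\<^sup>+z. indicator {z :: real \<times> 'a. fst z = t} z \<partial>lborel) = 0" by simp
  then have "AE z in lborel. indicator {z :: real \<times> 'a. fst z = t} z = (0::ennreal)"
    by (subst (asm) nn_integral_0_iff_AE) auto
  then show ?thesis by eventually_elim (auto simp: indicator_def)
qed

text \<open>The mass to the left of \<open>t\<close> depends continuously on \<open>t\<close>, since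
  hyperplanes orthogonal to the axis are null sets, and it runs from zero to the total mass; the
  intermediate value theorem finds half of it.\<close>

lemma exists_median:
  fixes f :: "real \<times> 'a::euclidean_space \<Rightarrow> real"
  assumes [measurable]: "f \<in> borel_measurable borel" and f: "\<And>x. 0 \<le> f x"
    and fin: "(\<integral>\<^sup>+x. ennreal (f x) \<partial>lborel) < \<infinity>"
  shows "\<exists>t. (\<integral>\<^sup>+x. ennreal (f x) * indicator {x. fst x < t} x \<partial>lborel)
    = (\<integral>\<^sup>+x. ennreal (f x) * indicator {x. t < fst x} x \<partial>lborel)"
proof -
  define \<Phi> where "\<Phi> t = (\<integral>x. f x * indicator {x. fst x < t} x \<partial>lborel)" for t
  define m where "m = (\<integral>x. f x \<partial>lborel)"
  have int: "integrable lborel f"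
    using fin f by (intro integrableI_nonneg) auto
  have intI: "integrable lborel (\<lambda>x. f x * indicator S x)" if [measurable]: "S \<in> sets borel" for S
    by (rule Bochner_Integration.integrable_bound[OF int]) (use f in \<open>auto simp: indicator_def\<close>)
  have conv: "(\<lambda>n. \<Phi> (X n)) \<longlonglongrightarrow> (\<integral>x. f x * indicator S x \<partial>lborel)"
    if [measurable]: "S \<in> sets borel"
      and X: "AE x in lborel. eventually (\<lambda>n. fst x < X n \<longleftrightarrow> x \<in> S) sequentially" for X S
    unfolding \<Phi>_def
  proof (rule integral_dominated_convergence[where w=f])
    show "AE x in lborel. (\<lambda>n. f x * indicator {x. fst x < X n} x) \<longlonglongrightarrow> f x * indicator S x"
      using X
    proof eventually_elim
      case (elim x)
      then have "eventually (\<lambda>n. f x * indicator S x = f x * indicator {x. fst x < X n} x) sequentially"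
        by eventually_elim (auto simp: indicator_def)
      then show ?case by (rule Lim_transform_eventually[OF tendsto_const])
    qed
  qed (use int f in \<open>auto simp: indicator_def\<close>)
  have cont: "isCont \<Phi> t" for t
    unfolding continuous_at_sequentially
  proof (intro allI impI)
    fix X assume X: "X \<longlonglongrightarrow> t"
    show "(\<Phi> \<circ> X) \<longlonglongrightarrow> \<Phi> t"
      unfolding o_def \<Phi>_def[of t]
    proof (rule conv)
      show "AE x in lborel. eventually (\<lambda>n. fst x < X n \<longleftrightarrow> x \<in> {x. fst x < t}) sequentially"
        using AE_fst_neq[of t]
      proof eventually_elim
        case (elim x)
        show ?case
        proof (cases "fst x < t")
          case True
          from order_tendstoD(1)[OF X this] show ?thesis by eventually_elim (use True in auto)
        next
          case False
          then have "t < fst x" using elim by simp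
          from order_tendstoD(2)[OF X this] show ?thesis by eventually_elim (use False in auto)
        qed
      qed
    qed measurable
  qed
  have up: "(\<lambda>n. \<Phi> (real n)) \<longlonglongrightarrow> m"
  proof -
    have "(\<lambda>n. \<Phi> (real n)) \<longlonglongrightarrow> (\<integral>x. f x * indicator UNIV x \<partial>lborel)"
    proof (rule conv)
      show "AE x in (lborel :: (real \<times> 'a) measure). eventually (\<lambda>n. fst x < real n \<longleftrightarrow> x \<in> UNIV) sequentially"
      proof (rule AE_I2)
        fix x :: "real \<times> 'a"
        obtain N where N: "fst x < real N" using reals_Archimedean2 by blast
        show "eventually (\<lambda>n. fst x < real n \<longleftrightarrow> x \<in> UNIV) sequentially"
          using eventually_ge_at_top[of N] by eventually_elim (use N in auto)
      qed
    qed simp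
    then show ?thesis by (simp add: m_def)
  qed
  have down: "(\<lambda>n. \<Phi> (- real n)) \<longlonglongrightarrow> 0"
  proof -
    have "(\<lambda>n. \<Phi> (- real n)) \<longlonglongrightarrow> (\<integral>x. f x * indicator {} x \<partial>lborel)"
    proof (rule conv)
      show "AE x in (lborel :: (real \<times> 'a) measure). eventually (\<lambda>n. fst x < - real n \<longleftrightarrow> x \<in> {}) sequentially"
      proof (rule AE_I2)
        fix x :: "real \<times> 'a"
        obtain N where N: "- fst x < real N" using reals_Archimedean2 by blast
        show "eventually (\<lambda>n. fst x < - real n \<longleftrightarrow> x \<in> {}) sequentially"
          using eventually_ge_at_top[of N] by eventually_elim (use N in auto)
      qed
    qed simp
    then show ?thesis by simp
  qed
  have m0: "0 \<le> m" unfolding m_def using f by (intro integral_nonneg_AE) auto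
  have "\<exists>t. \<Phi> t = m / 2"
  proof (cases "m = 0")
    case True
    have "\<Phi> 0 \<le> m" "0 \<le> \<Phi> 0"
      unfolding \<Phi>_def m_def using f int intI[of "{x. fst x < 0}"]
      by (auto intro!: integral_mono integral_nonneg_AE simp: indicator_def)
    then show ?thesis using True by auto
  next
    case False
    then have m: "0 < m" using m0 by simp
    have "eventually (\<lambda>n. m / 2 < \<Phi> (real n) \<and> \<Phi> (- real n) < m / 2) sequentially"
      using order_tendstoD(1)[OF up, of "m / 2"] order_tendstoD(2)[OF down, of "m / 2"] m by (auto simp: eventually_conj_iff)
    then obtain n where n: "m / 2 < \<Phi> (real n)" "\<Phi> (- real n) < m / 2"
      using eventually_happens[of _ sequentially] by auto
    have "\<exists>x. - real n \<le> x \<and> x \<le> real n \<and> \<Phi> x = m / 2"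
      by (rule IVT) (use n cont in auto)
    then show ?thesis by blast
  qed
  then obtain t where t: "\<Phi> t = m / 2" by blast
  have "m = (\<integral>x. f x * indicator {x. fst x < t} x + f x * indicator {x. t < fst x} x \<partial>lborel)"
    unfolding m_def
  proof (rule integral_cong_AE)
    show "AE x in lborel. f x = f x * indicator {x. fst x < t} x + f x * indicator {x. t < fst x} x"
      using AE_fst_neq[of t] by eventually_elim (auto simp: indicator_def)
  qed auto
  also have "\<dots> = \<Phi> t + (\<integral>x. f x * indicator {x. t < fst x} x \<partial>lborel)"
    unfolding \<Phi>_def by (intro Bochner_Integration.integral_add intI) measurable
  finally have "(\<integral>x. f x * indicator {x. t < fst x} x \<partial>lborel) = \<Phi> t" using t by simp
  moreover have "(\<integral>\<^sup>+x. ennreal (f x) * indicator S x \<partial>lborel) = ennreal (\<integral>x. f x * indicator S x \<partial>lborel)"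
    if [measurable]: "S \<in> sets borel" for S
  proof -
    have "(\<integral>\<^sup>+x. ennreal (f x) * indicator S x \<partial>lborel) = (\<integral>\<^sup>+x. ennreal (f x * indicator S x) \<partial>lborel)"
      by (intro nn_integral_cong) (auto simp: indicator_def)
    then show ?thesis using nn_integral_eq_integral[OF intI[OF that]] f by simp
  qed
  ultimately show ?thesis by (intro exI[of _ t]) (simp add: \<Phi>_def)
qed

section \<open>Potentials and radial averages\<close>

definition potential :: "(r4 \<Rightarrow> real) \<Rightarrow> r4 \<Rightarrow> ennreal" where
  "potential f x = (\<integral>\<^sup>+y. coulomb ((dist x y)\<^sup>2) * ennreal (f y) \<partial>lborel)"

lemma potential_measurable [measurable]:
  assumes [measurable]: "f \<in> borel_measurable borel"
  shows "potential f \<in> borel_measurable borel"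
  unfolding potential_def[abs_def] by measurable

lemma riesz_coulomb_potential:
  assumes [measurable]: "f \<in> borel_measurable borel" and f: "\<And>x. 0 \<le> f x"
  shows "riesz coulomb f = (\<integral>\<^sup>+x. ennreal (f x) * potential f x \<partial>lborel)"
  unfolding riesz_def potential_def
  by (intro nn_integral_cong) (simp add: nn_integral_cmult[symmetric] ennreal_mult f mult_ac)

lemma potential_swap:
  assumes [measurable]: "f \<in> borel_measurable borel" "g \<in> borel_measurable borel"
  shows "(\<integral>\<^sup>+x. ennreal (g x) * potential f x \<partial>lborel) = (\<integral>\<^sup>+y. ennreal (f y) * potential g y \<partial>lborel)"
proof -
  have "(\<integral>\<^sup>+x. ennreal (g x) * potential f x \<partial>lborel)
    = (\<integral>\<^sup>+x. \<integral>\<^sup>+y. ennreal (g x) * (coulomb ((dist x y)\<^sup>2) * ennreal (f y)) \<partial>lborel \<partial>lborel)"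
    unfolding potential_def by (intro nn_integral_cong nn_integral_cmult[symmetric]) measurable
  also have "\<dots> = (\<integral>\<^sup>+y. \<integral>\<^sup>+x. ennreal (g x) * (coulomb ((dist x y)\<^sup>2) * ennreal (f y)) \<partial>lborel \<partial>lborel)"
    by (rule lborel_pair.Fubini') measurable
  also have "\<dots> = (\<integral>\<^sup>+y. \<integral>\<^sup>+x. ennreal (f y) * (coulomb ((dist y x)\<^sup>2) * ennreal (g x)) \<partial>lborel \<partial>lborel)"
    by (intro nn_integral_cong) (simp add: dist_commute mult_ac)
  also have "\<dots> = (\<integral>\<^sup>+y. ennreal (f y) * potential g y \<partial>lborel)"
    unfolding potential_def by (intro nn_integral_cong nn_integral_cmult) measurable
  finally show ?thesis .
qed

text \<open>A mirror through the origin exchanges \<open>x\<close> and \<open>x'\<close>. Invariance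
  of \<open>f\<close> holds only almost everywhere for each mirror, but integration removes the null
  set, so the potential agrees at every pair of points of equal norm.\<close>

lemma potential_radial:
  assumes [measurable]: "f \<in> borel_measurable borel"
    and inv: "\<And>v. v \<noteq> 0 \<Longrightarrow> AE x in lborel. f (hrefl v 0 x) = f x" and eq: "norm x = norm x'"
  shows "potential f x = potential f x'"
proof (cases "x = x'")
  case False
  define v where "v = x' - x"
  have v: "v \<noteq> 0" using False by (simp add: v_def)
  have "(x' \<bullet> x' - x \<bullet> x) / 2 = 0" using eq by (simp add: norm_eq_sqrt_inner)
  with exists_hrefl[OF False] have x': "hrefl v 0 x = x'" by (simp add: v_def)
  have "potential f x' = (\<integral>\<^sup>+y. coulomb ((dist x (hrefl v 0 y))\<^sup>2) * ennreal (f y) \<partial>lborel)"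
    unfolding potential_def x'[symmetric] dist_hrefl_commute[OF v] ..
  also have "\<dots> = (\<integral>\<^sup>+y. coulomb ((dist x (hrefl v 0 (hrefl v 0 y)))\<^sup>2) * ennreal (f (hrefl v 0 y)) \<partial>lborel)"
    by (rule nn_integral_hrefl[OF v, of "\<lambda>y. coulomb ((dist x (hrefl v 0 y))\<^sup>2) * ennreal (f y)", symmetric]) measurable
  also have "\<dots> = potential f x"
    unfolding potential_def
  proof (rule nn_integral_cong_AE)
    show "AE y in lborel. coulomb ((dist x (hrefl v 0 (hrefl v 0 y)))\<^sup>2) * ennreal (f (hrefl v 0 y))
        = coulomb ((dist x y)\<^sup>2) * ennreal (f y)"
      using inv[OF v] by eventually_elim (simp add: v)
  qed
  finally show ?thesis by simp
qed simp

text \<open>The radial conditional expectation of \<open>f\<close>, obtained as a Radon--Nikodym density of the law of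
  \<open>(norm x)\<^sup>2\<close> under \<open>f\<close>.\<close>

lemma radial_average:
  fixes f :: "r4 \<Rightarrow> real"
  assumes [measurable]: "f \<in> borel_measurable borel" and f: "\<And>x. 0 \<le> f x"
    and fin: "(\<integral>\<^sup>+x. ennreal (f x) \<partial>lborel) < \<infinity>"
  obtains h :: "real \<Rightarrow> real" where "h \<in> borel_measurable borel" "\<And>v. 0 \<le> h v"
    "\<And>\<phi>. \<phi> \<in> borel_measurable borel \<Longrightarrow>
      (\<integral>\<^sup>+x. \<phi> ((norm x)\<^sup>2) * ennreal (f x) \<partial>lborel) = (\<integral>\<^sup>+x. \<phi> ((norm x)\<^sup>2) * ennreal (h ((norm (x :: r4))\<^sup>2)) \<partial>lborel)"
proof -
  define D where "D = density lborel (\<lambda>x. ennreal (f x))"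
  define \<nu> where "\<nu> = distr D borel (\<lambda>x. (norm x)\<^sup>2)"
  have sD[measurable_cong]: "sets D = sets borel" by (simp add: D_def)
  have int\<nu>: "(\<integral>\<^sup>+v. \<phi> v \<partial>\<nu>) = (\<integral>\<^sup>+x. \<phi> ((norm x)\<^sup>2) * ennreal (f x) \<partial>lborel)"
    if [measurable]: "\<phi> \<in> borel_measurable borel" for \<phi>
  proof -
    have "(\<integral>\<^sup>+v. \<phi> v \<partial>\<nu>) = (\<integral>\<^sup>+x. \<phi> ((norm x)\<^sup>2) \<partial>D)"
      unfolding \<nu>_def by (rule nn_integral_distr) measurable
    also have "\<dots> = (\<integral>\<^sup>+x. ennreal (f x) * \<phi> ((norm x)\<^sup>2) \<partial>lborel)"
      unfolding D_def by (rule nn_integral_density) measurable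
    finally show ?thesis by (simp add: mult.commute)
  qed
  have "absolutely_continuous lborel \<nu>"
    unfolding absolutely_continuous_def
  proof
    fix N assume N: "N \<in> null_sets (lborel :: real measure)"
    then have [measurable]: "N \<in> sets borel" by auto
    have "(\<integral>\<^sup>+x. indicator N ((norm (x :: r4))\<^sup>2) \<partial>lborel) = (\<integral>\<^sup>+v. ennreal (radial_density DIM(r4) v) * indicator N v \<partial>lborel)"
      by (rule nn_integral_norm_square) measurable
    also have "\<dots> = (\<integral>\<^sup>+v. 0 \<partial>(lborel :: real measure))"
      by (rule nn_integral_cong_AE) (use AE_not_in[OF N] in \<open>eventually_elim, auto simp: indicator_def\<close>)
    finally have "(\<integral>\<^sup>+x. indicator N ((norm (x :: r4))\<^sup>2) \<partial>lborel) = 0" by simp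
    then have "AE x in lborel. indicator N ((norm (x :: r4))\<^sup>2) = (0 :: ennreal)"
      by (subst (asm) nn_integral_0_iff_AE) auto
    then have "AE x in lborel. indicator N ((norm x)\<^sup>2) * ennreal (f x) = 0" by eventually_elim simp
    then have "(\<integral>\<^sup>+x. indicator N ((norm x)\<^sup>2) * ennreal (f x) \<partial>lborel) = (\<integral>\<^sup>+x. 0 \<partial>(lborel :: r4 measure))"
      by (rule nn_integral_cong_AE)
    then have "(\<integral>\<^sup>+v. indicator N v \<partial>\<nu>) = 0" by (subst int\<nu>) simp_all
    then show "N \<in> null_sets \<nu>" by (auto simp: null_sets_def \<nu>_def)
  qed
  from sigma_finite_measure.Radon_Nikodym[OF sigma_finite_lborel this] obtain H where [measurable]: "H \<in> borel_measurable borel"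
    and H: "density lborel H = \<nu>" by (auto simp: \<nu>_def)
  have intH: "(\<integral>\<^sup>+v. H v * \<phi> v \<partial>lborel) = (\<integral>\<^sup>+x. \<phi> ((norm x)\<^sup>2) * ennreal (f x) \<partial>lborel)"
    if [measurable]: "\<phi> \<in> borel_measurable borel" for \<phi>
    unfolding int\<nu>[OF that, symmetric] H[symmetric] by (rule nn_integral_density[symmetric]) measurable
  have "(\<integral>\<^sup>+v. H v \<partial>lborel) < \<infinity>" using intH[of "\<lambda>_. 1"] fin by simp
  then have Hfin: "AE v in lborel. H v \<noteq> \<infinity>" by (intro nn_integral_noteq_infinite) auto
  have "(\<integral>\<^sup>+x. indicator {..0::real} ((norm x)\<^sup>2) * ennreal (f x) \<partial>lborel) = (\<integral>\<^sup>+x. 0 \<partial>(lborel :: r4 measure))"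
    by (rule nn_integral_cong_AE) (use AE_lborel_singleton[of "0 :: r4"] in \<open>eventually_elim, auto simp: indicator_def\<close>)
  then have "(\<integral>\<^sup>+v. H v * indicator {..0} v \<partial>lborel) = 0" by (subst intH) simp_all
  then have H0: "AE v in lborel. H v * indicator {..0} v = 0" by (subst (asm) nn_integral_0_iff_AE) auto
  \<comment> \<open>\<open>H\<close> is a density in the variable \<open>v\<close>; division by
    \<open>radial_density 4\<close> turns it into a profile on the four-dimensional space.\<close>
  define h where "h v = (if 0 < v then enn2real (H v) / (pi\<^sup>2 * v) else 0)" for v
  have hm[measurable]: "h \<in> borel_measurable borel" unfolding h_def[abs_def] by measurable
  have h0: "0 \<le> h v" for v by (simp add: h_def)
  show ?thesis
  proof (rule that[OF hm h0])
    fix \<phi> :: "real \<Rightarrow> ennreal" assume [measurable]: "\<phi> \<in> borel_measurable borel"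
    have "(\<integral>\<^sup>+x. \<phi> ((norm x)\<^sup>2) * ennreal (h ((norm (x :: r4))\<^sup>2)) \<partial>lborel)
      = (\<integral>\<^sup>+v. ennreal (radial_density DIM(r4) v) * (\<phi> v * ennreal (h v)) \<partial>lborel)"
      by (rule nn_integral_norm_square) measurable
    also have "\<dots> = (\<integral>\<^sup>+v. H v * \<phi> v \<partial>lborel)"
    proof (rule nn_integral_cong_AE)
      show "AE v in lborel. ennreal (radial_density DIM(r4) v) * (\<phi> v * ennreal (h v)) = H v * \<phi> v"
        unfolding DIM_4 using Hfin H0
      proof eventually_elim
        case (elim v)
        show ?case
        proof (cases "0 < v")
          case True
          have "ennreal (radial_density 4 v) * ennreal (h v) = H v"
            using True elim(1) by (simp add: radial_density_4 h_def ennreal_mult[symmetric] less_top)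
          then show ?thesis by (simp add: mult_ac)
        next
          case False
          then show ?thesis using elim(2) by (simp add: radial_density_4)
        qed
      qed
    qed
    also have "\<dots> = (\<integral>\<^sup>+x. \<phi> ((norm x)\<^sup>2) * ennreal (f x) \<partial>lborel)" by (rule intH) measurable
    finally show "(\<integral>\<^sup>+x. \<phi> ((norm x)\<^sup>2) * ennreal (f x) \<partial>lborel)
      = (\<integral>\<^sup>+x. \<phi> ((norm x)\<^sup>2) * ennreal (h ((norm (x :: r4))\<^sup>2)) \<partial>lborel)" by simp
  qed
qed

lemma riesz_cong_AE:
  assumes fg: "AE x in lborel. f x = g x"
  shows "riesz k f = riesz k g"
  unfolding riesz_def
proof (rule nn_integral_cong_AE)
  show "AE x in lborel. (\<integral>\<^sup>+y. k ((dist x y)\<^sup>2) * ennreal (f x * f y) \<partial>lborel)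
    = (\<integral>\<^sup>+y. k ((dist x y)\<^sup>2) * ennreal (g x * g y) \<partial>lborel)"
    using fg
  proof eventually_elim
    case (elim x)
    have "AE y in lborel. k ((dist x y)\<^sup>2) * ennreal (f x * f y) = k ((dist x y)\<^sup>2) * ennreal (g x * g y)"
      using fg by eventually_elim (simp add: elim)
    then show ?case by (rule nn_integral_cong_AE)
  qed
qed

context hardy_profile
begin

lemma sharp_bound_cong_AE:
  assumes fg: "AE x in lborel. f x = g x"
  shows "sharp_bound f = sharp_bound g"
proof -
  have "(\<integral>\<^sup>+x. ennreal (f x) \<partial>lborel) = (\<integral>\<^sup>+x. ennreal (g x) \<partial>lborel)"
    by (rule nn_integral_cong_AE) (use fg in \<open>eventually_elim, simp\<close>)
  moreover have "(\<integral>\<^sup>+x. ennreal ((f x)\<^sup>2) \<partial>lborel) = (\<integral>\<^sup>+x. ennreal ((g x)\<^sup>2) \<partial>lborel)"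
    by (rule nn_integral_cong_AE) (use fg in \<open>eventually_elim, simp\<close>)
  ultimately show ?thesis by (simp add: sharp_bound_def)
qed

text \<open>Together with \<open>sharp_inequality\<close> this is equality in the bound; the energy
  is finite so that energies can be cancelled.\<close>

definition extremal :: "(r4 \<Rightarrow> real) \<Rightarrow> bool" where
  "extremal f \<longleftrightarrow> f \<in> borel_measurable borel \<and> (\<forall>x. 0 \<le> f x) \<and> sharp_bound f \<le> riesz coulomb f \<and> riesz coulomb f < \<infinity>"

lemma extremal_finite:
  assumes "extremal f"
  shows "(\<integral>\<^sup>+x. ennreal (f x) \<partial>lborel) < \<infinity>" "(\<integral>\<^sup>+x. ennreal ((f x)\<^sup>2) \<partial>lborel) < \<infinity>"
proof -
  have "sharp_bound f < top" using assms le_less_trans by (auto simp: extremal_def)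
  then show "(\<integral>\<^sup>+x. ennreal (f x) \<partial>lborel) < \<infinity>" "(\<integral>\<^sup>+x. ennreal ((f x)\<^sup>2) \<partial>lborel) < \<infinity>"
    using A c by (auto simp: sharp_bound_def ennreal_mult_less_top power2_eq_square)
qed

text \<open>A polarized function has the same norms, so the sharp inequality keeps its energy from
  exceeding that of the extremal \<open>f\<close>. Polarization therefore leaves the energy
  unchanged, and this carries over to the regular summand of a splitting of the kernel, to which the
  strict comparison applies.\<close>

lemma extremal_sign:
  assumes ex: "extremal f" and v: "v \<noteq> 0"
  shows "AE x in lborel. AE y in lborel. v \<bullet> x < d \<longrightarrow> v \<bullet> y < d \<longrightarrow>
    0 \<le> (f x - f (hrefl v d x)) * (f y - f (hrefl v d y))"
proof -
  have [measurable]: "f \<in> borel_measurable borel" and f: "\<And>x. 0 \<le> f x" using ex by (auto simp: extremal_def)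
  let ?p = "polarize v d f"
  \<comment> \<open>The splitting is 1 / s = 1 / (s + 1) + 1 / (s (s + 1)). The first summand is
    finite and strictly decreasing, as \<open>polarize_equality\<close> requires; the second is
    decreasing and absorbs the singularity.\<close>
  define \<kappa> where "\<kappa> s = 1 / (\<bar>s\<bar> + 1)" for s :: real
  define k2 where "k2 s = inverse (ennreal (s * (s + 1)))" for s :: real
  have [measurable]: "\<kappa> \<in> borel_measurable borel" "k2 \<in> borel_measurable borel"
    unfolding \<kappa>_def[abs_def] k2_def[abs_def] by measurable
  have split: "coulomb s = ennreal (\<kappa> s) + k2 s" if "0 \<le> s" for s
  proof (cases "s = 0")
    case True then show ?thesis by (simp add: coulomb_def k2_def)
  next
    case False
    then have s: "0 < s" using that by simp
    have "1 / s = 1 / (s + 1) + 1 / (s * (s + 1))" using s by (simp add: divide_simps)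
    moreover have "k2 s = ennreal (1 / (s * (s + 1)))"
      using s by (simp add: k2_def inverse_ennreal inverse_eq_divide)
    ultimately show ?thesis using s unfolding coulomb_pos[OF s] \<kappa>_def
      by (simp add: ennreal_plus[symmetric] del: ennreal_plus)
  qed
  have rs: "riesz coulomb u = riesz (\<lambda>s. ennreal (\<kappa> s)) u + riesz k2 u"
    if u[measurable]: "u \<in> borel_measurable borel" for u :: "r4 \<Rightarrow> real"
    unfolding riesz_def by (simp add: split distrib_right nn_integral_add)
  have "riesz coulomb ?p \<le> sharp_bound ?p"
    by (rule sharp_inequality) (auto simp: f polarize_nonneg)
  also have "sharp_bound ?p = sharp_bound f"
    unfolding sharp_bound_def by (simp add: nn_integral_polarize[OF v _ f])
  also have "\<dots> \<le> riesz coulomb f" using ex by (simp add: extremal_def)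
  finally have le: "riesz coulomb ?p \<le> riesz coulomb f" .
  have k2: "riesz k2 f \<le> riesz k2 ?p"
  proof (rule riesz_polarize_le[OF v _ _ f])
    show "k2 t \<le> k2 s" if "0 \<le> s" "s \<le> t" for s t
    proof (cases "s = 0")
      case True then show ?thesis by (simp add: k2_def)
    next
      case False
      then have p: "0 < s * (s + 1)" "s * (s + 1) \<le> t * (t + 1)" using that by (auto intro!: mult_mono mult_pos_pos)
      then have pt: "0 < t * (t + 1)" by linarith
      show ?thesis
        unfolding k2_def inverse_ennreal[OF p(1)] inverse_ennreal[OF pt]
        by (intro ennreal_leI le_imp_inverse_le p)
    qed
  qed auto
  have fin: "riesz coulomb f < top" using ex by (simp add: extremal_def)
  then have fp: "riesz coulomb ?p < top" using le le_less_trans by blast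
  \<comment> \<open>The singular summand does not decrease under polarization, so the regular one
    cannot increase.\<close>
  have "riesz k2 f + riesz (\<lambda>s. ennreal (\<kappa> s)) ?p \<le> riesz (\<lambda>s. ennreal (\<kappa> s)) ?p + riesz k2 ?p"
    using k2 by (subst add.commute) (rule add_left_mono)
  also have "\<dots> = riesz coulomb ?p" by (rule rs[symmetric]) measurable
  also have "\<dots> \<le> riesz coulomb f" by (rule le)
  also have "riesz coulomb f = riesz k2 f + riesz (\<lambda>s. ennreal (\<kappa> s)) f" by (subst rs) (auto simp: add.commute)
  finally have "riesz k2 f + riesz (\<lambda>s. ennreal (\<kappa> s)) ?p \<le> riesz k2 f + riesz (\<lambda>s. ennreal (\<kappa> s)) f" .
  moreover have fin2: "riesz k2 f < top" "riesz (\<lambda>s. ennreal (\<kappa> s)) f < top" using fin rs[of f] by auto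
  ultimately have kle: "riesz (\<lambda>s. ennreal (\<kappa> s)) ?p \<le> riesz (\<lambda>s. ennreal (\<kappa> s)) f"
    by (auto simp: ennreal_add_left_cancel_le)
  show ?thesis
  proof (rule polarize_equality[OF v _ _ f _ _ _ kle])
    show "0 \<le> \<kappa> s" if "0 \<le> s" for s using that by (simp add: \<kappa>_def)
    show "\<kappa> t < \<kappa> s" if "0 \<le> s" "s < t" for s t
      using that by (simp add: \<kappa>_def frac_less2)
  qed (use fin2 in auto)
qed

lemma extremal_reflection:
  assumes ex: "extremal f" and v: "v \<noteq> 0"
    and half: "(\<integral>\<^sup>+x. ennreal (f x) * indicator {x. v \<bullet> x < d} x \<partial>lborel)
      = (\<integral>\<^sup>+x. ennreal (f x) * indicator {x. d < v \<bullet> x} x \<partial>lborel)"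
  shows "AE x in lborel. f (hrefl v d x) = f x"
  using ex by (intro reflection_symmetric[OF v _ _ extremal_sign[OF ex v] extremal_finite(1)[OF ex] half])
    (auto simp: extremal_def)

lemma extremal_translate:
  assumes ex: "extremal f"
  shows "extremal (\<lambda>x. f (x + a))"
proof -
  have [measurable]: "f \<in> borel_measurable borel" using ex by (auto simp: extremal_def)
  have "sharp_bound (\<lambda>x. f (x + a)) = sharp_bound f"
    unfolding sharp_bound_def
    using nn_integral_lborel_translate[of "\<lambda>x. ennreal ((f x)\<^sup>2)" a] nn_integral_lborel_translate[of "\<lambda>x. ennreal (f x)" a]
    by simp
  then show ?thesis using ex riesz_translate[of f coulomb a] by (simp add: extremal_def del: split_paired_All)
qed

text \<open>The exceptional null sets vary with the mirror, hence the detour through the radial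
  average \<open>g\<close>. Potentials of reflection-invariant functions are radial, so
  \<open>f\<close> and \<open>g\<close> have equal energies; they have equal masses; and averaging
  does not increase the square norm. Extremality of \<open>f\<close> then forces equal square norms,
  and for a projection this means that \<open>f\<close> equals \<open>g\<close> almost
  everywhere.\<close>

lemma radial_of_reflection_invariant:
  assumes ex: "extremal f" and inv: "\<And>v. v \<noteq> 0 \<Longrightarrow> AE x in lborel. f (hrefl v 0 x) = f x"
  shows "\<exists>h. h \<in> borel_measurable borel \<and> (\<forall>v. 0 \<le> h v) \<and> (AE x in lborel. f x = h ((norm x)\<^sup>2))"
proof -
  have fm[measurable]: "f \<in> borel_measurable borel" and f: "\<And>x. 0 \<le> f x" using ex by (auto simp: extremal_def)
  note fin = extremal_finite[OF ex]
  obtain h :: "real \<Rightarrow> real" where hm[measurable]: "h \<in> borel_measurable borel" and h: "\<And>v. 0 \<le> h v"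
    and proj: "\<And>\<phi>. \<phi> \<in> borel_measurable borel \<Longrightarrow>
      (\<integral>\<^sup>+x. \<phi> ((norm x)\<^sup>2) * ennreal (f x) \<partial>lborel) = (\<integral>\<^sup>+x. \<phi> ((norm x)\<^sup>2) * ennreal (h ((norm (x :: r4))\<^sup>2)) \<partial>lborel)"
    using radial_average[OF fm f fin(1)] by blast
  define g where "g x = h ((norm x)\<^sup>2)" for x :: r4
  have gm[measurable]: "g \<in> borel_measurable borel" unfolding g_def[abs_def] by measurable
  have g: "0 \<le> g x" for x by (simp add: g_def h)
  have ginv: "g (hrefl v 0 x) = g x" if "v \<noteq> 0" for v x by (simp add: g_def norm_hrefl[OF that])
  have swap: "(\<integral>\<^sup>+x. ennreal (f x) * potential u x \<partial>lborel) = (\<integral>\<^sup>+x. ennreal (g x) * potential u x \<partial>lborel)"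
    if [measurable]: "u \<in> borel_measurable borel" and "\<And>v. v \<noteq> 0 \<Longrightarrow> AE x in lborel. u (hrefl v 0 x) = u x" for u
  proof -
    define p where "p a = potential u (sqrt a, 0)" for a
    have "(\<lambda>a. (sqrt a, 0) :: r4) \<in> borel_measurable borel"
      by (intro borel_measurable_continuous_onI continuous_intros)
    then have [measurable]: "p \<in> borel_measurable borel" unfolding p_def[abs_def] by measurable
    have "potential u x = p ((norm x)\<^sup>2)" for x
      unfolding p_def by (rule potential_radial[OF that]) (simp_all add: norm_Pair)
    then show ?thesis using proj[of p] by (simp add: g_def mult.commute)
  qed
  \<comment> \<open>Against a radial potential \<open>f\<close> may be replaced by its average; the
    symmetry of the kernel allows this in both slots.\<close>
  have "riesz coulomb f = (\<integral>\<^sup>+x. ennreal (g x) * potential f x \<partial>lborel)"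
    unfolding riesz_coulomb_potential[OF fm f] by (rule swap[OF fm inv])
  also have "\<dots> = (\<integral>\<^sup>+x. ennreal (f x) * potential g x \<partial>lborel)" by (rule potential_swap) measurable
  also have "\<dots> = (\<integral>\<^sup>+x. ennreal (g x) * potential g x \<partial>lborel)" by (rule swap[OF gm]) (simp add: ginv)
  also have "\<dots> = riesz coulomb g" by (rule riesz_coulomb_potential[OF gm g, symmetric])
  also have "\<dots> \<le> sharp_bound g" by (rule sharp_inequality[OF gm g])
  finally have "sharp_bound f \<le> sharp_bound g" using ex by (auto simp: extremal_def)
  moreover have m: "(\<integral>\<^sup>+x. ennreal (g x) \<partial>lborel) = (\<integral>\<^sup>+x. ennreal (f x) \<partial>lborel)"
    using proj[of "\<lambda>_. 1"] by (simp add: g_def)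
  ultimately have "ennreal (c * pi\<^sup>2) * (\<integral>\<^sup>+x. ennreal ((f x)\<^sup>2) \<partial>lborel) \<le> ennreal (c * pi\<^sup>2) * (\<integral>\<^sup>+x. ennreal ((g x)\<^sup>2) \<partial>lborel)"
    using fin(1) unfolding sharp_bound_def m add.commute[of "ennreal (c * pi\<^sup>2) * _"]
    by (auto simp: ennreal_add_left_cancel_le ennreal_mult_eq_top_iff power2_eq_square)
  then have sq1: "(\<integral>\<^sup>+x. ennreal ((f x)\<^sup>2) \<partial>lborel) \<le> (\<integral>\<^sup>+x. ennreal ((g x)\<^sup>2) \<partial>lborel)"
    using c by (subst (asm) ennreal_mult_le_mult_iff) auto
  \<comment> \<open>The upper bound for the square norm of \<open>g\<close> comes from cancelling a
    square integral. That of \<open>g\<close> itself is not yet known to be finite, whereas a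
    truncation of the integrable \<open>g\<close> is square integrable.\<close>
  have trunc: "(\<integral>\<^sup>+x. ennreal ((min (g x) (real k))\<^sup>2) \<partial>lborel) \<le> (\<integral>\<^sup>+x. ennreal ((f x)\<^sup>2) \<partial>lborel)" for k
  proof -
    define w where "w x = min (g x) (real k)" for x
    have [measurable]: "w \<in> borel_measurable borel" unfolding w_def[abs_def] by measurable
    have w: "0 \<le> w x" "w x \<le> g x" "w x \<le> real k" for x using g[of x] by (auto simp: w_def)
    have wfin: "(\<integral>\<^sup>+x. ennreal ((w x)\<^sup>2) \<partial>lborel) < top"
    proof -
      have "(\<integral>\<^sup>+x. ennreal ((w x)\<^sup>2) \<partial>lborel) \<le> (\<integral>\<^sup>+x. ennreal (real k) * ennreal (g x) \<partial>lborel)"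
        using w g by (intro nn_integral_mono) (auto simp: ennreal_mult[symmetric] power2_eq_square intro!: ennreal_leI mult_mono)
      also have "\<dots> < top" using fin(1) m by (simp add: nn_integral_cmult ennreal_mult_less_top)
      finally show ?thesis .
    qed
    have "2 * (\<integral>\<^sup>+x. ennreal ((w x)\<^sup>2) \<partial>lborel) \<le> 2 * (\<integral>\<^sup>+x. ennreal (w x) * ennreal (g x) \<partial>lborel)"
      using w g by (intro mult_left_mono nn_integral_mono) (auto simp: ennreal_mult[symmetric] power2_eq_square intro!: ennreal_leI mult_left_mono)
    also have "(\<integral>\<^sup>+x. ennreal (w x) * ennreal (g x) \<partial>lborel) = (\<integral>\<^sup>+x. ennreal (w x) * ennreal (f x) \<partial>lborel)"
      using proj[of "\<lambda>v. ennreal (min (h v) (real k))"] by (simp add: g_def w_def)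
    also have "2 * \<dots> = (\<integral>\<^sup>+x. ennreal (2 * (w x * f x)) \<partial>lborel)"
      using w f by (subst nn_integral_cmult[symmetric]) (auto simp: ennreal_mult intro!: nn_integral_cong)
    also have "\<dots> \<le> (\<integral>\<^sup>+x. ennreal ((w x)\<^sup>2 + (f x)\<^sup>2) \<partial>lborel)"
    proof (intro nn_integral_mono ennreal_leI)
      fix x
      have "0 \<le> (w x - f x)\<^sup>2" by simp
      then show "2 * (w x * f x) \<le> (w x)\<^sup>2 + (f x)\<^sup>2" by (simp add: power2_eq_square algebra_simps)
    qed
    also have "\<dots> = (\<integral>\<^sup>+x. ennreal ((w x)\<^sup>2) \<partial>lborel) + (\<integral>\<^sup>+x. ennreal ((f x)\<^sup>2) \<partial>lborel)"
      by (simp add: nn_integral_add)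
    finally have "(\<integral>\<^sup>+x. ennreal ((w x)\<^sup>2) \<partial>lborel) \<le> (\<integral>\<^sup>+x. ennreal ((f x)\<^sup>2) \<partial>lborel)"
      using wfin by (auto simp: mult_2 ennreal_add_left_cancel_le less_top)
    then show ?thesis by (simp add: w_def)
  qed
  have sq2: "(\<integral>\<^sup>+x. ennreal ((g x)\<^sup>2) \<partial>lborel) \<le> (\<integral>\<^sup>+x. ennreal ((f x)\<^sup>2) \<partial>lborel)"
  proof -
    have "(\<integral>\<^sup>+x. ennreal ((g x)\<^sup>2) \<partial>lborel) = (\<integral>\<^sup>+x. liminf (\<lambda>k. ennreal ((min (g x) (real k))\<^sup>2)) \<partial>lborel)"
    proof (rule nn_integral_cong)
      fix x
      obtain N where N: "g x \<le> real N" using real_arch_simple by blast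
      have "eventually (\<lambda>k. ennreal ((g x)\<^sup>2) = ennreal ((min (g x) (real k))\<^sup>2)) sequentially"
        using eventually_ge_at_top[of N]
      proof eventually_elim
        case (elim k)
        then have "g x \<le> real k" using N by (meson of_nat_le_iff order_trans)
        then show ?case by (simp add: min_def)
      qed
      then have "(\<lambda>k. ennreal ((min (g x) (real k))\<^sup>2)) \<longlonglongrightarrow> ennreal ((g x)\<^sup>2)"
        by (rule Lim_transform_eventually[OF tendsto_const])
      from lim_imp_Liminf[OF _ this] show "ennreal ((g x)\<^sup>2) = liminf (\<lambda>k. ennreal ((min (g x) (real k))\<^sup>2))" by simp
    qed
    also have "\<dots> \<le> liminf (\<lambda>k. \<integral>\<^sup>+x. ennreal ((min (g x) (real k))\<^sup>2) \<partial>lborel)"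
      by (rule nn_integral_liminf) measurable
    also have "\<dots> \<le> liminf (\<lambda>k::nat. \<integral>\<^sup>+x. ennreal ((f x)\<^sup>2) \<partial>lborel)"
      by (rule Liminf_mono) (simp add: trunc)
    also have "\<dots> = (\<integral>\<^sup>+x. ennreal ((f x)\<^sup>2) \<partial>lborel)" by (simp add: Liminf_const)
    finally show ?thesis .
  qed
  have sq: "(\<integral>\<^sup>+x. ennreal ((g x)\<^sup>2) \<partial>lborel) = (\<integral>\<^sup>+x. ennreal ((f x)\<^sup>2) \<partial>lborel)"
    using sq1 sq2 by (rule antisym[rotated])
  have cross: "(\<integral>\<^sup>+x. ennreal (g x) * ennreal (f x) \<partial>lborel) = (\<integral>\<^sup>+x. ennreal ((g x)\<^sup>2) \<partial>lborel)"
    using proj[of "\<lambda>v. ennreal (h v)"] by (simp add: g_def power2_eq_square ennreal_mult h)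
  \<comment> \<open>Pythagoras for the projection, again arranged additively: with equal square
    norms and \<open>cross\<close>, nothing is left for the difference.\<close>
  have "(\<integral>\<^sup>+x. ennreal ((f x - g x)\<^sup>2) \<partial>lborel) + 2 * (\<integral>\<^sup>+x. ennreal ((g x)\<^sup>2) \<partial>lborel)
    = (\<integral>\<^sup>+x. ennreal ((f x - g x)\<^sup>2) + 2 * (ennreal (g x) * ennreal (f x)) \<partial>lborel)"
    by (simp add: nn_integral_add nn_integral_cmult cross)
  also have "\<dots> = (\<integral>\<^sup>+x. ennreal ((f x)\<^sup>2) + ennreal ((g x)\<^sup>2) \<partial>lborel)"
  proof (rule nn_integral_cong)
    fix x
    have "2 * (ennreal (g x) * ennreal (f x)) = ennreal (2 * (g x * f x))" using f g by (simp add: ennreal_mult)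
    moreover have "(f x - g x)\<^sup>2 + 2 * (g x * f x) = (f x)\<^sup>2 + (g x)\<^sup>2" by (simp add: power2_eq_square algebra_simps)
    ultimately show "ennreal ((f x - g x)\<^sup>2) + 2 * (ennreal (g x) * ennreal (f x)) = ennreal ((f x)\<^sup>2) + ennreal ((g x)\<^sup>2)"
      using f g by (simp add: ennreal_plus[symmetric] del: ennreal_plus)
  qed
  also have "\<dots> = 0 + 2 * (\<integral>\<^sup>+x. ennreal ((g x)\<^sup>2) \<partial>lborel)" by (simp add: nn_integral_add sq mult_2)
  finally have "2 * (\<integral>\<^sup>+x. ennreal ((g x)\<^sup>2) \<partial>lborel) + (\<integral>\<^sup>+x. ennreal ((f x - g x)\<^sup>2) \<partial>lborel)
    = 2 * (\<integral>\<^sup>+x. ennreal ((g x)\<^sup>2) \<partial>lborel) + 0" by (simp add: add.commute)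
  then have "(\<integral>\<^sup>+x. ennreal ((f x - g x)\<^sup>2) \<partial>lborel) = 0"
    using fin(2) sq by (auto simp: ennreal_add_left_cancel ennreal_mult_eq_top_iff)
  then have "AE x in lborel. ennreal ((f x - g x)\<^sup>2) = 0" by (subst (asm) nn_integral_0_iff_AE) auto
  then have "AE x in lborel. f x = h ((norm x)\<^sup>2)" by eventually_elim (simp add: g_def ennreal_eq_0_iff)
  then show ?thesis using hm h by blast
qed

lemma extremal_radial_profile:
  assumes ex: "extremal f" and h[measurable]: "h \<in> borel_measurable borel" "\<And>v. 0 \<le> h v"
    and AE: "AE x in lborel. f x = h ((norm x)\<^sup>2)"
  shows "\<exists>\<kappa>. AE x in lborel. f x = (if (norm x)\<^sup>2 < A then \<kappa> * n0 ((norm x)\<^sup>2) / (pi\<^sup>2 * (norm x)\<^sup>2) else 0)"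
proof -
  have [measurable]: "f \<in> borel_measurable borel" using ex by (auto simp: extremal_def)
  define g where "g x = h ((norm x)\<^sup>2)" for x :: r4
  have [measurable]: "g \<in> borel_measurable borel" unfolding g_def[abs_def] by measurable
  have fg: "AE x in lborel. f x = g x" using AE by (simp add: g_def)
  have "riesz coulomb f = riesz coulomb g" by (rule riesz_cong_AE[OF fg])
  moreover have "sharp_bound f = sharp_bound g" by (rule sharp_bound_cong_AE[OF fg])
  ultimately have "sharp_bound g \<le> riesz coulomb g" "riesz coulomb g < \<infinity>" using ex by (auto simp: extremal_def)
  moreover have sp0: "0 \<le> shell_profile h v" for v by (simp add: shell_profile_def h(2))
  ultimately have "\<exists>\<kappa>. AE v in lborel. 0 < v \<longrightarrow> shell_profile h v = (if v < A then \<kappa> * n0 v else 0)"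
    unfolding sharp_bound_radial[OF h g_def] radial_integrals(1)[OF h g_def]
    by (intro shell_equality) simp_all
  then obtain \<kappa> where \<kappa>: "AE v in lborel. 0 < v \<longrightarrow> shell_profile h v = (if v < A then \<kappa> * n0 v else 0)" by blast
  \<comment> \<open>Null sets of squared radii pull back to null sets of points because the law of
    the squared norm has a density.\<close>
  have "AE v in density lborel (\<lambda>v. ennreal (radial_density DIM(r4) v)). shell_profile h v = (if v < A then \<kappa> * n0 v else 0)"
  proof (subst AE_density)
    show "AE v in lborel. 0 < ennreal (radial_density DIM(r4) v) \<longrightarrow> shell_profile h v = (if v < A then \<kappa> * n0 v else 0)"
      using \<kappa> by eventually_elim (simp add: radial_density_def split: if_splits)
  qed measurable
  then have "AE v in distr lborel borel (\<lambda>x::r4. (norm x)\<^sup>2). shell_profile h v = (if v < A then \<kappa> * n0 v else 0)"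
    by (simp only: distr_norm_square)
  then have "AE x in lborel. shell_profile h ((norm (x::r4))\<^sup>2) = (if (norm x)\<^sup>2 < A then \<kappa> * n0 ((norm x)\<^sup>2) else 0)"
    by (subst (asm) AE_distr_iff) auto
  then have "AE x in lborel. f x = (if (norm x)\<^sup>2 < A then \<kappa> * n0 ((norm x)\<^sup>2) / (pi\<^sup>2 * (norm x)\<^sup>2) else 0)"
    using AE AE_lborel_singleton[of "0 :: r4"]
  proof eventually_elim
    case (elim x)
    then have "0 < (norm x)\<^sup>2" by simp
    then have "h ((norm x)\<^sup>2) = shell_profile h ((norm x)\<^sup>2) / (pi\<^sup>2 * (norm x)\<^sup>2)"
      by (simp add: shell_profile_def)
    then show ?case using elim by simp
  qed
  then show ?thesis by blast
qed

theorem extremal_cylindrical: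
  assumes ex: "extremal f" and cyl: "\<And>t y y'. norm y = norm y' \<Longrightarrow> f (t, y) = f (t, y')"
  shows "\<exists>t \<kappa>. AE x in lborel. f (x + (t, 0)) =
    (if (norm x)\<^sup>2 < A then \<kappa> * n0 ((norm x)\<^sup>2) / (pi\<^sup>2 * (norm x)\<^sup>2) else 0)"
proof -
  have [measurable]: "f \<in> borel_measurable borel" and f: "\<And>x. 0 \<le> f x" using ex by (auto simp: extremal_def)
  obtain t where t: "(\<integral>\<^sup>+x. ennreal (f x) * indicator {x. fst x < t} x \<partial>lborel)
    = (\<integral>\<^sup>+x. ennreal (f x) * indicator {x. t < fst x} x \<partial>lborel)"
    using exists_median[of f] f extremal_finite(1)[OF ex] by auto
  define g where "g x = f (x + (t, 0))" for x
  have exg: "extremal g" unfolding g_def[abs_def] by (rule extremal_translate[OF ex])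
  have [measurable]: "g \<in> borel_measurable borel" using exg by (auto simp: extremal_def)
  let ?e = "(1, 0) :: r4"
  have e: "?e \<noteq> 0" by (simp add: zero_prod_def)
  have inner_e: "?e \<bullet> x = fst x" for x by (cases x) simp
  have re: "hrefl ?e 0 x = (- fst x, snd x)" for x
    by (cases x) (simp add: hrefl_def)
  have "AE x in lborel. g (hrefl ?e 0 x) = g x"
  proof (rule extremal_reflection[OF exg e])
    have "(\<integral>\<^sup>+x. ennreal (g x) * indicator {x. fst x < 0} x \<partial>lborel)
      = (\<integral>\<^sup>+x. ennreal (f x) * indicator {x. fst x < t} x \<partial>lborel)"
      using nn_integral_lborel_translate[of "\<lambda>x. ennreal (f x) * indicator {x. fst x < t} x" "(t, 0)"]
      by (simp add: g_def indicator_def)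
    moreover have "(\<integral>\<^sup>+x. ennreal (g x) * indicator {x. 0 < fst x} x \<partial>lborel)
      = (\<integral>\<^sup>+x. ennreal (f x) * indicator {x. t < fst x} x \<partial>lborel)"
      using nn_integral_lborel_translate[of "\<lambda>x. ennreal (f x) * indicator {x. t < fst x} x" "(t, 0)"]
      by (simp add: g_def indicator_def)
    ultimately show "(\<integral>\<^sup>+x. ennreal (g x) * indicator {x. ?e \<bullet> x < 0} x \<partial>lborel)
      = (\<integral>\<^sup>+x. ennreal (g x) * indicator {x. 0 < ?e \<bullet> x} x \<partial>lborel)"
      using t by (simp only: inner_e)
  qed
  \<comment> \<open>The halving mirror changes the sign of the axial coordinate; the axial symmetry
    supplies the sign change of the others.\<close>
  then have neg: "AE x in lborel. g (- x) = g x"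
  proof eventually_elim
    case (elim x)
    obtain a b where x: "x = (a, b)" by (cases x)
    have "g (- x) = g (- fst x, snd x)"
      using cyl[where y="- b" and y'=b and t="t - a"] by (simp add: g_def x)
    then show ?case using elim by (simp add: re)
  qed
  have inv: "AE x in lborel. g (hrefl v 0 x) = g x" if v: "v \<noteq> 0" for v
  proof (rule extremal_reflection[OF exg v])
    have "orthogonal_transformation (uminus :: r4 \<Rightarrow> r4)"
      by (simp add: orthogonal_transformation_def linear_uminus)
    then have d: "distr lborel borel (uminus :: r4 \<Rightarrow> r4) = lborel" by (rule distr_lborel_orthogonal_transformation)
    have "(\<integral>\<^sup>+x. ennreal (g x) * indicator {x. v \<bullet> x < 0} x \<partial>lborel)
      = (\<integral>\<^sup>+x. ennreal (g x) * indicator {x. v \<bullet> x < 0} x \<partial>distr lborel borel uminus)" by (simp only: d)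
    also have "\<dots> = (\<integral>\<^sup>+x. ennreal (g (- x)) * indicator {x. v \<bullet> x < 0} (- x) \<partial>lborel)"
      by (rule nn_integral_distr) measurable
    also have "\<dots> = (\<integral>\<^sup>+x. ennreal (g x) * indicator {x. 0 < v \<bullet> x} x \<partial>lborel)"
    proof (rule nn_integral_cong_AE)
      show "AE x in lborel. ennreal (g (- x)) * indicator {x. v \<bullet> x < 0} (- x) = ennreal (g x) * indicator {x. 0 < v \<bullet> x} x"
        using neg by eventually_elim (simp add: indicator_def)
    qed
    finally show "(\<integral>\<^sup>+x. ennreal (g x) * indicator {x. v \<bullet> x < 0} x \<partial>lborel)
      = (\<integral>\<^sup>+x. ennreal (g x) * indicator {x. 0 < v \<bullet> x} x \<partial>lborel)" .
  qed
  obtain h where "h \<in> borel_measurable borel" "\<forall>v. 0 \<le> h v" "AE x in lborel. g x = h ((norm x)\<^sup>2)"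
    using radial_of_reflection_invariant[OF exg inv] by blast
  then obtain \<kappa> where "AE x in lborel. g x = (if (norm x)\<^sup>2 < A then \<kappa> * n0 ((norm x)\<^sup>2) / (pi\<^sup>2 * (norm x)\<^sup>2) else 0)"
    using extremal_radial_profile[OF exg, of h] by blast
  then show ?thesis unfolding g_def by blast
qed

end

section \<open>Bessel functions\<close>

text \<open>In the variable \<open>u = x\<^sup>2 / 4\<close> one has \<open>J\<^sub>1 x = x / 2 * j1 u\<close> and \<open>J\<^sub>0 x = j0 u\<close>.\<close>

definition j1_coeff :: "nat \<Rightarrow> real" where
  "j1_coeff k = (-1) ^ k / (fact k * fact (k + 1))"

definition j1 :: "real \<Rightarrow> real" where
  "j1 u = (\<Sum>k. j1_coeff k * u ^ k)"

definition j0_coeff :: "nat \<Rightarrow> real" where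
  "j0_coeff k = (-1) ^ k / (fact k * fact k)"

definition j0 :: "real \<Rightarrow> real" where
  "j0 u = (\<Sum>k. j0_coeff k * u ^ k)"

lemma summable_exp_comparison:
  fixes a :: "nat \<Rightarrow> real"
  assumes "\<And>k. \<bar>a k\<bar> \<le> 1 / fact k"
  shows "summable (\<lambda>k. a k * u ^ k)"
proof (rule summable_comparison_test)
  show "summable (\<lambda>k. inverse (fact k) * \<bar>u\<bar> ^ k)" by (rule summable_exp)
  have "norm (a k * u ^ k) \<le> inverse (fact k) * \<bar>u\<bar> ^ k" for k
    using mult_right_mono[OF assms[of k], of "\<bar>u\<bar> ^ k"] by (simp add: abs_mult power_abs inverse_eq_divide)
  then show "\<exists>N. \<forall>n\<ge>N. norm (a n * u ^ n) \<le> inverse (fact n) * \<bar>u\<bar> ^ n" by blast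
qed

lemma one_over_fact_le: "1 / (fact k * fact m) \<le> (1 :: real) / fact k"
proof -
  have "(1::real) \<le> fact m" by (rule fact_ge_1)
  then show ?thesis by (simp add: divide_simps)
qed

lemma summable_j1: "summable (\<lambda>k. j1_coeff k * u ^ k)"
  by (rule summable_exp_comparison)
    (use one_over_fact_le in \<open>simp add: j1_coeff_def abs_mult power_abs del: fact_Suc\<close>)

lemma summable_j0: "summable (\<lambda>k. j0_coeff k * u ^ k)"
  by (rule summable_exp_comparison)
    (use one_over_fact_le in \<open>simp add: j0_coeff_def abs_mult power_abs\<close>)

text \<open>The relation J0' = - J1 on the level of coefficients.\<close>

lemma diffs_j0_coeff: "diffs j0_coeff = (\<lambda>k. - j1_coeff k)"
proof
  fix k
  have "m * (- s / (m * f * (m * f))) = - (s / (f * (m * f)))" if "m \<noteq> 0" "f \<noteq> 0" for m f s :: real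
    using that by (simp add: field_simps)
  from this[of "1 + real k" "fact k" "(-1) ^ k"] show "diffs j0_coeff k = - j1_coeff k"
    by (simp add: diffs_def j0_coeff_def j1_coeff_def)
qed

lemma DERIV_j0: "(j0 has_real_derivative - j1 u) (at u)"
proof -
  have "(j0 has_real_derivative (\<Sum>k. diffs j0_coeff k * u ^ k)) (at u)"
    unfolding j0_def[abs_def] by (rule termdiffs_strong_converges_everywhere[OF summable_j0])
  then show ?thesis
    using suminf_minus[OF summable_j1, of u] by (simp add: diffs_j0_coeff j1_def)
qed

definition dj1 :: "real \<Rightarrow> real" where
  "dj1 u = (\<Sum>k. diffs j1_coeff k * u ^ k)"

lemma DERIV_j1: "(j1 has_real_derivative dj1 u) (at u)"
  unfolding j1_def[abs_def] dj1_def by (rule termdiffs_strong_converges_everywhere[OF summable_j1])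

text \<open>The recurrence (x J1)' = x J0 in the variable u = x^2 / 4, by comparison of
  coefficients.\<close>

lemma mult_dj1: "u * dj1 u = j0 u - j1 u"
proof -
  have s: "summable (\<lambda>k. diffs j1_coeff k * u ^ k)"
    by (rule termdiff_converges_all[OF summable_j1])
  have "(\<lambda>k. real k * j1_coeff k * u ^ k) = (\<lambda>k. j0_coeff k * u ^ k - j1_coeff k * u ^ k)"
  proof
    fix k
    have "(n - 1) * (s / (f * (n * f))) = s / (f * f) - s / (f * (n * f))"
      if "n \<noteq> 0" "f \<noteq> 0" for n f s :: real
      using that by (simp add: divide_simps left_diff_distrib)
    from this[of "1 + real k" "fact k" "(-1) ^ k"]
    have "real k * j1_coeff k = j0_coeff k - j1_coeff k" by (simp add: j0_coeff_def j1_coeff_def)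
    then show "real k * j1_coeff k * u ^ k = j0_coeff k * u ^ k - j1_coeff k * u ^ k"
      by (simp add: left_diff_distrib)
  qed
  then have "(\<lambda>k. real k * j1_coeff k * u ^ k) sums (j0 u - j1 u)"
    unfolding j0_def j1_def by (simp only:) (intro sums_diff summable_sums summable_j0 summable_j1)
  then have "(\<lambda>k. real (Suc k) * j1_coeff (Suc k) * u ^ Suc k) sums (j0 u - j1 u)"
    by (subst sums_Suc_iff) simp
  moreover have "(\<lambda>k. u * (diffs j1_coeff k * u ^ k)) sums (u * dj1 u)"
    unfolding dj1_def by (intro sums_mult summable_sums s)
  moreover have "(\<lambda>k. u * (diffs j1_coeff k * u ^ k)) = (\<lambda>k. real (Suc k) * j1_coeff (Suc k) * u ^ Suc k)"
    by (simp add: diffs_def mult_ac)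
  ultimately show ?thesis by (metis sums_unique2)
qed

lemma half_power_even: "(x / 2) ^ (2 * k) = (x\<^sup>2 / 4) ^ k" for x :: real
proof -
  have "(x / 2)\<^sup>2 = x\<^sup>2 / 4" by (simp add: power_divide)
  then show ?thesis by (simp only: power_mult)
qed

lemma bessel_J_0: "bessel_J 0 x = j0 (x\<^sup>2 / 4)"
  by (simp add: bessel_J_def j0_def j0_coeff_def half_power_even)

lemma bessel_J_1: "bessel_J 1 x = x / 2 * j1 (x\<^sup>2 / 4)"
proof -
  have "bessel_J 1 x = (\<Sum>k. x / 2 * (j1_coeff k * (x\<^sup>2 / 4) ^ k))"
    unfolding bessel_J_def j1_coeff_def power_add half_power_even by (simp add: mult_ac)
  also have "\<dots> = x / 2 * j1 (x\<^sup>2 / 4)"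
    unfolding j1_def by (rule suminf_mult[OF summable_j1])
  finally show ?thesis .
qed

lemma continuous_j1: "continuous_on S j1"
  by (meson DERIV_j1 DERIV_continuous_on has_field_derivative_at_within)

lemma continuous_j0: "continuous_on S j0"
  by (meson DERIV_j0 DERIV_continuous_on has_field_derivative_at_within)

lemma j1_0: "j1 0 = 1"
proof -
  have "j1 0 = (\<Sum>k. j1_coeff k * 0 ^ k)" by (simp add: j1_def)
  also have "\<dots> = j1_coeff 0" by (rule powser_zero)
  finally show ?thesis by (simp add: j1_coeff_def)
qed

text \<open>An upper bound for the first zero of J1, since u = 4 corresponds to x = 4. The first
  five terms add up to - 1 / 45, and the rest is an alternating series with decreasing terms whose
  leading term is negative.\<close>

lemma j1_4_neg: "j1 4 < 0"
proof -
  define a where "a k = (4::real) ^ (k + 5) / (fact (k + 5) * fact (k + 6))" for k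
  have pos: "0 \<le> a k" for k by (simp add: a_def)
  have a: "(-1) ^ k * a k = - (j1_coeff (k + 5) * 4 ^ (k + 5))" for k
  proof -
    have "(-1 :: real) ^ (k + 5) = - ((-1) ^ k)" by (simp add: power_add)
    then show ?thesis by (simp only: a_def j1_coeff_def) (simp add: add.commute)
  qed
  have summ: "summable (\<lambda>k. j1_coeff (k + 5) * 4 ^ (k + 5))"
    using summable_j1[of 4] by (subst summable_iff_shift)
  have lim: "a \<longlonglongrightarrow> 0"
  proof -
    have "(\<lambda>k. \<bar>j1_coeff (k + 5) * 4 ^ (k + 5)\<bar>) \<longlonglongrightarrow> 0"
      using tendsto_rabs_zero[OF summable_LIMSEQ_zero[OF summ]] .
    moreover have "\<bar>j1_coeff (k + 5) * 4 ^ (k + 5)\<bar> = a k" for k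
      by (simp add: a_def j1_coeff_def abs_mult add.commute)
    ultimately show ?thesis by simp
  qed
  have mono: "a (Suc k) \<le> a k" for k
  proof -
    have "a (Suc k) = a k * (4 / (real (k + 6) * real (k + 7)))"
    proof -
      have "k + 6 = Suc (k + 5)" "k + 7 = Suc (k + 6)" by simp_all
      then have f: "(fact (k + 6) :: real) = real (k + 6) * fact (k + 5)" "(fact (k + 7) :: real) = real (k + 7) * fact (k + 6)"
        by (simp_all only: fact_Suc)
      have "p * 4 / ((m * f) * (q * (m * f))) = p / (f * (m * f)) * (4 / (m * q))" if "m \<noteq> 0" "q \<noteq> 0" "f \<noteq> 0" for p m q f :: real
        using that by (simp add: field_simps)
      from this[of "real (k + 6)" "real (k + 7)" "fact (k + 5)" "4 ^ (k + 5)"]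
      moreover have "(4 :: real) ^ (k + 6) = 4 ^ (k + 5) * 4" by (simp add: power_add)
      ultimately show ?thesis by (simp add: a_def f add.commute[of 6] add.commute[of 7] mult_ac)
    qed
    also have "\<dots> \<le> a k * 1"
      by (intro mult_left_mono pos) (simp add: divide_le_eq algebra_simps)
    finally show ?thesis by simp
  qed
  have "0 \<le> (\<Sum>k. (-1) ^ k * a k)"
    using summable_Leibniz'(2)[OF lim pos mono, of 0] by simp
  then have "(\<Sum>k. j1_coeff (k + 5) * 4 ^ (k + 5)) \<le> 0"
    unfolding a by (simp add: suminf_minus[OF summ])
  moreover have "j1 4 = (\<Sum>k. j1_coeff (k + 5) * 4 ^ (k + 5)) + (\<Sum>k<5. j1_coeff k * 4 ^ k)"
    unfolding j1_def by (rule suminf_split_initial_segment[OF summable_j1])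
  moreover have "(\<Sum>k<5. j1_coeff k * 4 ^ k) < 0"
  proof -
    have "{..<5::nat} = {0, 1, 2, 3, 4}" by auto
    then show ?thesis by (simp add: j1_coeff_def fact_numeral)
  qed
  ultimately show ?thesis by simp
qed

text \<open>The \<open>LEAST\<close> over the reals has to be shown to exist: the zeros of
  \<open>j1\<close> in [0, 4] form a nonempty compact set, and \<open>j1 0 = 1\<close> keeps its
  minimum away from zero. An earlier nonpositive value would produce an earlier zero by the
  intermediate value theorem.\<close>

lemma bessel_c0_properties:
  shows "0 < bessel_c0" "j1 (bessel_c0\<^sup>2 / 4) = 0"
    "\<And>u. 0 \<le> u \<Longrightarrow> u < bessel_c0\<^sup>2 / 4 \<Longrightarrow> 0 < j1 u"
proof -
  define Z where "Z = {u \<in> {0..4}. j1 u = 0}"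
  have "compact Z"
  proof -
    have "closed {u \<in> {0..4}. j1 u = 0}"
      by (intro continuous_closed_preimage_constant continuous_j1) auto
    then show ?thesis
      unfolding Z_def by (auto simp: compact_eq_bounded_closed intro: bounded_subset[of "{0..4::real}"])
  qed
  moreover have "Z \<noteq> {}"
  proof -
    have "\<exists>x\<ge>0. x \<le> 4 \<and> j1 x = 0"
      by (rule IVT2') (use j1_4_neg j1_0 continuous_j1 in auto)
    then show ?thesis by (auto simp: Z_def)
  qed
  ultimately obtain u0 where u0: "u0 \<in> Z" "\<And>u. u \<in> Z \<Longrightarrow> u0 \<le> u"
    using compact_attains_inf[of Z] by blast
  then have u0z: "j1 u0 = 0" "0 \<le> u0" "u0 \<le> 4" by (auto simp: Z_def)
  then have u0pos: "0 < u0" using j1_0 by (cases "u0 = 0") auto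
  have pos: "0 < j1 u" if u: "0 \<le> u" "u < u0" for u
  proof (rule ccontr)
    assume "\<not> 0 < j1 u"
    then have "\<exists>x\<ge>0. x \<le> u \<and> j1 x = 0"
      by (intro IVT2') (use u j1_0 continuous_j1 in auto)
    then obtain x where "0 \<le> x" "x \<le> u" "j1 x = 0" by blast
    then show False using u0(2)[of x] u u0z by (auto simp: Z_def)
  qed
  have e: "bessel_c0 = 2 * sqrt u0"
    unfolding bessel_c0_def
  proof (rule Least_equality)
    show "0 < 2 * sqrt u0 \<and> bessel_J 1 (2 * sqrt u0) = 0"
      using u0pos u0z by (simp only: bessel_J_1) (simp add: power_mult_distrib)
    fix y assume y: "0 < y \<and> bessel_J 1 y = 0"
    then have "j1 (y\<^sup>2 / 4) = 0" unfolding bessel_J_1 by auto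
    then have "u0 \<le> y\<^sup>2 / 4" using pos[of "y\<^sup>2 / 4"] by force
    then have "4 * u0 \<le> y\<^sup>2" by simp
    then have "sqrt (4 * u0) \<le> y" using y by (intro real_le_lsqrt) auto
    then show "2 * sqrt u0 \<le> y" by (simp add: real_sqrt_mult)
  qed
  have c: "bessel_c0\<^sup>2 / 4 = u0" and "0 < bessel_c0"
    unfolding e using u0pos by (simp_all add: power_mult_distrib)
  then show "0 < bessel_c0" "j1 (bessel_c0\<^sup>2 / 4) = 0"
    "\<And>u. 0 \<le> u \<Longrightarrow> u < bessel_c0\<^sup>2 / 4 \<Longrightarrow> 0 < j1 u"
    using u0z pos by auto
qed

text \<open>Since J2 = 2 J1 / x - J0, the function is x^2 J2 / 4, and the formula is (x^2 J2)' = x^2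
  J1.\<close>

lemma DERIV_bessel_moment: "((\<lambda>u. u * (j1 u - j0 u)) has_real_derivative u * j1 u) (at u)"
proof -
  have "((\<lambda>u. u * (j1 u - j0 u)) has_real_derivative (1 * (j1 u - j0 u) + (dj1 u - (- j1 u)) * u)) (at u)"
    by (intro DERIV_mult DERIV_ident DERIV_diff DERIV_j1 DERIV_j0)
  also have "1 * (j1 u - j0 u) + (dj1 u - (- j1 u)) * u = u * j1 u"
    using mult_dj1[of u] by (simp add: algebra_simps)
  finally show ?thesis .
qed

lemma bessel_moment_pos:
  assumes u: "0 < u" "u \<le> bessel_c0\<^sup>2 / 4"
  shows "0 < u * (j1 u - j0 u)"
proof -
  have "0 * (j1 0 - j0 0) < u * (j1 u - j0 u)"
  proof (rule DERIV_pos_imp_increasing_open[OF u(1), of "\<lambda>u. u * (j1 u - j0 u)"])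
    show "\<exists>y. ((\<lambda>u. u * (j1 u - j0 u)) has_real_derivative y) (at x) \<and> 0 < y" if "0 < x" "x < u" for x
      using DERIV_bessel_moment[of x] bessel_c0_properties(3)[of x] that u by (intro exI[of _ "x * j1 x"]) auto
    show "continuous_on {0..u} (\<lambda>u. u * (j1 u - j0 u))"
      by (intro continuous_intros continuous_j1 continuous_j0)
  qed
  then show ?thesis by simp
qed

text \<open>At the zero of \<open>j1\<close> the positive quantity of
  \<open>bessel_moment_pos\<close> reduces to \<open>- u * j0 u\<close>.\<close>

lemma bessel_J_0_c0_neg: "bessel_J 0 bessel_c0 < 0"
  using bessel_moment_pos[of "bessel_c0\<^sup>2 / 4"] bessel_c0_properties(1,2)
  by (simp add: bessel_J_0 mult_less_0_iff zero_less_mult_iff)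

lemma j1_measurable [measurable]: "j1 \<in> borel_measurable borel"
  by (intro borel_measurable_continuous_onI continuous_j1)

lemma j0_measurable [measurable]: "j0 \<in> borel_measurable borel"
  by (intro borel_measurable_continuous_onI continuous_j0)

section \<open>The Lamb dipole\<close>

text \<open>Up to a constant this is \<open>radial_density 4\<close> times the profile J1 (sqrt lam
  r) / r of the lifted dipole, in the variable v = r^2.\<close>

definition lamb_n0 :: "real \<Rightarrow> real \<Rightarrow> real" where
  "lamb_n0 lam v = v * j1 (lam * v / 4)"

definition lamb_N0 :: "real \<Rightarrow> real \<Rightarrow> real" where
  "lamb_N0 lam u = 4 * u / lam * (j1 (lam * u / 4) - j0 (lam * u / 4))"

lemma lamb_argument:
  assumes "0 < lam"
  shows "lam * v / 4 < bessel_c0\<^sup>2 / 4 \<longleftrightarrow> v < bessel_c0\<^sup>2 / lam" "lam * v / 4 \<le> bessel_c0\<^sup>2 / 4 \<longleftrightarrow> v \<le> bessel_c0\<^sup>2 / lam"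
  using assms by (auto simp: field_simps)

lemma DERIV_lamb_N0:
  assumes lam: "0 < lam"
  shows "(lamb_N0 lam has_real_derivative lamb_n0 lam u) (at u)"
proof -
  let ?b = "lam / 4"
  have "((\<lambda>u. u * (j1 u - j0 u)) has_real_derivative (?b * u) * j1 (?b * u)) (at (?b * u))"
    by (rule DERIV_bessel_moment)
  then have "((\<lambda>u. (?b * u) * (j1 (?b * u) - j0 (?b * u))) has_real_derivative (?b * u) * j1 (?b * u) * ?b) (at u)"
    by (rule DERIV_chain2) (auto intro!: derivative_eq_intros)
  from DERIV_cmult[OF this, of "16 / lam\<^sup>2"]
  have "((\<lambda>u. 16 / lam\<^sup>2 * ((?b * u) * (j1 (?b * u) - j0 (?b * u)))) has_real_derivative 16 / lam\<^sup>2 * ((?b * u) * j1 (?b * u) * ?b)) (at u)" .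
  moreover have "(\<lambda>u. 16 / lam\<^sup>2 * ((?b * u) * (j1 (?b * u) - j0 (?b * u)))) = lamb_N0 lam"
    using lam by (auto simp: lamb_N0_def fun_eq_iff power2_eq_square)
  moreover have "16 / lam\<^sup>2 * ((?b * u) * j1 (?b * u) * ?b) = lamb_n0 lam u"
    using lam by (simp add: lamb_n0_def power2_eq_square)
  ultimately show ?thesis by simp
qed

text \<open>By \<open>mult_dj1\<close>, a primitive of N0 / u^2 is - (4 / lam) times
  \<open>j1 (lam * u / 4)\<close>. It vanishes at \<open>A\<close> because \<open>bessel_c0\<close>
  is a zero of J1, so the tail integral is its negative at \<open>v\<close>, which is 4 / lam times
  n0 / v. This explains both the radius and the constant.\<close>

lemma lamb_hardy_profile:
  assumes lam: "0 < lam"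
  shows "hardy_profile (lamb_n0 lam) (lamb_N0 lam) (bessel_c0\<^sup>2 / lam) (4 / lam)"
proof
  let ?A = "bessel_c0\<^sup>2 / lam"
  show "0 < ?A" "0 < 4 / lam" using lam bessel_c0_properties(1) by auto
  show "lamb_n0 lam \<in> borel_measurable borel" "lamb_N0 lam \<in> borel_measurable borel"
    unfolding lamb_n0_def[abs_def] lamb_N0_def[abs_def] by measurable
  show n0: "0 < lamb_n0 lam v" if "0 < v" "v < ?A" for v
    unfolding lamb_n0_def using that lam lamb_argument(1)[OF lam, of v]
    by (intro mult_pos_pos bessel_c0_properties(3)) auto
  show "0 < lamb_N0 lam u" if u: "0 < u" "u \<le> ?A" for u
  proof -
    have "0 < lam * u / 4 * (j1 (lam * u / 4) - j0 (lam * u / 4))"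
      by (rule bessel_moment_pos) (use u lam lamb_argument(2)[OF lam, of u] in auto)
    moreover have "0 < lam * u / 4" using u lam by simp
    ultimately have "0 < j1 (lam * u / 4) - j0 (lam * u / 4)" by (rule zero_less_mult_pos)
    then show ?thesis using u lam by (simp add: lamb_N0_def)
  qed
  show "mass (lamb_n0 lam) u = ennreal (lamb_N0 lam u)" if u: "0 < u" "u \<le> ?A" for u
  proof -
    have "mass (lamb_n0 lam) u = ennreal (lamb_N0 lam u - lamb_N0 lam 0)"
      unfolding mass_def
    proof (rule nn_integral_FTC_Ioo)
      show "continuous_on {0..u} (lamb_N0 lam)"
        by (meson DERIV_lamb_N0[OF lam] DERIV_continuous_on has_field_derivative_at_within)
      show "0 \<le> lamb_n0 lam v" if "0 < v" "v < u" for v using n0[of v] that u by simp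
      show "lamb_n0 lam \<in> borel_measurable borel" by fact
    qed (use u DERIV_lamb_N0[OF lam] in auto)
    then show ?thesis by (simp add: lamb_N0_def)
  qed
  show "(\<integral>\<^sup>+u. ennreal (lamb_N0 lam u / u\<^sup>2) * indicator {v<..<?A} u \<partial>lborel) = ennreal (4 / lam * lamb_n0 lam v / v)"
    if v: "0 < v" "v < ?A" for v
  proof -
    define F where "F u = - (4 / lam) * j1 (lam / 4 * u)" for u
    have F: "(F has_real_derivative lamb_N0 lam u / u\<^sup>2) (at u)" if u: "0 < u" for u
    proof -
      have "((\<lambda>u. j1 (lam / 4 * u)) has_real_derivative dj1 (lam / 4 * u) * (lam / 4)) (at u)"
        by (rule DERIV_chain2[OF DERIV_j1]) (auto intro!: derivative_eq_intros)
      then have "(F has_real_derivative - (4 / lam) * (dj1 (lam / 4 * u) * (lam / 4))) (at u)"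
        unfolding F_def by (rule DERIV_cmult)
      also have "- (4 / lam) * (dj1 (lam / 4 * u) * (lam / 4)) = - dj1 (lam / 4 * u)" using lam by simp
      also have "\<dots> = lamb_N0 lam u / u\<^sup>2"
      proof -
        have "lam / 4 * u * dj1 (lam / 4 * u) = j0 (lam / 4 * u) - j1 (lam / 4 * u)" by (rule mult_dj1)
        moreover have "lam * u / 4 = lam / 4 * u" by simp
        ultimately have "j1 (lam * u / 4) - j0 (lam * u / 4) = - (lam / 4 * u * dj1 (lam / 4 * u))"
          by (simp only:)
        then show ?thesis unfolding lamb_N0_def using u lam by (simp add: power2_eq_square)
      qed
      finally show ?thesis .
    qed
    have "(\<integral>\<^sup>+u. ennreal (lamb_N0 lam u / u\<^sup>2) * indicator {v<..<?A} u \<partial>lborel) = ennreal (F ?A - F v)"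
    proof (rule nn_integral_FTC_Ioo)
      have [measurable]: "lamb_N0 lam \<in> borel_measurable borel" by fact
      show "(\<lambda>u. lamb_N0 lam u / u\<^sup>2) \<in> borel_measurable borel" by measurable
      show "continuous_on {v..?A} F"
        unfolding F_def by (intro continuous_intros continuous_on_compose2[OF continuous_j1[of UNIV]]) auto
      show "0 \<le> lamb_N0 lam u / u\<^sup>2" if "v < u" "u < ?A" for u
        using \<open>\<And>u. 0 < u \<Longrightarrow> u \<le> ?A \<Longrightarrow> 0 < lamb_N0 lam u\<close>[of u] that v by simp
    qed (use v F in auto)
    also have "F ?A - F v = 4 / lam * lamb_n0 lam v / v"
      using v lam bessel_c0_properties(2) by (simp add: F_def lamb_n0_def)
    finally show ?thesis .
  qed
qed

text \<open>The product of \<open>lam\<close>, \<open>lamb_coeff lam W\<close> and half the square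
  root of \<open>lam\<close>: the coefficient that remains when J1 is expressed by
  \<open>j1\<close>.\<close>

definition lamb_amplitude :: "real \<Rightarrow> real \<Rightarrow> real" where
  "lamb_amplitude lam W = - (lam * W / bessel_J 0 bessel_c0)"

text \<open>A Borel function on the whole plane that vanishes off the upper half-disk. The formula
  of \<open>lamb_dipole\<close> is meant for the half-plane only: for positive \<open>W\<close> it
  is positive below the axis outside the disk.\<close>

definition lamb_rep :: "real \<Rightarrow> real \<Rightarrow> real \<times> real \<Rightarrow> real" where
  "lamb_rep lam W x = lamb_amplitude lam W * max 0 (snd x) *
     (if (norm x)\<^sup>2 < bessel_c0\<^sup>2 / lam then j1 (lam * (norm x)\<^sup>2 / 4) else 0)"

lemma lamb_amplitude_pos: "0 < lam \<Longrightarrow> 0 < W \<Longrightarrow> 0 < lamb_amplitude lam W"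
  using bessel_J_0_c0_neg by (simp add: lamb_amplitude_def divide_less_0_iff)

lemma lamb_rep_measurable [measurable]: "lamb_rep lam W \<in> borel_measurable borel"
  unfolding lamb_rep_def[abs_def] by measurable

lemma j1_nonneg_below: "0 < lam \<Longrightarrow> 0 \<le> v \<Longrightarrow> v < bessel_c0\<^sup>2 / lam \<Longrightarrow> 0 < j1 (lam * v / 4)"
  using lamb_argument(1)[of lam v] by (intro bessel_c0_properties(3)) auto

lemma lamb_rep_nonneg: "0 < lam \<Longrightarrow> 0 < W \<Longrightarrow> 0 \<le> lamb_rep lam W x"
  using lamb_amplitude_pos[of lam W] j1_nonneg_below[of lam "(norm x)\<^sup>2"]
  by (auto simp: lamb_rep_def)

text \<open>Within the radius the stream function is nonnegative because \<open>j1\<close> is, and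
  beyond it the stream function is negative, so taking the positive part is the same as cutting at
  the radius.\<close>

lemma lamb_dipole_eq_rep:
  assumes lam: "0 < lam" and W: "0 < W" and x: "x \<in> half_plane"
  shows "lamb_dipole lam W x = lamb_rep lam W x"
proof -
  define r where "r = norm x"
  have s: "0 < snd x" using x by (simp add: half_plane_def)
  then have "x \<noteq> 0" by auto
  then have r: "0 < r" by (simp add: r_def)
  have sq1: "lam powr (1 / 2) = sqrt lam" using lam by (intro powr_half_sqrt) simp
  have sq2: "lam powr (- (1 / 2)) = inverse (sqrt lam)" by (simp only: powr_minus sq1)
  note sq = sq1 sq2
  have a: "lamb_radius lam = bessel_c0 / sqrt lam" unfolding lamb_radius_def sq by (simp only: divide_inverse)
  have a0: "0 < lamb_radius lam" using lam bessel_c0_properties(1) by (simp add: a)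
  have a2: "(lamb_radius lam)\<^sup>2 = bessel_c0\<^sup>2 / lam" using lam by (simp add: a power_divide)
  show ?thesis
  proof (cases "r \<le> lamb_radius lam")
    case True
    have "sqrt lam * r / 2 * j1 ((sqrt lam * r)\<^sup>2 / 4) = sqrt lam * r / 2 * j1 (lam * r\<^sup>2 / 4)"
      using lam by (simp add: power_mult_distrib)
    then have J: "bessel_J 1 (sqrt lam * r) = sqrt lam * r / 2 * j1 (lam * r\<^sup>2 / 4)" by (simp only: bessel_J_1)
    have st: "lamb_stream lam W x = lamb_coeff lam W * (sqrt lam * r / 2 * j1 (lam * r\<^sup>2 / 4)) * (snd x / r)"
      using True by (simp only: lamb_stream_def Let_def r_def[symmetric] sq J if_True)
    have "lam * ((- (2 * W / (p * q)) * (p * r / 2 * J)) * (snd x / r)) = - (lam * W / q) * snd x * J"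
      if "p \<noteq> 0" "q \<noteq> 0" for p q J :: real
      using that r by simp
    from this[of "sqrt lam" "bessel_J 0 bessel_c0" "j1 (lam * r\<^sup>2 / 4)"]
    have Q: "lam * lamb_stream lam W x = lamb_amplitude lam W * snd x * j1 (lam * r\<^sup>2 / 4)"
      unfolding st lamb_coeff_def sq lamb_amplitude_def using lam bessel_J_0_c0_neg by simp
    \<comment> \<open>On the circle itself \<open>j1\<close> vanishes, so the closed disk of the
      dipole and the open disk of \<open>lamb_rep\<close> give the same value.\<close>
    have J0: "0 \<le> j1 (lam * r\<^sup>2 / 4)" and J1: "r\<^sup>2 < bessel_c0\<^sup>2 / lam \<or> j1 (lam * r\<^sup>2 / 4) = 0"
    proof -
      have "r\<^sup>2 \<le> bessel_c0\<^sup>2 / lam" using True r unfolding a2[symmetric] by (intro power_mono) auto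
      then consider "r\<^sup>2 < bessel_c0\<^sup>2 / lam" | "r\<^sup>2 = bessel_c0\<^sup>2 / lam" by linarith
      then have "r\<^sup>2 < bessel_c0\<^sup>2 / lam \<and> 0 < j1 (lam * r\<^sup>2 / 4) \<or> j1 (lam * r\<^sup>2 / 4) = 0"
      proof cases
        case 1 then show ?thesis using j1_nonneg_below[OF lam, of "r\<^sup>2"] by simp
      next
        case 2 then show ?thesis using bessel_c0_properties(2) lam by simp
      qed
      then show "0 \<le> j1 (lam * r\<^sup>2 / 4)" "r\<^sup>2 < bessel_c0\<^sup>2 / lam \<or> j1 (lam * r\<^sup>2 / 4) = 0" by auto
    qed
    have "0 \<le> lam * lamb_stream lam W x"
      unfolding Q using lamb_amplitude_pos[OF lam W] s J0 by (intro mult_nonneg_nonneg) auto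
    then have "0 \<le> lamb_stream lam W x" using lam by (simp add: zero_le_mult_iff)
    then have "lamb_dipole lam W x = lamb_amplitude lam W * snd x * j1 (lam * r\<^sup>2 / 4)"
      using Q by (simp add: lamb_dipole_def)
    also have "\<dots> = lamb_rep lam W x"
      using s J1 by (auto simp: lamb_rep_def r_def[symmetric])
    finally show ?thesis .
  next
    case False
    then have ra: "lamb_radius lam < r" by simp
    have lt: "(lamb_radius lam)\<^sup>2 < r\<^sup>2" using ra a0 by (intro power_strict_mono) auto
    have out: "\<not> r\<^sup>2 < bessel_c0\<^sup>2 / lam" "0 < r - (lamb_radius lam)\<^sup>2 / r"
    proof -
      show "\<not> r\<^sup>2 < bessel_c0\<^sup>2 / lam" using lt a2 by simp
      show "0 < r - (lamb_radius lam)\<^sup>2 / r" using lt r by (simp add: divide_less_eq power2_eq_square)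
    qed
    have "lamb_stream lam W x = - W * (r - (lamb_radius lam)\<^sup>2 / r) * (snd x / r)"
      using False by (simp add: lamb_stream_def Let_def r_def[symmetric])
    also have "\<dots> < 0" using W out(2) s r by (simp add: mult_less_0_iff zero_less_mult_iff)
    finally show ?thesis using out(1) by (simp add: lamb_dipole_def lamb_rep_def r_def[symmetric])
  qed
qed

text \<open>The cancelling factors \<open>pi\<^sup>2\<close> bring the lift into the form in which
  \<open>extremal_cylindrical\<close> delivers extremal profiles.\<close>

lemma AE_lift_lamb_rep:
  "AE z in lborel. lift (lamb_rep lam W) z =
    (if (norm z)\<^sup>2 < bessel_c0\<^sup>2 / lam then (pi\<^sup>2 * lamb_amplitude lam W) * lamb_n0 lam ((norm z)\<^sup>2) / (pi\<^sup>2 * (norm z)\<^sup>2) else 0)"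
  using AE_snd_nonzero
proof eventually_elim
  case (elim z)
  then have n: "0 < norm (snd z)" by simp
  have e: "(norm (fst z, norm (snd z)))\<^sup>2 = (norm z)\<^sup>2" by (cases z) (simp add: norm_Pair)
  have "0 < (norm z)\<^sup>2" using elim by (auto simp: zero_less_norm_iff)
  then show ?case using n by (simp add: lift_def lamb_rep_def e lamb_n0_def)
qed

section \<open>The half-plane\<close>

lemma half_plane_lebesgue [measurable]: "half_plane \<in> sets lebesgue"
  using half_plane_borel by auto

lemma space_half_leb: "space half_leb = half_plane"
  by (simp add: space_restrict_space)

lemma nn_integral_half_leb:
  "(\<integral>\<^sup>+x. F x \<partial>half_leb) = (\<integral>\<^sup>+x. F x * indicator half_plane x \<partial>lborel)"
  by (simp add: nn_integral_restrict_space nn_integral_completion)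

lemma AE_half_leb: "(AE x in half_leb. P x) \<longleftrightarrow> (AE x in lborel. x \<in> half_plane \<longrightarrow> P x)"
  by (simp add: AE_restrict_space_iff AE_completion_iff)

lemma borel_imp_half_leb: "f \<in> borel_measurable borel \<Longrightarrow> f \<in> borel_measurable half_leb"
  by (intro measurable_restrict_space1 measurable_completion) simp

text \<open>Completeness of Lebesgue measure. It is needed for the inner integral of the energy,
  which is identified with a Borel function only almost everywhere.\<close>

lemma half_leb_measurable_AE:
  fixes f g :: "real \<times> real \<Rightarrow> real"
  assumes f: "f \<in> borel_measurable half_leb" and AE: "AE x in half_leb. f x = g x"
  shows "g \<in> borel_measurable half_leb"
proof (rule measurableI)
  fix S :: "real set" assume S: "S \<in> sets borel"
  have "f -` S \<inter> half_plane \<in> sets half_leb"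
    using measurable_sets[OF f S] by (simp add: space_half_leb)
  then have fS: "f -` S \<inter> half_plane \<in> sets lebesgue"
    by (subst (asm) sets_restrict_space_iff) auto
  have "g -` S \<inter> half_plane \<in> sets lebesgue"
  proof (rule completion.in_sets_AE[OF _ fS])
    show "AE x in lebesgue. x \<in> f -` S \<inter> half_plane \<longleftrightarrow> x \<in> g -` S \<inter> half_plane"
      using AE unfolding AE_half_leb AE_completion_iff by eventually_elim auto
  qed auto
  then show "g -` S \<inter> space half_leb \<in> sets half_leb"
    unfolding space_half_leb by (subst sets_restrict_space_iff) auto
qed auto

text \<open>Admissible functions are Lebesgue measurable and nonnegative almost everywhere, whereas
  polarization and lifting are carried out for Borel functions that are nonnegative
  everywhere.\<close>

lemma half_leb_borel_representative:
  fixes \<omega> :: "real \<times> real \<Rightarrow> real"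
  assumes \<omega>: "\<omega> \<in> borel_measurable half_leb" and nonneg: "AE x in half_leb. 0 \<le> \<omega> x"
  obtains \<omega>' where "\<omega>' \<in> borel_measurable borel" "\<And>x. 0 \<le> \<omega>' x" "AE x in half_leb. \<omega> x = \<omega>' x"
proof -
  have "(\<lambda>x. if x \<in> half_plane then \<omega> x else 0) \<in> borel_measurable lebesgue"
    using \<omega> by (simp add: borel_measurable_if)
  from completion_ex_borel_measurable_real[OF this] obtain g where g: "g \<in> borel_measurable lborel"
    "AE x in lborel. (if x \<in> half_plane then \<omega> x else 0) = g x" by blast
  show ?thesis
  proof (rule that[of "\<lambda>x. max 0 (g x)"])
    show "(\<lambda>x. max 0 (g x)) \<in> borel_measurable borel" using g(1) by simp
    show "AE x in half_leb. \<omega> x = max 0 (g x)"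
      using g(2) nonneg unfolding AE_half_leb by eventually_elim auto
  qed simp
qed

section \<open>The functionals of the problem on Borel representatives\<close>

definition representative :: "(real \<times> real \<Rightarrow> real) \<Rightarrow> (real \<times> real \<Rightarrow> real) \<Rightarrow> bool" where
  "representative \<omega> \<omega>' \<longleftrightarrow> \<omega> \<in> borel_measurable half_leb \<and> \<omega>' \<in> borel_measurable borel \<and> (\<forall>x. 0 \<le> \<omega>' x)
     \<and> (AE x in half_leb. \<omega> x = \<omega>' x)"

definition half_moment :: "(real \<times> real \<Rightarrow> real) \<Rightarrow> ennreal" where
  "half_moment \<omega> = (\<integral>\<^sup>+x. ennreal (snd x * \<omega> x) * indicator half_plane x \<partial>lborel)"

definition half_mass :: "(real \<times> real \<Rightarrow> real) \<Rightarrow> ennreal" where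
  "half_mass \<omega> = (\<integral>\<^sup>+x. ennreal (\<omega> x) * indicator half_plane x \<partial>lborel)"

definition half_square :: "(real \<times> real \<Rightarrow> real) \<Rightarrow> ennreal" where
  "half_square \<omega> = (\<integral>\<^sup>+x. ennreal ((\<omega> x)\<^sup>2) * indicator half_plane x \<partial>lborel)"

definition half_energy :: "(real \<times> real \<Rightarrow> real) \<Rightarrow> ennreal" where
  "half_energy \<omega> = (\<integral>\<^sup>+x. \<integral>\<^sup>+y. ennreal (G x y * \<omega> x * \<omega> y) * indicator half_plane x * indicator half_plane y \<partial>lborel \<partial>lborel)"

text \<open>The bridge from Bochner integrals to extended nonnegative integrals. The formula for the
  value covers the divergent case as well, where both sides are zero by convention.\<close>

lemma half_leb_integral_iff:
  assumes F: "F \<in> borel_measurable half_leb" and F': "F' \<in> borel_measurable borel"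
    and eq: "AE x in half_leb. F x = F' x" and nonneg: "\<And>x. x \<in> half_plane \<Longrightarrow> 0 \<le> F' x"
  shows "integrable half_leb F \<longleftrightarrow> (\<integral>\<^sup>+x. ennreal (F' x) * indicator half_plane x \<partial>lborel) < \<infinity>"
    and "(\<integral>x. F x \<partial>half_leb) = enn2real (\<integral>\<^sup>+x. ennreal (F' x) * indicator half_plane x \<partial>lborel)"
proof -
  have AE0: "AE x in half_leb. 0 \<le> F x"
    using eq nonneg unfolding AE_half_leb by (auto elim: eventually_mono)
  have nn: "(\<integral>\<^sup>+x. ennreal (F x) \<partial>half_leb) = (\<integral>\<^sup>+x. ennreal (F' x) * indicator half_plane x \<partial>lborel)"
    unfolding nn_integral_half_leb[symmetric]
    by (rule nn_integral_cong_AE) (use eq in \<open>eventually_elim, simp\<close>)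
  show "(\<integral>x. F x \<partial>half_leb) = enn2real (\<integral>\<^sup>+x. ennreal (F' x) * indicator half_plane x \<partial>lborel)"
    unfolding nn[symmetric] by (rule integral_eq_nn_integral[OF F AE0])
  show "integrable half_leb F \<longleftrightarrow> (\<integral>\<^sup>+x. ennreal (F' x) * indicator half_plane x \<partial>lborel) < \<infinity>"
  proof
    assume "integrable half_leb F"
    then show "(\<integral>\<^sup>+x. ennreal (F' x) * indicator half_plane x \<partial>lborel) < \<infinity>"
      using nn_integral_eq_integral[OF _ AE0] nn by simp
  next
    assume "(\<integral>\<^sup>+x. ennreal (F' x) * indicator half_plane x \<partial>lborel) < \<infinity>"
    then show "integrable half_leb F" using nn by (intro integrableI_nonneg F AE0) simp
  qed
qed

lemma admissible_iff:
  assumes rep: "representative \<omega> \<omega>'" and \<mu>: "0 < \<mu>" and \<nu>: "0 < \<nu>"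
  shows "\<omega> \<in> admissible \<mu> \<nu> \<longleftrightarrow> half_moment \<omega>' = ennreal \<mu> \<and> half_mass \<omega>' \<le> ennreal \<nu> \<and> half_square \<omega>' < \<infinity>"
proof -
  have m: "\<omega> \<in> borel_measurable half_leb" and m'[measurable]: "\<omega>' \<in> borel_measurable borel"
    and nn: "\<And>x. 0 \<le> \<omega>' x" and eq: "AE x in half_leb. \<omega> x = \<omega>' x" using rep by (auto simp: representative_def)
  have [measurable]: "\<omega> \<in> borel_measurable half_leb" "snd \<in> borel_measurable half_leb"
    using m borel_imp_half_leb[OF snd_borel] by auto
  have AE0: "AE x in half_leb. 0 \<le> \<omega> x" using eq nn by (auto elim: eventually_mono)
  have sq: "integrable half_leb (\<lambda>x. (\<omega> x)\<^sup>2) \<longleftrightarrow> half_square \<omega>' < \<infinity>"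
    unfolding half_square_def by (rule half_leb_integral_iff) (use eq in \<open>auto elim: eventually_mono\<close>)
  have ms: "integrable half_leb \<omega> \<longleftrightarrow> half_mass \<omega>' < \<infinity>" "(\<integral>x. \<omega> x \<partial>half_leb) = enn2real (half_mass \<omega>')"
    unfolding half_mass_def by (rule half_leb_integral_iff[OF m m' eq nn])+
  have prod: "(\<lambda>x. snd x * \<omega> x) \<in> borel_measurable half_leb" "(\<lambda>x. snd x * \<omega>' x) \<in> borel_measurable borel"
    by measurable
  have peq: "AE x in half_leb. snd x * \<omega> x = snd x * \<omega>' x" using eq by eventually_elim simp
  have pnn: "x \<in> half_plane \<Longrightarrow> 0 \<le> snd x * \<omega>' x" for x using nn[of x] by (simp add: half_plane_def)
  have mo: "integrable half_leb (\<lambda>x. snd x * \<omega> x) \<longleftrightarrow> half_moment \<omega>' < \<infinity>"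
    "(\<integral>x. snd x * \<omega> x \<partial>half_leb) = enn2real (half_moment \<omega>')"
    unfolding half_moment_def
    by (rule half_leb_integral_iff[OF prod peq pnn], assumption)+
  have 1: "half_moment \<omega>' < \<infinity> \<and> enn2real (half_moment \<omega>') = \<mu> \<longleftrightarrow> half_moment \<omega>' = ennreal \<mu>"
    using \<mu> by (cases "half_moment \<omega>'") auto
  have 2: "half_mass \<omega>' < \<infinity> \<and> enn2real (half_mass \<omega>') \<le> \<nu> \<longleftrightarrow> half_mass \<omega>' \<le> ennreal \<nu>"
    using \<nu> by (cases "half_mass \<omega>'") (auto simp: top_unique)
  show ?thesis
    unfolding admissible_def L2_half_def mem_Collect_eq sq ms mo using m AE0 1 2 by auto
qed

text \<open>A finite double integral makes the inner integrals finite for almost every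
  \<open>x\<close> of the half-plane, so the Bochner integrals do not fall back to their default
  value zero.\<close>

lemma energy_eq:
  assumes rep: "representative \<omega> \<omega>'" and fin: "half_energy \<omega>' < \<infinity>"
  shows "energy \<omega> = 1 / 2 * enn2real (half_energy \<omega>')"
proof -
  have m: "\<omega> \<in> borel_measurable half_leb" and m'[measurable]: "\<omega>' \<in> borel_measurable borel"
    and nn: "\<And>x. 0 \<le> \<omega>' x" and eq: "AE x in half_leb. \<omega> x = \<omega>' x" using rep by (auto simp: representative_def)
  define I where "I x = (\<integral>y. G x y * \<omega> x * \<omega> y \<partial>half_leb)" for x
  define P where "P x = (\<integral>\<^sup>+y. ennreal (G x y * \<omega>' x * \<omega>' y) * indicator half_plane y \<partial>lborel)" for x
  have [measurable]: "P \<in> borel_measurable borel" unfolding P_def[abs_def] by measurable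
  have IP: "AE x in half_leb. I x = enn2real (P x)"
    using eq AE_space
  proof eventually_elim
    case (elim x)
    then have x: "x \<in> half_plane" by (simp add: space_half_leb)
    have [measurable]: "G x \<in> borel_measurable borel" by measurable
    show ?case
      unfolding I_def P_def
    proof (rule half_leb_integral_iff(2))
      have "G x \<in> borel_measurable half_leb" by (rule borel_imp_half_leb) measurable
      then show "(\<lambda>y. G x y * \<omega> x * \<omega> y) \<in> borel_measurable half_leb" using m by simp
      show "AE y in half_leb. G x y * \<omega> x * \<omega> y = G x y * \<omega>' x * \<omega>' y"
        using eq by eventually_elim (use elim in simp)
      show "0 \<le> G x y * \<omega>' x * \<omega>' y" if "y \<in> half_plane" for y
        using G_nonneg[OF x that] nn by simp
    qed measurable
  qed
  have E: "half_energy \<omega>' = (\<integral>\<^sup>+x. P x * indicator half_plane x \<partial>lborel)"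
    unfolding half_energy_def P_def
    by (intro nn_integral_cong) (auto simp: indicator_def)
  have Pfin: "AE x in half_leb. P x < top"
  proof -
    have "AE x in lborel. P x * indicator half_plane x \<noteq> \<infinity>"
      by (rule nn_integral_noteq_infinite) (use fin E in auto)
    then show ?thesis unfolding AE_half_leb by eventually_elim (auto simp: less_top)
  qed
  have Im: "I \<in> borel_measurable half_leb"
  proof (rule half_leb_measurable_AE)
    show "(\<lambda>x. enn2real (P x)) \<in> borel_measurable half_leb" by (rule borel_imp_half_leb) measurable
    show "AE x in half_leb. enn2real (P x) = I x" using IP by eventually_elim simp
  qed
  have "(\<integral>x. I x \<partial>half_leb) = enn2real (\<integral>\<^sup>+x. ennreal (enn2real (P x)) * indicator half_plane x \<partial>lborel)"
    by (rule half_leb_integral_iff(2)[OF Im _ IP]) auto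
  also have "(\<integral>\<^sup>+x. ennreal (enn2real (P x)) * indicator half_plane x \<partial>lborel) = half_energy \<omega>'"
    unfolding E
  proof (rule nn_integral_cong_AE)
    show "AE x in lborel. ennreal (enn2real (P x)) * indicator half_plane x = P x * indicator half_plane x"
      using Pfin unfolding AE_half_leb by eventually_elim (auto simp: indicator_def)
  qed
  finally show ?thesis unfolding energy_def I_def by simp
qed

lemma lift_integrals:
  assumes [measurable]: "\<omega> \<in> borel_measurable borel" and nn: "\<And>x. 0 \<le> \<omega> x"
  shows "(\<integral>\<^sup>+z. ennreal (lift \<omega> z) \<partial>lborel) = ennreal (4 * pi) * half_moment \<omega>"
    and "(\<integral>\<^sup>+z. ennreal ((lift \<omega> z)\<^sup>2) \<partial>lborel) = ennreal (4 * pi) * half_square \<omega>"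
    and "riesz coulomb (lift \<omega>) = ennreal (16 * pi ^ 3) * half_energy \<omega>"
proof -
  have "(\<integral>\<^sup>+z. ennreal (lift \<omega> z) \<partial>lborel)
    = (\<integral>\<^sup>+x. ennreal (4 * pi * (snd x)\<^sup>2) * ennreal (\<omega> x / snd x) * indicator half_plane x \<partial>lborel)"
    unfolding lift_def
    by (subst nn_integral_axisymmetric[of "\<lambda>x. ennreal (\<omega> x / snd x)", symmetric]) auto
  also have "\<dots> = (\<integral>\<^sup>+x. ennreal (4 * pi) * (ennreal (snd x * \<omega> x) * indicator half_plane x) \<partial>lborel)"
  proof (rule nn_integral_cong)
    fix x :: "real \<times> real"
    have "4 * pi * (snd x)\<^sup>2 * (\<omega> x / snd x) = 4 * pi * (snd x * \<omega> x)" if "0 < snd x"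
      using that by (simp add: power2_eq_square)
    then show "ennreal (4 * pi * (snd x)\<^sup>2) * ennreal (\<omega> x / snd x) * indicator half_plane x
      = ennreal (4 * pi) * (ennreal (snd x * \<omega> x) * indicator half_plane x)"
      using nn by (auto simp: indicator_def half_plane_def ennreal_mult'[symmetric])
  qed
  also have "\<dots> = ennreal (4 * pi) * half_moment \<omega>"
    unfolding half_moment_def by (rule nn_integral_cmult) measurable
  finally show "(\<integral>\<^sup>+z. ennreal (lift \<omega> z) \<partial>lborel) = ennreal (4 * pi) * half_moment \<omega>" .
  have "(\<integral>\<^sup>+z. ennreal ((lift \<omega> z)\<^sup>2) \<partial>lborel)
    = (\<integral>\<^sup>+x. ennreal (4 * pi * (snd x)\<^sup>2) * ennreal ((\<omega> x / snd x)\<^sup>2) * indicator half_plane x \<partial>lborel)"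
    unfolding lift_def
    by (subst nn_integral_axisymmetric[of "\<lambda>x. ennreal ((\<omega> x / snd x)\<^sup>2)", symmetric]) auto
  also have "\<dots> = (\<integral>\<^sup>+x. ennreal (4 * pi) * (ennreal ((\<omega> x)\<^sup>2) * indicator half_plane x) \<partial>lborel)"
  proof (rule nn_integral_cong)
    fix x :: "real \<times> real"
    have "4 * pi * (snd x)\<^sup>2 * (\<omega> x / snd x)\<^sup>2 = 4 * pi * (\<omega> x)\<^sup>2" if "0 < snd x"
      using that by (simp add: power_divide)
    then show "ennreal (4 * pi * (snd x)\<^sup>2) * ennreal ((\<omega> x / snd x)\<^sup>2) * indicator half_plane x
      = ennreal (4 * pi) * (ennreal ((\<omega> x)\<^sup>2) * indicator half_plane x)"
      by (auto simp: indicator_def half_plane_def ennreal_mult'[symmetric])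
  qed
  also have "\<dots> = ennreal (4 * pi) * half_square \<omega>"
    unfolding half_square_def by (rule nn_integral_cmult) measurable
  finally show "(\<integral>\<^sup>+z. ennreal ((lift \<omega> z)\<^sup>2) \<partial>lborel) = ennreal (4 * pi) * half_square \<omega>" .
  show "riesz coulomb (lift \<omega>) = ennreal (16 * pi ^ 3) * half_energy \<omega>"
    unfolding half_energy_def by (rule riesz_lift[OF assms])
qed

text \<open>Null sets return from four dimensions to the half-plane because the sphere area is
  positive there.\<close>

lemma AE_axisymmetric:
  fixes P :: "real \<times> real \<Rightarrow> bool"
  assumes [measurable]: "Measurable.pred borel P"
    and AE: "AE z in lborel. P (fst z, norm (snd (z :: r4)))"
  shows "AE x in lborel. x \<in> half_plane \<longrightarrow> P x"
proof -
  define H where "H x = (if P x then 0 else 1 :: ennreal)" for x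
  have [measurable]: "H \<in> borel_measurable borel" unfolding H_def[abs_def] by measurable
  have "(\<integral>\<^sup>+x. ennreal (4 * pi * (snd x)\<^sup>2) * H x * indicator half_plane x \<partial>lborel)
    = (\<integral>\<^sup>+z. H (fst z, norm (snd (z :: r4))) \<partial>lborel)"
    by (rule nn_integral_axisymmetric[symmetric]) measurable
  also have "\<dots> = (\<integral>\<^sup>+z. 0 \<partial>(lborel :: r4 measure))"
    by (rule nn_integral_cong_AE) (use AE in \<open>eventually_elim, simp add: H_def\<close>)
  finally have "AE x in lborel. ennreal (4 * pi * (snd x)\<^sup>2) * H x * indicator half_plane x = 0"
    by (simp add: nn_integral_0_iff_AE)
  then show ?thesis
    by eventually_elim (use pi_gt_zero in \<open>auto simp: H_def half_plane_def indicator_def ennreal_eq_0_iff mult_le_0_iff split: if_splits\<close>)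
qed

section \<open>The optimal value of the penalized energy\<close>

locale lamb_setting =
  fixes lam :: real
  assumes lam: "0 < lam"

sublocale lamb_setting \<subseteq> hardy_profile "lamb_n0 lam" "lamb_N0 lam" "bessel_c0\<^sup>2 / lam" "4 / lam"
  by (rule lamb_hardy_profile[OF lam])

context lamb_setting
begin

text \<open>The mass term (4 pi \<mu>)^2 / a^2 of the sharp bound, divided by 32 pi^3.\<close>

definition optimal_value :: "real \<Rightarrow> real" where
  "optimal_value \<mu> = \<mu>\<^sup>2 * lam / (2 * pi * bessel_c0\<^sup>2)"

text \<open>After division by \<open>32 * pi ^ 3\<close> the square-norm term of the sharp
  inequality is exactly the penalization. What remains is a bound by a constant depending only on
  \<open>\<mu>\<close> and \<open>lam\<close>, and equality in it is extremality of the
  lift.\<close>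

lemma penalized_energy_bound:
  assumes rep: "representative \<omega> \<omega>'" and \<mu>: "0 < \<mu>"
    and mom: "half_moment \<omega>' = ennreal \<mu>" and sq: "half_square \<omega>' < \<infinity>"
  shows "penalized_energy lam \<omega> \<le> optimal_value \<mu>"
    and "penalized_energy lam \<omega> = optimal_value \<mu> \<longleftrightarrow> extremal (lift \<omega>')"
proof -
  have m: "\<omega> \<in> borel_measurable half_leb" and m'[measurable]: "\<omega>' \<in> borel_measurable borel"
    and nn: "\<And>x. 0 \<le> \<omega>' x" and eq: "AE x in half_leb. \<omega> x = \<omega>' x" using rep by (auto simp: representative_def)
  have c0: "0 < bessel_c0" by (rule bessel_c0_properties)
  have l0: "0 \<le> lift \<omega>' z" for z by (simp add: lift_def nn)
  obtain S where S: "half_square \<omega>' = ennreal S" "0 \<le> S" using sq by (cases "half_square \<omega>'") auto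
  define B where "B = 16 * pi ^ 3 * S / lam + 16 * pi\<^sup>2 * \<mu>\<^sup>2 * lam / bessel_c0\<^sup>2"
  have B0: "0 \<le> B" using S lam by (simp add: B_def)
  have sb: "sharp_bound (lift \<omega>') = ennreal B"
  proof -
    have "sharp_bound (lift \<omega>') = ennreal (4 / lam * pi\<^sup>2) * (ennreal (4 * pi) * ennreal S)
      + ennreal (1 / (bessel_c0\<^sup>2 / lam)) * (ennreal (4 * pi) * ennreal \<mu>)\<^sup>2"
      unfolding sharp_bound_def lift_integrals[OF m' nn] S mom ..
    also have "\<dots> = ennreal (4 / lam * pi\<^sup>2 * (4 * pi * S) + 1 / (bessel_c0\<^sup>2 / lam) * (4 * pi * \<mu>)\<^sup>2)"
      using S lam \<mu> by (simp add: ennreal_mult'[symmetric] ennreal_power ennreal_plus[symmetric] del: ennreal_plus)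
    also have "4 / lam * pi\<^sup>2 * (4 * pi * S) + 1 / (bessel_c0\<^sup>2 / lam) * (4 * pi * \<mu>)\<^sup>2 = B"
      by (simp add: B_def power2_eq_square power3_eq_cube mult_ac)
    finally show ?thesis .
  qed
  have ri: "riesz coulomb (lift \<omega>') = ennreal (16 * pi ^ 3) * half_energy \<omega>'"
    by (rule lift_integrals(3)[OF m' nn])
  have le: "riesz coulomb (lift \<omega>') \<le> ennreal B"
    unfolding sb[symmetric] by (rule sharp_inequality) (simp_all add: l0)
  then have "riesz coulomb (lift \<omega>') < top" by (rule le_less_trans) simp
  then have "half_energy \<omega>' < \<infinity>" using pi_gt_zero unfolding ri by (auto simp: ennreal_mult_less_top)
  then obtain E where E: "half_energy \<omega>' = ennreal E" "0 \<le> E" by (cases "half_energy \<omega>'") auto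
  have r2: "riesz coulomb (lift \<omega>') = ennreal (16 * pi ^ 3 * E)"
    unfolding ri E by (simp add: ennreal_mult'[symmetric])
  have EB: "16 * pi ^ 3 * E \<le> B" using le B0 unfolding r2 by simp
  have en: "energy \<omega> = E / 2" using energy_eq[OF rep] E by simp
  have sqi: "(\<integral>x. (\<omega> x)\<^sup>2 \<partial>half_leb) = S"
  proof -
    have "(\<integral>x. (\<omega> x)\<^sup>2 \<partial>half_leb) = enn2real (half_square \<omega>')"
      unfolding half_square_def
      by (rule half_leb_integral_iff(2)) (use m eq in \<open>auto elim: eventually_mono\<close>)
    then show ?thesis using S by simp
  qed
  have diff: "optimal_value \<mu> - penalized_energy lam \<omega> = (B - 16 * pi ^ 3 * E) / (32 * pi ^ 3)"
    unfolding penalized_energy_def en sqi optimal_value_def B_def using lam c0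
    by (simp add: field_simps power2_eq_square power3_eq_cube)
  show "penalized_energy lam \<omega> \<le> optimal_value \<mu>"
  proof -
    have "0 \<le> (B - 16 * pi ^ 3 * E) / (32 * pi ^ 3)" using EB by (intro divide_nonneg_pos) auto
    then show ?thesis using diff by simp
  qed
  have "penalized_energy lam \<omega> = optimal_value \<mu> \<longleftrightarrow> B = 16 * pi ^ 3 * E"
    using diff by auto
  also have "\<dots> \<longleftrightarrow> B \<le> 16 * pi ^ 3 * E" using EB by auto
  also have "\<dots> \<longleftrightarrow> extremal (lift \<omega>')"
    unfolding extremal_def sb r2 using l0 E by auto
  finally show "penalized_energy lam \<omega> = optimal_value \<mu> \<longleftrightarrow> extremal (lift \<omega>')" .
qed

lemma lamb_N0_radius: "lamb_N0 lam (bessel_c0\<^sup>2 / lam) = - (4 * bessel_c0\<^sup>2 / lam\<^sup>2 * bessel_J 0 bessel_c0)"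
  using lam bessel_c0_properties(2) by (simp add: lamb_N0_def bessel_J_0 power2_eq_square)

text \<open>Used in two ways: the total mass pins down the factor of a given extremal profile, and
  the second part shows that the lift of the dipole is extremal.\<close>

lemma profile_total:
  assumes \<kappa>: "0 \<le> \<kappa>"
    and f: "AE x in lborel. f x = (if (norm x)\<^sup>2 < bessel_c0\<^sup>2 / lam then \<kappa> * lamb_n0 lam ((norm x)\<^sup>2) / (pi\<^sup>2 * (norm x)\<^sup>2) else 0)"
    and fm: "f \<in> borel_measurable borel" and f0: "\<And>x. 0 \<le> f x"
  shows "(\<integral>\<^sup>+x. ennreal (f x) \<partial>lborel) = ennreal (\<kappa> * lamb_N0 lam (bessel_c0\<^sup>2 / lam))"
    and "(\<integral>\<^sup>+x. ennreal ((f x)\<^sup>2) \<partial>lborel) < \<infinity> \<Longrightarrow> extremal f"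
proof -
  let ?A = "bessel_c0\<^sup>2 / lam"
  define h where "h v = (if 0 < v \<and> v < ?A then \<kappa> * lamb_n0 lam v / (pi\<^sup>2 * v) else 0)" for v
  have hm: "h \<in> borel_measurable borel" unfolding h_def[abs_def] by measurable
  have h0: "0 \<le> h v" for v using \<kappa> n0_pos[of v] by (auto simp: h_def)
  define g where "g x = h ((norm x)\<^sup>2)" for x :: r4
  have fg: "AE x in lborel. f x = g x"
    using f AE_lborel_singleton[of "0 :: r4"] by eventually_elim (auto simp: g_def h_def)
  have sp: "shell_profile h v = (if 0 < v \<and> v < ?A then \<kappa> * lamb_n0 lam v else 0)" for v
    by (simp add: shell_profile_def h_def)
  have spm: "shell_profile h \<in> borel_measurable borel" using hm by measurable
  have "(\<integral>\<^sup>+x. ennreal (f x) \<partial>lborel) = (\<integral>\<^sup>+x. ennreal (g x) \<partial>lborel)"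
    by (rule nn_integral_cong_AE) (use fg in \<open>eventually_elim, simp\<close>)
  also have "\<dots> = ennreal (\<kappa> * lamb_N0 lam ?A)"
    unfolding radial_integrals(2)[OF hm h0 g_def] by (rule shell_attained(1)[OF spm \<kappa> sp])
  finally show tot: "(\<integral>\<^sup>+x. ennreal (f x) \<partial>lborel) = ennreal (\<kappa> * lamb_N0 lam ?A)" .
  assume fin: "(\<integral>\<^sup>+x. ennreal ((f x)\<^sup>2) \<partial>lborel) < \<infinity>"
  have "riesz coulomb g = sharp_bound g"
    unfolding sharp_bound_radial[OF hm h0 g_def] radial_integrals(1)[OF hm h0 g_def]
    by (rule shell_attained(2)[OF spm \<kappa> sp])
  then have "riesz coulomb f = sharp_bound f"
    unfolding riesz_cong_AE[OF fg] sharp_bound_cong_AE[OF fg] .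
  moreover have "sharp_bound f < top"
    using fin lam bessel_c0_properties(1) unfolding sharp_bound_def tot
    by (simp add: ennreal_mult_less_top power2_eq_square)
  ultimately show "extremal f" using fm f0 by (simp add: extremal_def)
qed

end

section \<open>Admissibility of the dipole and identification of the minimizers\<close>

lemma j1_bounded_below_zero:
  obtains B where "1 \<le> B" "\<And>u. 0 \<le> u \<Longrightarrow> u < bessel_c0\<^sup>2 / 4 \<Longrightarrow> j1 u \<le> B"
proof -
  have "bounded (j1 ` {0..bessel_c0\<^sup>2 / 4})"
    by (intro compact_imp_bounded compact_continuous_image continuous_j1) auto
  then obtain b where b: "\<forall>u\<in>{0..bessel_c0\<^sup>2 / 4}. \<bar>j1 u\<bar> \<le> b"
    unfolding bounded_iff by auto
  show ?thesis
    by (rule that[of "max 1 b"]) (use b in \<open>force simp: abs_le_iff le_max_iff_disj\<close>)+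
qed

text \<open>A crude bound suffices. Since \<open>B\<close> is absolute, the mass bound it implies is
  an absolute multiple of \<mu> times the square root of \<open>lam\<close>, which is the scaling of
  the smallness condition.\<close>

lemma lamb_rep_le:
  assumes lam: "0 < lam" and W: "0 < W" and B: "1 \<le> B" "\<And>u. 0 \<le> u \<Longrightarrow> u < bessel_c0\<^sup>2 / 4 \<Longrightarrow> j1 u \<le> B"
  shows "lamb_rep lam W x \<le> lamb_amplitude lam W * (bessel_c0 / sqrt lam) * B * indicator (ball 0 (bessel_c0 / sqrt lam)) x"
proof (cases "(norm x)\<^sup>2 < bessel_c0\<^sup>2 / lam")
  case False
  then show ?thesis
    using lamb_amplitude_pos[OF lam W] bessel_c0_properties(1) lam B(1) by (simp add: lamb_rep_def)
next
  case True
  let ?a = "bessel_c0 / sqrt lam"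
  have a: "0 < ?a" "?a\<^sup>2 = bessel_c0\<^sup>2 / lam" using bessel_c0_properties(1) lam by (simp_all add: power_divide)
  have n: "norm x < ?a" using True a by (intro power_less_imp_less_base[of "norm x" 2 ?a]) auto
  have "\<bar>snd x\<bar> \<le> norm x" using norm_snd_le[of "snd x" "fst x"] by simp
  then have s: "max 0 (snd x) \<le> ?a" using n a(1) by auto
  have j: "j1 (lam * (norm x)\<^sup>2 / 4) \<le> B" "0 \<le> j1 (lam * (norm x)\<^sup>2 / 4)"
    using B(2)[of "lam * (norm x)\<^sup>2 / 4"] lamb_argument(1)[OF lam, of "(norm x)\<^sup>2"] True lam
      j1_nonneg_below[OF lam, of "(norm x)\<^sup>2"] by auto
  have "lamb_amplitude lam W * max 0 (snd x) * j1 (lam * (norm x)\<^sup>2 / 4) \<le> lamb_amplitude lam W * ?a * B"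
  proof (intro mult_mono mult_left_mono s j)
    show "0 \<le> lamb_amplitude lam W * ?a" using lamb_amplitude_pos[OF lam W] a(1) by (intro mult_nonneg_nonneg) auto
  qed (use lamb_amplitude_pos[OF lam W] B(1) in auto)
  then show ?thesis using True n by (simp add: lamb_rep_def)
qed

lemma emeasure_plane_ball: "0 \<le> r \<Longrightarrow> emeasure lborel (ball (0 :: real \<times> real) r) = ennreal (pi * r\<^sup>2)"
  by (subst emeasure_ball) (simp_all only: DIM_2 of_nat_numeral unit_ball_vol_2)

lemma half_integral_bound:
  fixes f :: "real \<times> real \<Rightarrow> real"
  assumes "\<And>x. f x \<le> K * indicator (ball 0 r) x" "0 \<le> K" "0 \<le> r"
  shows "(\<integral>\<^sup>+x. ennreal (f x) * indicator half_plane x \<partial>lborel) \<le> ennreal (K * (pi * r\<^sup>2))"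
proof -
  have [measurable]: "ball (0 :: real \<times> real) r \<in> sets borel" by simp
  have "(\<integral>\<^sup>+x. ennreal (f x) * indicator half_plane x \<partial>lborel) \<le> (\<integral>\<^sup>+x. ennreal K * indicator (ball (0 :: real \<times> real) r) x \<partial>lborel)"
  proof (rule nn_integral_mono)
    fix x :: "real \<times> real"
    have "ennreal (f x) \<le> ennreal (K * indicator (ball 0 r) x)" by (intro ennreal_leI assms)
    also have "\<dots> = ennreal K * indicator (ball 0 r) x" by (simp add: indicator_def)
    finally show "ennreal (f x) * indicator half_plane x \<le> ennreal K * indicator (ball 0 r) x"
      by (auto simp: indicator_def split: if_splits)
  qed
  also have "\<dots> = ennreal K * emeasure lborel (ball (0 :: real \<times> real) r)" by (rule nn_integral_cmult_indicator) simp
  also have "\<dots> = ennreal (K * (pi * r\<^sup>2))"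
    using assms by (simp add: emeasure_plane_ball ennreal_mult')
  finally show ?thesis .
qed

text \<open>Boundary points translate along the axis, which preserves the half-plane and the weight
  \<open>snd x\<close>.\<close>

lemma half_integrals_translate:
  assumes [measurable]: "\<omega> \<in> borel_measurable borel" and y: "y \<in> half_plane_boundary"
  shows "half_moment (\<lambda>x. \<omega> (x + y)) = half_moment \<omega>" "half_mass (\<lambda>x. \<omega> (x + y)) = half_mass \<omega>"
    "half_square (\<lambda>x. \<omega> (x + y)) = half_square \<omega>"
proof -
  have s: "snd (x + y) = snd x" "indicator half_plane (x + y) = (indicator half_plane x :: ennreal)" for x
    using y by (auto simp: half_plane_boundary_def half_plane_def indicator_def)
  show "half_moment (\<lambda>x. \<omega> (x + y)) = half_moment \<omega>"
    unfolding half_moment_def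
    using nn_integral_lborel_translate[of "\<lambda>x. ennreal (snd x * \<omega> x) * indicator half_plane x" y] by (simp only: s) simp
  show "half_mass (\<lambda>x. \<omega> (x + y)) = half_mass \<omega>"
    unfolding half_mass_def
    using nn_integral_lborel_translate[of "\<lambda>x. ennreal (\<omega> x) * indicator half_plane x" y] by (simp only: s) simp
  show "half_square (\<lambda>x. \<omega> (x + y)) = half_square \<omega>"
    unfolding half_square_def
    using nn_integral_lborel_translate[of "\<lambda>x. ennreal ((\<omega> x)\<^sup>2) * indicator half_plane x" y] by (simp only: s) simp
qed

lemma lift_translate: "lift (\<lambda>x. \<omega> (x + (t, 0))) = (\<lambda>z. lift \<omega> (z + (t, 0)))"
  by (rule ext) (simp add: lift_def)

lemma AE_lborel_translate:
  fixes a :: "'a::euclidean_space"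
  assumes "AE x in lborel. P x" and [measurable]: "Measurable.pred borel P"
  shows "AE x in lborel. P (x + a)"
proof -
  have "AE x in distr lborel borel ((+) a). P x" unfolding lborel_distr_plus by (rule assms(1))
  then have "AE x in lborel. P (a + x)" by (subst (asm) AE_distr_iff) auto
  then show ?thesis by (simp add: add.commute)
qed

lemma quotient_ae_eq: "S // ae_eq = {ae_eq `` {\<omega>} | \<omega>. \<omega> \<in> S}"
  by (auto simp: quotient_def)

lemma ae_eq_class_eqI:
  assumes "f \<in> borel_measurable half_leb" "g \<in> borel_measurable half_leb" "AE x in half_leb. f x = g x"
  shows "ae_eq `` {f} = ae_eq `` {g}"
proof -
  have "(AE x in half_leb. f x = h x) \<longleftrightarrow> (AE x in half_leb. g x = h x)" for h
    using assms(3) by (auto elim: eventually_elim2)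
  then show ?thesis using assms(1,2) by (auto simp: ae_eq_def)
qed

theorem theorem1p5:
  "\<exists>M1::real. M1 > 0 \<and>
     (\<forall>\<mu> \<nu> lam W :: real.
        0 < \<mu> \<longrightarrow> 0 < \<nu> \<longrightarrow> 0 < lam \<longrightarrow>
        \<mu> * inverse \<nu> * lam powr (1 / 2) \<le> M1 \<longrightarrow>
        W = \<mu> * lam / (bessel_c0\<^sup>2 * pi) \<longrightarrow>
        minimizers \<mu> \<nu> lam =
          {ae_eq `` {\<lambda>x. lamb_dipole lam W (x + y)} | y. y \<in> half_plane_boundary})"
proof -
  obtain B where B: "1 \<le> B" "\<And>u. 0 \<le> u \<Longrightarrow> u < bessel_c0\<^sup>2 / 4 \<Longrightarrow> j1 u \<le> B"
    using j1_bounded_below_zero by blast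
  have c0: "0 < bessel_c0" by (rule bessel_c0_properties)
  have J0: "bessel_J 0 bessel_c0 < 0" by (rule bessel_J_0_c0_neg)
  show ?thesis
  \<comment> \<open>With the prescribed \<open>W\<close>, the crude mass bound
    \<open>k * a * B * (pi * a\<^sup>2)\<close> of the dipole equals \<mu> sqrt(lam) c0 B / (-
    J0(c0)); the constant is chosen so that this is at most \<nu>.\<close>
  proof (intro exI[of _ "- bessel_J 0 bessel_c0 / (bessel_c0 * B)"] conjI allI impI)
    show "0 < - bessel_J 0 bessel_c0 / (bessel_c0 * B)" using c0 J0 B(1) by (simp add: divide_less_0_iff)
    fix \<mu> \<nu> lam W :: real
    assume \<mu>: "0 < \<mu>" and \<nu>: "0 < \<nu>" and lam: "0 < lam"
      and small: "\<mu> * inverse \<nu> * lam powr (1 / 2) \<le> - bessel_J 0 bessel_c0 / (bessel_c0 * B)"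
      and W_eq: "W = \<mu> * lam / (bessel_c0\<^sup>2 * pi)"
    have W: "0 < W" unfolding W_eq using \<mu> lam c0 by simp
    interpret lamb_setting lam by standard (rule lam)
    define a where "a = bessel_c0 / sqrt lam"
    have a: "0 < a" "a\<^sup>2 = bessel_c0\<^sup>2 / lam" using c0 lam by (simp_all add: a_def power_divide)
    define k where "k = lamb_amplitude lam W"
    have k: "0 < k" unfolding k_def by (rule lamb_amplitude_pos[OF lam W])
    define R where "R = lamb_rep lam W"
    have Rm[measurable]: "R \<in> borel_measurable borel" and R0: "0 \<le> R x" for x
      unfolding R_def using lamb_rep_nonneg[OF lam W] by auto
    have Rle: "R x \<le> k * a * B * indicator (ball 0 a) x" for x
      unfolding R_def k_def a_def by (rule lamb_rep_le[OF lam W B])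
    have K0: "0 \<le> k * a * B" using k a B(1) by simp
    \<comment> \<open>Here the prescribed value of \<open>W\<close> enters: it gives the lift the
      mass \<open>4 * pi * \<mu>\<close>, that is, the dipole the moment \<mu>.\<close>
    have totN: "pi\<^sup>2 * k * lamb_N0 lam (bessel_c0\<^sup>2 / lam) = 4 * pi * \<mu>"
      unfolding lamb_N0_radius k_def lamb_amplitude_def W_eq using J0 lam c0
      by (simp add: field_simps power2_eq_square)
    have liftR: "AE z in lborel. lift R z = (if (norm z)\<^sup>2 < bessel_c0\<^sup>2 / lam
        then (pi\<^sup>2 * k) * lamb_n0 lam ((norm z)\<^sup>2) / (pi\<^sup>2 * (norm z)\<^sup>2) else 0)"
      unfolding R_def k_def by (rule AE_lift_lamb_rep)
    have liftR0: "0 \<le> lift R z" for z by (simp add: lift_def R0)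
    have pk: "0 \<le> pi\<^sup>2 * k" using k by simp
    have Rmass: "half_mass R \<le> ennreal \<nu>"
    proof -
      have "half_mass R \<le> ennreal (k * a * B * (pi * a\<^sup>2))"
        unfolding half_mass_def using a by (intro half_integral_bound Rle K0) simp
      also have "k * a * B * (pi * a\<^sup>2) \<le> \<nu>"
      proof -
        have "\<mu> * sqrt lam * (bessel_c0 * B) \<le> - bessel_J 0 bessel_c0 * \<nu>"
          using small \<nu> c0 B(1) lam by (simp add: powr_half_sqrt field_simps)
        moreover have "k * a * B * (pi * a\<^sup>2) = \<mu> * sqrt lam * (bessel_c0 * B) / - bessel_J 0 bessel_c0"
        proof -
          have "lam = sqrt lam * sqrt lam" using lam by simp
          then have "k * a = lam * \<mu> * sqrt lam / (bessel_c0 * pi * - bessel_J 0 bessel_c0)"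
            unfolding k_def a_def lamb_amplitude_def W_eq using J0 lam c0
            by (simp add: divide_simps power2_eq_square)
          then have "k * a * B * (pi * a\<^sup>2)
            = lam * \<mu> * sqrt lam / (bessel_c0 * pi * - bessel_J 0 bessel_c0) * B * (pi * (bessel_c0\<^sup>2 / lam))"
            by (simp only: a(2))
          also have "\<dots> = \<mu> * sqrt lam * (bessel_c0 * B) / - bessel_J 0 bessel_c0"
            using J0 lam c0 by (simp add: power2_eq_square)
          finally show ?thesis .
        qed
        moreover have "0 < - bessel_J 0 bessel_c0" using J0 by simp
        ultimately show ?thesis
          using pos_divide_le_eq[of "- bessel_J 0 bessel_c0" "\<mu> * sqrt lam * (bessel_c0 * B)" \<nu>]
          by (simp only: mult.commute)
      qed
      finally show ?thesis by (simp add: ennreal_leI)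
    qed
    have Rsq: "half_square R < \<infinity>"
    proof -
      have "(R x)\<^sup>2 \<le> (k * a * B)\<^sup>2 * indicator (ball 0 a) x" for x
        using power_mono[OF Rle[of x] R0[of x], of 2] by (auto simp: indicator_def split: if_splits)
      then have "half_square R \<le> ennreal ((k * a * B)\<^sup>2 * (pi * a\<^sup>2))"
        unfolding half_square_def using a by (intro half_integral_bound) auto
      also have "\<dots> < \<infinity>" by simp
      finally show ?thesis .
    qed
    have Rmom: "half_moment R = ennreal \<mu>"
    proof -
      have "ennreal (4 * pi) * half_moment R = ennreal (4 * pi) * ennreal \<mu>"
        unfolding lift_integrals(1)[OF Rm R0, symmetric] profile_total(1)[OF pk liftR lift_measurable[OF Rm] liftR0] totN
        using \<mu> by (simp add: ennreal_mult)
      then show ?thesis by (simp add: ennreal_mult_cancel_left)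
    qed
    have exR: "extremal (lift R)"
    proof (rule profile_total(2)[OF pk liftR lift_measurable[OF Rm] liftR0])
      show "(\<integral>\<^sup>+z. ennreal ((lift R z)\<^sup>2) \<partial>lborel) < \<infinity>"
        unfolding lift_integrals(2)[OF Rm R0] using Rsq by (simp add: ennreal_mult_less_top)
    qed
    let ?L = "\<lambda>y x. lamb_dipole lam W (x + y)"
    have repL: "representative (?L y) (\<lambda>x. R (x + y))" if y: "y \<in> half_plane_boundary" for y
    proof -
      have AE: "AE x in half_leb. R (x + y) = ?L y x"
        using AE_space
      proof eventually_elim
        case (elim x)
        then have "x + y \<in> half_plane" using y by (auto simp: space_half_leb half_plane_def half_plane_boundary_def)
        then show ?case by (simp add: R_def lamb_dipole_eq_rep[OF lam W])
      qed
      have m: "(\<lambda>x. R (x + y)) \<in> borel_measurable borel" by measurable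
      show ?thesis
        unfolding representative_def
      proof (intro conjI allI m R0)
        show "?L y \<in> borel_measurable half_leb"
          by (rule half_leb_measurable_AE[OF borel_imp_half_leb[OF m] AE])
        show "AE x in half_leb. ?L y x = R (x + y)" using AE by eventually_elim simp
      qed
    qed
    define Opt where "Opt = {\<omega> \<in> admissible \<mu> \<nu>. penalized_energy lam \<omega> = optimal_value \<mu>}"
    have L_opt: "?L y \<in> Opt" if y: "y \<in> half_plane_boundary" for y
    proof -
      note tr = half_integrals_translate[OF Rm y]
      obtain t where t: "y = (t, 0)" using y by (auto simp: half_plane_boundary_def)
      have "?L y \<in> admissible \<mu> \<nu>"
        unfolding admissible_iff[OF repL[OF y] \<mu> \<nu>] tr using Rmom Rmass Rsq by simp
      moreover have "penalized_energy lam (?L y) = optimal_value \<mu>"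
      proof (subst penalized_energy_bound(2)[OF repL[OF y] \<mu>])
        show "half_moment (\<lambda>x. R (x + y)) = ennreal \<mu>" "half_square (\<lambda>x. R (x + y)) < \<infinity>"
          unfolding tr using Rmom Rsq by simp_all
        show "extremal (lift (\<lambda>x. R (x + y)))"
          unfolding t lift_translate by (rule extremal_translate[OF exR])
      qed
      ultimately show ?thesis by (simp add: Opt_def)
    qed
    have rep_ex: "\<exists>\<omega>'. representative \<omega> \<omega>' \<and> half_moment \<omega>' = ennreal \<mu> \<and> half_square \<omega>' < \<infinity>"
      if adm: "\<omega> \<in> admissible \<mu> \<nu>" for \<omega>
    proof -
      have "\<omega> \<in> borel_measurable half_leb" "AE x in half_leb. 0 \<le> \<omega> x"
        using adm by (auto simp: admissible_def L2_half_def)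
      then obtain \<omega>' where "representative \<omega> \<omega>'"
        using half_leb_borel_representative[of \<omega>] unfolding representative_def by metis
      then show ?thesis using admissible_iff[of \<omega> \<omega>' \<mu> \<nu>] adm \<mu> \<nu> by blast
    qed
    have upper: "penalized_energy lam \<omega> \<le> optimal_value \<mu>" if "\<omega> \<in> admissible \<mu> \<nu>" for \<omega>
      using rep_ex[OF that] penalized_energy_bound(1)[OF _ \<mu>] by blast
    have bd: "(0, 0) \<in> half_plane_boundary" by (simp add: half_plane_boundary_def)
    have "min_value \<mu> \<nu> lam = - optimal_value \<mu>"
      unfolding min_value_def
    proof (rule cInf_eq_minimum)
      show "- optimal_value \<mu> \<in> (\<lambda>\<omega>. - penalized_energy lam \<omega>) ` admissible \<mu> \<nu>"
        using L_opt[OF bd] unfolding Opt_def by (intro image_eqI[of _ _ "?L (0, 0)"]) auto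
      show "- optimal_value \<mu> \<le> v" if "v \<in> (\<lambda>\<omega>. - penalized_energy lam \<omega>) ` admissible \<mu> \<nu>" for v
        using that upper by auto
    qed
    then have min: "minimizers \<mu> \<nu> lam = {ae_eq `` {\<omega>} | \<omega>. \<omega> \<in> Opt}"
      unfolding minimizers_def quotient_ae_eq Opt_def by simp
    have "\<exists>y\<in>half_plane_boundary. ae_eq `` {\<omega>} = ae_eq `` {?L y}" if \<omega>: "\<omega> \<in> Opt" for \<omega>
    proof -
      obtain \<omega>' where rep: "representative \<omega> \<omega>'" and mom: "half_moment \<omega>' = ennreal \<mu>" and sq: "half_square \<omega>' < \<infinity>"
        using \<omega> rep_ex unfolding Opt_def by blast
      have m'[measurable]: "\<omega>' \<in> borel_measurable borel" and nn: "\<And>x. 0 \<le> \<omega>' x" using rep by (auto simp: representative_def)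
      have ex: "extremal (lift \<omega>')"
        using penalized_energy_bound(2)[OF rep \<mu> mom sq] \<omega> by (simp add: Opt_def)
      have "lift \<omega>' (t, y) = lift \<omega>' (t, y')" if "norm y = norm y'" for t y y' using that by (simp add: lift_def)
      from extremal_cylindrical[OF ex this] obtain t \<kappa> where
        prof: "AE x in lborel. lift \<omega>' (x + (t, 0)) = (if (norm x)\<^sup>2 < bessel_c0\<^sup>2 / lam
          then \<kappa> * lamb_n0 lam ((norm x)\<^sup>2) / (pi\<^sup>2 * (norm x)\<^sup>2) else 0)" by blast
      define f where "f x = lift \<omega>' (x + (t, 0))" for x
      have fm: "f \<in> borel_measurable borel" unfolding f_def[abs_def] by measurable
      have f0: "0 \<le> f x" for x by (simp add: f_def lift_def nn)
      have prof': "AE x in lborel. f x = (if (norm x)\<^sup>2 < bessel_c0\<^sup>2 / lam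
          then \<kappa> * lamb_n0 lam ((norm x)\<^sup>2) / (pi\<^sup>2 * (norm x)\<^sup>2) else 0)" using prof by (simp add: f_def)
      have totf: "(\<integral>\<^sup>+x. ennreal (f x) \<partial>lborel) = ennreal (4 * pi * \<mu>)"
      proof -
        have "(\<integral>\<^sup>+x. ennreal (f x) \<partial>lborel) = (\<integral>\<^sup>+x. ennreal (lift \<omega>' x) \<partial>lborel)"
          unfolding f_def by (rule nn_integral_lborel_translate[of "\<lambda>x. ennreal (lift \<omega>' x)"]) measurable
        then show ?thesis using \<mu> by (simp add: lift_integrals(1)[OF m' nn] mom ennreal_mult)
      qed
      \<comment> \<open>The factor arrives without a sign. A negative one would force the
        nonnegative \<open>f\<close> to vanish almost everywhere, against its positive mass.\<close>
      have \<kappa>: "0 \<le> \<kappa>"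
      proof (rule ccontr)
        assume neg: "\<not> 0 \<le> \<kappa>"
        have "(\<integral>\<^sup>+x. ennreal (f x) \<partial>lborel) = (\<integral>\<^sup>+x. 0 \<partial>(lborel :: r4 measure))"
        proof (rule nn_integral_cong_AE)
          show "AE x in lborel. ennreal (f x) = 0"
            using prof'
          proof eventually_elim
            case (elim x)
            have "0 \<le> lamb_n0 lam ((norm x)\<^sup>2)" if "(norm x)\<^sup>2 < bessel_c0\<^sup>2 / lam"
              using n0_pos[of "(norm x)\<^sup>2"] that by (cases "x = 0") (auto simp: lamb_n0_def)
            then have "f x \<le> 0" unfolding elim using neg by (auto intro!: divide_nonpos_nonneg mult_nonpos_nonneg)
            then show ?case by (simp add: ennreal_neg)
          qed
        qed
        then show False using totf \<mu> by simp
      qed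
      have Npos: "0 < lamb_N0 lam (bessel_c0\<^sup>2 / lam)" using A by (intro N0_pos) auto
      have "\<kappa> * lamb_N0 lam (bessel_c0\<^sup>2 / lam) = 4 * pi * \<mu>"
        using profile_total(1)[OF \<kappa> prof' fm f0] totf \<mu> \<kappa> Npos by simp
      \<comment> \<open>Both profiles have total mass \<open>4 * pi * \<mu>\<close>, so their
        factors coincide.\<close>
      then have \<kappa>k: "\<kappa> = pi\<^sup>2 * k" using totN Npos by (metis less_irrefl mult_right_cancel)
      have "AE z in lborel. f z = lift R z"
        using prof' liftR unfolding \<kappa>k by eventually_elim simp
      then have "AE z in lborel. \<omega>' ((fst z, norm (snd (z :: r4))) + (t, 0)) / snd (fst z, norm (snd z))
          = R (fst z, norm (snd z)) / snd (fst z, norm (snd z))"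
        by eventually_elim (simp add: f_def lift_def)
      from AE_axisymmetric[of "\<lambda>x. \<omega>' (x + (t, 0)) / snd x = R x / snd x", OF _ this]
      have "AE x in lborel. x \<in> half_plane \<longrightarrow> \<omega>' (x + (t, 0)) / snd x = R x / snd x" by measurable
      then have "AE x in lborel. x \<in> half_plane \<longrightarrow> \<omega>' (x + (t, 0)) = R x"
        by eventually_elim (auto simp: half_plane_def)
      \<comment> \<open>The centring of the profile at \<open>t\<close> is undone, which exhibits
        the minimizer as the translate of the dipole by \<open>(- t, 0)\<close>.\<close>
      from AE_lborel_translate[OF this, of "(- t, 0)"]
      have "AE x in lborel. x + (- t, 0) \<in> half_plane \<longrightarrow> \<omega>' (x + (- t, 0) + (t, 0)) = R (x + (- t, 0))" by measurable
      then have "AE x in half_leb. \<omega>' x = R (x + (- t, 0))"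
        unfolding AE_half_leb by eventually_elim (auto simp: half_plane_def)
      moreover have y: "(- t, 0) \<in> half_plane_boundary" by (simp add: half_plane_boundary_def)
      ultimately have "AE x in half_leb. \<omega> x = ?L (- t, 0) x"
        using rep repL[OF y] unfolding representative_def by (auto elim: eventually_elim2)
      then have "ae_eq `` {\<omega>} = ae_eq `` {?L (- t, 0)}"
        using rep repL[OF y] by (intro ae_eq_class_eqI) (auto simp: representative_def)
      then show ?thesis using y by blast
    qed
    then show "minimizers \<mu> \<nu> lam = {ae_eq `` {\<lambda>x. lamb_dipole lam W (x + y)} | y. y \<in> half_plane_boundary}"
      unfolding min using L_opt by blast
  qed
qed

end
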